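(* Let $\chi\in(0,1]$. There is an open and dense subset $\mathcal{U}$ of $\mathcal{E}^{1,\chi}(\mathbb{T})$ (with the $C^{1,\chi}$ topology) such that every $T\in\mathcal{U}$ has a unique Lyapunov minimizing measure, and this measure is supported on a periodic orbit of $T$.
   Context: $\mathbb{T}=\mathbb{R}/\mathbb{Z}$ is the circle with its standard metric $d$. A $C^1$ map $T:\mathbb{T}\to\mathbb{T}$ is expanding if there are $C>0$ and $\lambda>1$ with $|DT^n(x)|\ge C\lambda^n$ for all $x\in\mathbb{T}$, $n\ge1$. For $\chi\in(0,1]$, $\mathcal{E}^{1,\chi}(\mathbb{T})$ is the space of $C^1$ expanding self-maps of $\mathbb{T}$ whose derivative is $\chi$-Hölder, with the distance $d_{C^{1,\chi}}(S,T)=d_{C^0}(S,T)+d_{C^0}(DS,DT)+\sup_{x\neq y}\frac{|(DS-DT)(x)-(DS-DT)(y)|}{d(x,y)^{\chi}}$. For a $T$-invariant Borel probability measure $\mu$, $\lambda_T(\mu)=\int\log|DT|\,d\mu$; $\alpha(T)$ is the infimum of $\lambda_T(\nu)$ over all $T$-invariant Borel probability measures $\nu$, and $\mu$ is a Lyapunov minimizing measure if $\lambda_T(\mu)=\alpha(T)$. *)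

theory Defs
  imports "HOL-Probability.Probability"
begin

text \<open>The circle T = R/Z is represented via lifts: points are reals, and two reals
  represent the same point iff they differ by an integer. A self-map of the circle is
  represented by a lift F :: real => real with F(x+1) - F(x) an integer for all x.
  Invariant measures are Borel probability measures on the reals concentrated on the
  fundamental domain [0,1), invariant under the induced map x |-> frac (F x).\<close>

definition cdist :: "real \<Rightarrow> real \<Rightarrow> real" where
  "cdist x y = \<bar>(x - y) - real_of_int (round (x - y))\<bar>"

definition circ_map :: "(real \<Rightarrow> real) \<Rightarrow> real \<Rightarrow> real" where
  "circ_map F x = frac (F x)"

definition C1_circle_lift :: "(real \<Rightarrow> real) \<Rightarrow> bool" where
  "C1_circle_lift F \<longleftrightarrow>
     (\<forall>x. F differentiable (at x)) \<and> continuous_on UNIV (deriv F) \<and>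
     (\<forall>x. F (x + 1) - F x \<in> \<int>)"

definition expanding :: "(real \<Rightarrow> real) \<Rightarrow> bool" where
  "expanding F \<longleftrightarrow>
     (\<exists>C>0. \<exists>lam>1. \<forall>x. \<forall>n\<ge>1. \<bar>deriv (F ^^ n) x\<bar> \<ge> C * lam ^ n)"

definition holder_deriv :: "real \<Rightarrow> (real \<Rightarrow> real) \<Rightarrow> bool" where
  "holder_deriv chi F \<longleftrightarrow>
     (\<exists>H. \<forall>x y. \<bar>deriv F x - deriv F y\<bar> \<le> H * cdist x y powr chi)"

definition E1chi :: "real \<Rightarrow> (real \<Rightarrow> real) set" where
  "E1chi chi = {F. C1_circle_lift F \<and> holder_deriv chi F \<and> expanding F}"

definition dC1chi :: "real \<Rightarrow> (real \<Rightarrow> real) \<Rightarrow> (real \<Rightarrow> real) \<Rightarrow> real" where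
  "dC1chi chi S T =
     (SUP x. cdist (S x) (T x))
   + (SUP x. \<bar>deriv S x - deriv T x\<bar>)
   + (SUP p\<in>{(x, y). cdist x y \<noteq> 0}.
        \<bar>(deriv S (fst p) - deriv T (fst p)) - (deriv S (snd p) - deriv T (snd p))\<bar>
          / cdist (fst p) (snd p) powr chi)"

definition open_in_E :: "real \<Rightarrow> (real \<Rightarrow> real) set \<Rightarrow> bool" where
  "open_in_E chi U \<longleftrightarrow> U \<subseteq> E1chi chi \<and>
     (\<forall>T\<in>U. \<exists>e>0. \<forall>S\<in>E1chi chi. dC1chi chi S T < e \<longrightarrow> S \<in> U)"

definition dense_in_E :: "real \<Rightarrow> (real \<Rightarrow> real) set \<Rightarrow> bool" where
  "dense_in_E chi U \<longleftrightarrow>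
     (\<forall>T\<in>E1chi chi. \<forall>e>0. \<exists>S\<in>U. dC1chi chi S T < e)"

definition inv_measures :: "(real \<Rightarrow> real) \<Rightarrow> real measure set" where
  "inv_measures F = {\<mu>. prob_space \<mu> \<and> sets \<mu> = sets borel \<and>
      measure \<mu> {0..<1} = 1 \<and> distr \<mu> borel (circ_map F) = \<mu>}"

definition lyap :: "(real \<Rightarrow> real) \<Rightarrow> real measure \<Rightarrow> real" where
  "lyap F \<mu> = integral\<^sup>L \<mu> (\<lambda>x. ln \<bar>deriv F x\<bar>)"

definition alpha :: "(real \<Rightarrow> real) \<Rightarrow> real" where
  "alpha F = (INF \<nu>\<in>inv_measures F. lyap F \<nu>)"

definition lyap_minimizing :: "(real \<Rightarrow> real) \<Rightarrow> real measure \<Rightarrow> bool" where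
  "lyap_minimizing F \<mu> \<longleftrightarrow> \<mu> \<in> inv_measures F \<and> lyap F \<mu> = alpha F"

definition supported_on_periodic_orbit :: "(real \<Rightarrow> real) \<Rightarrow> real measure \<Rightarrow> bool" where
  "supported_on_periodic_orbit F \<mu> \<longleftrightarrow>
     (\<exists>p\<in>{0..<1}. \<exists>n\<ge>1. (circ_map F ^^ n) p = p \<and>
        measure \<mu> {(circ_map F ^^ k) p | k. k < n} = 1)"

end

theory Submission
  imports Defs
begin

text \<open>
  Write \<open>f = ln \<bar>T'\<bar>\<close>. A lift of an expanding circle map expands the whole line in an adapted
  coordinate \<open>W\<close>, so every closed pseudo-orbit is shadowed by a periodic orbit with an error controlled
  by the sum of the \<open>chi\<close>-th powers of its jumps. This gives a Hoelder sub-action \<open>u\<close> with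
  \<open>f - alpha + u - u \<circ> T \<ge> 0\<close>. On the set where this function vanishes along the whole orbit, the counting
  argument of Bressaud and Quas yields periodic orbits of excess \<open>E = \<Sum> (f - alpha)\<close> smaller than any
  power of the period. Whenever two points of such an orbit are close compared with \<open>E\<close>, the orbit is
  cut in two and the shorter half is kept (Huang, Lian, Ma, Xu, Zhang); the process ends with an orbit
  \<open>O\<close> whose excess is at most \<open>del * s powr chi\<close> and whose points are at distance at least a large multiple of \<open>s\<close>.

  The perturbation decreases the derivative on \<open>O\<close> only: \<open>S = g \<circ> T\<close>, where \<open>g\<close> fixes \<open>O\<close>, is the identity
  outside the \<open>s\<close>-neighbourhood of \<open>O\<close> and satisfies
  \<open>ln g' \<ge> ln g'(O) + (eps / 2) * min (dist x O) s powr chi\<close>. As \<open>T\<close> and \<open>S\<close>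
  differ by \<open>O(s powr chi * dist x O)\<close>, the error \<open>u \<circ> T - u \<circ> S\<close> is absorbed by this gain. An orbit leaving \<open>O\<close>
  must cross the shell at distance \<open>s\<close>, where the gain exceeds all that it could have lost near \<open>O\<close>;
  hence \<open>O\<close> carries the only minimizing measure, and this persists under small perturbations of \<open>S\<close>.
\<close>

section \<open>Expanding lifts and sub-actions\<close>

text \<open>Changing \<open>T\<close> changes the potential and the dynamics together, and a
  sub-action is only \<open>chi\<close>-Hoelder, so moving \<open>T x\<close> by \<open>h\<close>
  may cost \<open>h powr chi\<close>. With \<open>O\<close> fixed and a displacement of order
  \<open>s powr chi * dist x O\<close>, the cost is of order
  \<open>s powr (chi * chi) * dist x O powr chi\<close>. For small \<open>s\<close> this lies below
  the gain \<open>eps * dist x O powr chi\<close>, whatever the period. The bump changes the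
  derivative by about \<open>eps * s powr chi\<close> on the scale \<open>s\<close>, so its
  \<open>chi\<close>-Hoelder seminorm is of order \<open>eps\<close> for every \<open>s\<close>.

  Cutting an orbit multiplies the bound on the excess by a fixed factor, which depends on
  \<open>del\<close> and on the required separation, but it at least halves the period. This is why
  the orbits to be cut must have excess below every power of the period, and why mere existence of
  orbits with small mean excess is not enough.

  The coordinate \<open>W\<close> and all constants of expansion and regularity are shared by a
  whole neighbourhood of \<open>T\<close>. They can therefore be fixed before the orbit and the
  perturbation are chosen, which avoids a circular choice of \<open>s\<close>.\<close>

lemma powr_subadditive:
  fixes a b chi :: real
  assumes "0 \<le> a" "0 \<le> b" "0 < chi" "chi \<le> 1"
  shows "(a + b) powr chi \<le> a powr chi + b powr chi"
proof (cases "a + b = 0")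
  case True
  then show ?thesis using assms by simp
next
  case False
  then have pos: "a + b > 0" using assms by linarith
  have part: "t / (a + b) \<le> (t / (a + b)) powr chi" if "0 \<le> t" "t \<le> a + b" for t
    using powr_mono'[of chi 1 "t / (a + b)"] that pos assms by simp
  have "1 = a / (a + b) + b / (a + b)"
    using pos by (simp add: add_divide_distrib[symmetric])
  also have "\<dots> \<le> (a / (a + b)) powr chi + (b / (a + b)) powr chi"
    using part[of a] part[of b] assms by simp
  also have "\<dots> = (a powr chi + b powr chi) / (a + b) powr chi"
    by (simp add: powr_divide add_divide_distrib)
  finally show ?thesis
    using pos by (simp add: field_simps)
qed

lemma powr_diff_le:
  fixes a b chi :: real
  assumes "0 \<le> a" "0 \<le> b" "0 < chi" "chi \<le> 1"
  shows "\<bar>a powr chi - b powr chi\<bar> \<le> \<bar>a - b\<bar> powr chi"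
proof -
  have *: "x powr chi - y powr chi \<le> \<bar>x - y\<bar> powr chi \<and> y powr chi \<le> x powr chi"
    if "0 \<le> y" "y \<le> x" for x y :: real
    using powr_subadditive[of y "x - y" chi] powr_mono2[of chi y x] that assms by simp
  show ?thesis
    using *[of b a] *[of a b] assms by (cases "b \<le> a") (auto simp: abs_minus_commute)
qed

lemma shift_of_int:
  fixes g :: "real \<Rightarrow> real"
  assumes "\<And>x. g (x + 1) = g x + e"
  shows "g (x + of_int k) = g x + of_int k * e"
proof (induction k rule: int_induct[where k = 0])
  case base
  show ?case by simp
next
  case (step1 i)
  have "g (x + of_int (i + 1)) = g ((x + of_int i) + 1)" by (simp add: add.assoc)
  then show ?case using step1 assms[of "x + of_int i"] by (simp add: algebra_simps)
next
  case (step2 i)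
  have "g (x + of_int i) = g ((x + of_int (i - 1)) + 1)" by (simp add: algebra_simps)
  then show ?case using step2 assms[of "x + of_int (i - 1)"] by (simp add: algebra_simps)
qed

text \<open>Applied to the iterates, with shift \<open>d ^ n\<close>, and to \<open>F ^^ n\<close>
  minus the identity, with shift \<open>d ^ n - 1\<close>; the second use is the source of all
  periodic points below.\<close>

lemma shift_surj:
  fixes g :: "real \<Rightarrow> real"
  assumes cont: "continuous_on UNIV g" and shift: "\<And>x. g (x + 1) = g x + e" and "e \<noteq> 0"
  shows "\<exists>x. g x = y"
proof -
  define j where "j = \<lfloor>(y - g 0) / e\<rfloor>"
  have gj: "g (of_int j) = g 0 + of_int j * e" "g (of_int (j + 1)) = g 0 + of_int (j + 1) * e"
    using shift_of_int[of g e 0 j, OF shift] shift_of_int[of g e 0 "j + 1", OF shift] by simp_all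
  have j: "of_int j \<le> (y - g 0) / e" "(y - g 0) / e < of_int (j + 1)"
    unfolding j_def by linarith+
  have c: "continuous_on {of_int j..of_int (j + 1)} g"
    using cont continuous_on_subset by blast
  show ?thesis
  proof (cases "e > 0")
    case True
    then have "g (of_int j) \<le> y" "y \<le> g (of_int (j + 1))"
      using j gj by (simp_all add: field_simps)
    then show ?thesis using IVT'[of g "of_int j" y "of_int (j + 1)"] c by auto
  next
    case False
    then have "e < 0" using assms by simp
    then have "y \<le> g (of_int j)" "g (of_int (j + 1)) \<le> y"
      using j gj by (simp_all add: field_simps)
    then show ?thesis using IVT2'[of g "of_int (j + 1)" y "of_int j"] c by auto
  qed
qed

text \<open>Distances are measured in the coordinate \<open>W\<close>, which stays fixed when the lift \<open>F\<close> is perturbed;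
  the potential \<open>f\<close> will be \<open>ln \<bar>F'\<bar>\<close>.\<close>

locale lift_system =
  fixes F W f :: "real \<Rightarrow> real" and d :: int and c M lam Lam chi K :: real
  assumes chi: "0 < chi" "chi \<le> 1"
    and F_cont: "continuous_on UNIV F"
    and F_shift: "\<And>x. F (x + 1) = F x + of_int d"
    and W_shift: "\<And>x. W (x + 1) = W x + c"
    and W_lower: "\<And>x y. \<bar>x - y\<bar> \<le> \<bar>W x - W y\<bar>"
    and W_upper: "\<And>x y. \<bar>W x - W y\<bar> \<le> M * \<bar>x - y\<bar>"
    and W_expand: "\<And>x y. lam * \<bar>W x - W y\<bar> \<le> \<bar>W (F x) - W (F y)\<bar>"
    and W_lip: "\<And>x y. \<bar>W (F x) - W (F y)\<bar> \<le> Lam * \<bar>W x - W y\<bar>"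
    and lam: "1 < lam"
    and f_shift: "\<And>x. f (x + 1) = f x"
    and f_holder: "\<And>x y. \<bar>f x - f y\<bar> \<le> K * \<bar>W x - W y\<bar> powr chi"
begin

definition D :: "real \<Rightarrow> real \<Rightarrow> real" where "D x y = \<bar>W x - W y\<bar>"

lemma D_nonneg [simp]: "0 \<le> D x y" by (simp add: D_def)
lemma D_self [simp]: "D x x = 0" by (simp add: D_def)
lemma D_sym: "D x y = D y x" by (simp add: D_def abs_minus_commute)
lemma D_triangle: "D x z \<le> D x y + D y z" by (simp add: D_def)
lemma D_lower: "\<bar>x - y\<bar> \<le> D x y" using W_lower by (simp add: D_def)
lemma D_upper: "D x y \<le> M * \<bar>x - y\<bar>" using W_upper by (simp add: D_def)
lemma D_expand: "lam * D x y \<le> D (F x) (F y)" using W_expand by (simp add: D_def)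
lemma D_lip: "D (F x) (F y) \<le> Lam * D x y" using W_lip by (simp add: D_def)

lemma D_eq_0 [simp]: "D x y = 0 \<longleftrightarrow> x = y"
  using D_lower[of x y] by auto

lemma W_shift_int: "W (x + of_int k) = W x + of_int k * c"
  by (rule shift_of_int) (rule W_shift)

lemma D_shift [simp]: "D (x + of_int k) (y + of_int k) = D x y"
  by (simp add: D_def W_shift_int)

lemma F_shift_int: "F (x + of_int k) = F x + of_int (d * k)"
  using shift_of_int[of F "of_int d" x k, OF F_shift] by (simp add: mult.commute)

lemma f_shift_int [simp]: "f (x + of_int k) = f x"
  using shift_of_int[of f 0 x k] f_shift by simp

lemma iter_shift: "(F ^^ n) (x + of_int k) = (F ^^ n) x + of_int (d ^ n * k)"
proof (induction n)
  case (Suc n)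
  show ?case by (simp only: funpow.simps comp_apply Suc F_shift_int) (simp add: mult.assoc)
qed simp

lemma iter_cont: "continuous_on UNIV (F ^^ n)"
proof (induction n)
  case (Suc n)
  have "continuous_on UNIV (\<lambda>x. F ((F ^^ n) x))"
    by (rule continuous_on_compose2[OF F_cont Suc]) auto
  then show ?case by (simp add: comp_def)
qed (simp add: id_def)

lemma M_ge_1: "1 \<le> M"
  using W_lower[of 1 0] W_upper[of 1 0] by simp

lemma K_nonneg: "0 \<le> K"
  using f_holder[of 1 0] W_lower[of 1 0]
  by (smt (verit, best) mult_neg_pos powr_gt_zero)

lemma c_ge_1: "1 \<le> \<bar>c\<bar>"
  using W_lower[of 1 0] W_shift[of 0] by simp

text \<open>Compare 0 and 1: \<open>W\<close> differs by \<open>c\<close> between them and by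
  \<open>d * c\<close> between their images.\<close>

lemma d_abs: "lam \<le> \<bar>of_int d\<bar>"
proof -
  have "D (F 0 + of_int d) (F 0) = \<bar>of_int d\<bar> * \<bar>c\<bar>"
    by (simp add: D_def W_shift_int abs_mult)
  moreover have "D (0 + 1) 0 = \<bar>c\<bar>" by (simp only: D_def W_shift add_diff_cancel_left')
  ultimately have "lam * \<bar>c\<bar> \<le> \<bar>of_int d\<bar> * \<bar>c\<bar>"
    using D_expand[of "0 + 1" 0] by (simp only: F_shift)
  then show ?thesis using c_ge_1 by (auto simp: mult_le_cancel_right)
qed

lemma d_pow_ne_1: assumes "1 \<le> n" shows "d ^ n \<noteq> 1"
proof -
  have "\<bar>d\<bar> > 1" using d_abs lam by linarith
  then have "1 < \<bar>d\<bar> ^ n" using assms by (intro one_less_power) auto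
  then show ?thesis by (auto simp flip: power_abs)
qed

lemma Lam_ge: "lam \<le> Lam"
proof -
  have "0 < D 1 0" using D_lower[of 1 0] by simp
  moreover have "lam * D 1 0 \<le> Lam * D 1 0" using D_expand[of 1 0] D_lip[of 1 0] by simp
  ultimately show ?thesis by simp
qed

lemma iter_surj: "\<exists>x. (F ^^ n) x = y"
proof (rule shift_surj[of _ "of_int (d ^ n)"])
  show "(F ^^ n) (x + 1) = (F ^^ n) x + of_int (d ^ n)" for x
    using iter_shift[of n x 1] by simp
  show "of_int (d ^ n) \<noteq> (0::real)"
    using d_abs lam by auto
qed (rule iter_cont)

lemma iter_expand: "lam ^ n * D x y \<le> D ((F ^^ n) x) ((F ^^ n) y)"
proof (induction n)
  case (Suc n)
  have "lam ^ Suc n * D x y = lam * (lam ^ n * D x y)" by simp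
  also have "\<dots> \<le> lam * D ((F ^^ n) x) ((F ^^ n) y)"
    using Suc lam by (intro mult_left_mono) auto
  also have "\<dots> \<le> D ((F ^^ Suc n) x) ((F ^^ Suc n) y)" using D_expand by simp
  finally show ?case .
qed simp

section \<open>Closing pseudo-orbits\<close>

definition lamc :: real where "lamc = lam powr chi - 1"

lemma lamc_pos: "0 < lamc"
  using lam chi by (simp add: lamc_def gr_one_powr)

text \<open>Raising the one-step expansion to the power \<open>chi\<close> and summing over one period, the shifted
  sum cancels: this is why no constant depends on the length of the pseudo-orbit.\<close>

lemma closing:
  assumes n: "1 \<le> n" and per: "x n = x 0 + of_int k"
  shows "\<exists>p. (F ^^ n) p = p + of_int k \<and>
    (\<Sum>i<n. D ((F ^^ i) p) (x i) powr chi) \<le> (\<Sum>i<n. D (F (x i)) (x (Suc i)) powr chi) / lamc"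
proof -
  \<comment> \<open>\<open>p\<close> gets the same translation \<open>k\<close> as the pseudo-orbit.
    Both are then compared on the line without choosing inverse branches, and their distance is the
    same at times 0 and \<open>n\<close>.\<close>
  have "\<exists>p. (F ^^ n) p - p = of_int k"
  proof (rule shift_surj[of _ "of_int (d ^ n) - 1"])
    show "continuous_on UNIV (\<lambda>p. (F ^^ n) p - p)"
      by (intro continuous_intros iter_cont)
    show "(F ^^ n) (x + 1) - (x + 1) = (F ^^ n) x - x + (of_int (d ^ n) - 1)" for x
      using iter_shift[of n x 1] by simp
    show "of_int (d ^ n) - 1 \<noteq> (0::real)"
      using d_pow_ne_1[OF n] by (metis eq_iff_diff_eq_0 of_int_eq_1_iff)
  qed
  then obtain p where p: "(F ^^ n) p = p + of_int k" by (metis add.commute diff_add_cancel)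
  define a where "a i = D ((F ^^ i) p) (x i) powr chi" for i
  define b where "b i = D (F (x i)) (x (Suc i)) powr chi" for i
  have step: "lam powr chi * a i \<le> a (Suc i) + b i" for i
  proof -
    have "lam * D ((F ^^ i) p) (x i) \<le> D (F ((F ^^ i) p)) (F (x i))" by (rule D_expand)
    also have "\<dots> \<le> D ((F ^^ Suc i) p) (x (Suc i)) + D (F (x i)) (x (Suc i))"
      using D_triangle[of "F ((F ^^ i) p)" "F (x i)" "x (Suc i)"] by (simp add: D_sym)
    finally have "(lam * D ((F ^^ i) p) (x i)) powr chi
        \<le> (D ((F ^^ Suc i) p) (x (Suc i)) + D (F (x i)) (x (Suc i))) powr chi"
      using chi lam by (intro powr_mono2) auto
    also have "\<dots> \<le> a (Suc i) + b i"
      unfolding a_def b_def using chi by (intro powr_subadditive) auto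
    finally show ?thesis by (simp add: a_def powr_mult)
  qed
  have "a n = a 0" by (simp add: a_def p per)
  then have cyc: "(\<Sum>i<n. a (Suc i)) = (\<Sum>i<n. a i)"
    using sum.lessThan_Suc_shift[of a n] by simp
  have "lam powr chi * (\<Sum>i<n. a i) \<le> (\<Sum>i<n. a (Suc i)) + (\<Sum>i<n. b i)"
    unfolding sum_distrib_left sum.distrib[symmetric] by (intro sum_mono step)
  then have "lamc * (\<Sum>i<n. a i) \<le> (\<Sum>i<n. b i)"
    by (simp add: cyc lamc_def algebra_simps)
  then have "(\<Sum>i<n. a i) \<le> (\<Sum>i<n. b i) / lamc"
    using lamc_pos by (simp add: field_simps)
  then show ?thesis using p unfolding a_def b_def by blast
qed

section \<open>Birkhoff sums and the minimal periodic mean\<close>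

definition S :: "nat \<Rightarrow> real \<Rightarrow> real" where "S n x = (\<Sum>i<n. f ((F ^^ i) x))"

definition per :: "nat \<Rightarrow> real \<Rightarrow> bool" where
  "per n p \<longleftrightarrow> 1 \<le> n \<and> (\<exists>k::int. (F ^^ n) p = p + of_int k)"

lemma S_shift [simp]: "S n (x + of_int k) = S n x"
  by (simp only: S_def iter_shift f_shift_int)

lemma S_add: "S (m + n) x = S m x + S n ((F ^^ m) x)"
proof -
  have "S (m + n) x = (\<Sum>i<m. f ((F ^^ i) x)) + (\<Sum>i<n. f ((F ^^ (m + i)) x))"
    by (induction n) (simp_all add: S_def)
  then show ?thesis by (simp add: S_def funpow_add add.commute[of m])
qed

definition Q :: real where "Q = K / lamc"

lemma Q_nonneg: "0 \<le> Q"
  using K_nonneg lamc_pos by (simp add: Q_def)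

text \<open>The segment of \<open>y\<close> is closed by a single jump, at its last step. The bound
  of \<open>closing\<close> reduces to that jump, so the error of the Birkhoff sum does not grow
  with \<open>n\<close>.\<close>

lemma closing_segment:
  assumes n: "1 \<le> n"
  shows "\<exists>p. per n p \<and> \<bar>S n p - S n y\<bar> \<le> Q * D ((F ^^ n) y) (y + of_int k) powr chi"
proof -
  define x where "x i = (if i < n then (F ^^ i) y else y + of_int k)" for i
  have "x n = x 0 + of_int k" using n by (simp add: x_def)
  from closing[OF n this] obtain p where p: "(F ^^ n) p = p + of_int k"
    and le: "(\<Sum>i<n. D ((F ^^ i) p) (x i) powr chi) \<le> (\<Sum>i<n. D (F (x i)) (x (Suc i)) powr chi) / lamc"
    by blast
  have "(\<Sum>i<n. D (F (x i)) (x (Suc i)) powr chi)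
      = (\<Sum>i<n. if i = n - 1 then D ((F ^^ n) y) (y + of_int k) powr chi else 0)"
  proof (intro sum.cong refl)
    fix i assume i: "i \<in> {..<n}"
    show "D (F (x i)) (x (Suc i)) powr chi = (if i = n - 1 then D ((F ^^ n) y) (y + of_int k) powr chi else 0)"
    proof (cases "i = n - 1")
      case True
      then have "Suc i = n" using n by simp
      then show ?thesis using True i by (simp add: x_def flip: funpow.simps(2)[of "n - 1", simplified])
         (metis comp_apply funpow.simps(2) \<open>Suc i = n\<close>)
    next
      case False
      then have "Suc i < n" using i by auto
      then show ?thesis using False i by (simp add: x_def)
    qed
  qed
  also have "\<dots> = D ((F ^^ n) y) (y + of_int k) powr chi" using n by simp
  finally have sum: "(\<Sum>i<n. D (F (x i)) (x (Suc i)) powr chi) = D ((F ^^ n) y) (y + of_int k) powr chi" .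
  have "\<bar>S n p - S n y\<bar> \<le> (\<Sum>i<n. \<bar>f ((F ^^ i) p) - f ((F ^^ i) y)\<bar>)"
    unfolding S_def sum_subtractf[symmetric] by (rule sum_abs)
  also have "\<dots> \<le> (\<Sum>i<n. K * D ((F ^^ i) p) (x i) powr chi)"
    using f_holder by (intro sum_mono) (auto simp: x_def D_def)
  also have "\<dots> \<le> K * (D ((F ^^ n) y) (y + of_int k) powr chi / lamc)"
    unfolding sum_distrib_left[symmetric] using le sum K_nonneg by (intro mult_left_mono) auto
  finally show ?thesis using p n unfolding per_def Q_def by auto
qed

text \<open>The mean is minimised over periodic orbits only; no measure enters before the good
  periodic orbit has been found.\<close>

definition alph :: real where "alph = (INF q\<in>{(n, p). per n p}. S (fst q) (snd q) / fst q)"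

lemma holder_bounded:
  assumes "\<And>x y. \<bar>g x - g y\<bar> \<le> C * D x y powr chi" and shift: "\<And>x k. g (x + of_int k) = g x"
  shows "\<bar>g x\<bar> \<le> \<bar>g 0\<bar> + \<bar>C\<bar> * M powr chi"
proof -
  have "g x = g (frac x + of_int \<lfloor>x\<rfloor>)" by (simp add: frac_def)
  then have "g x = g (frac x)" by (simp only: shift)
  have "D (frac x) 0 \<le> M * \<bar>frac x - 0\<bar>" by (rule D_upper)
  also have "\<dots> \<le> M * 1" using M_ge_1 frac_ge_0[of x] frac_lt_1[of x] by (intro mult_left_mono) auto
  finally have "D (frac x) 0 powr chi \<le> M powr chi" using chi by (intro powr_mono2) auto
  then have "\<bar>C\<bar> * D (frac x) 0 powr chi \<le> \<bar>C\<bar> * M powr chi" by (rule mult_left_mono) simp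
  moreover have "C * D (frac x) 0 powr chi \<le> \<bar>C\<bar> * D (frac x) 0 powr chi" by (rule mult_right_mono) auto
  ultimately show ?thesis using assms(1)[of "frac x" 0] \<open>g x = g (frac x)\<close> by linarith
qed

lemma f_D_holder: "\<bar>f x - f y\<bar> \<le> K * D x y powr chi"
  using f_holder by (simp add: D_def)

lemma per_exists: "\<exists>p. per 1 p"
  using closing_segment[of 1] by auto

lemma means_bdd_below: "bdd_below ((\<lambda>q. S (fst q) (snd q) / fst q) ` {(n, p). per n p})"
proof (rule bdd_belowI2)
  fix q assume q: "q \<in> {(n, p). per n p}"
  obtain n p where [simp]: "q = (n, p)" by (cases q)
  have n: "1 \<le> n" using q by (auto simp: per_def)
  define C where "C = \<bar>f 0\<bar> + \<bar>K\<bar> * M powr chi"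
  have C: "\<bar>f x\<bar> \<le> C" for x unfolding C_def using f_D_holder f_shift_int by (rule holder_bounded)
  have "- C \<le> f x" for x using C[of x] by linarith
  then have "(\<Sum>i<n. - C) \<le> S n p" unfolding S_def by (intro sum_mono)
  then show "- (\<bar>f 0\<bar> + \<bar>K\<bar> * M powr chi) \<le> S (fst q) (snd q) / fst q"
    unfolding C_def[symmetric] using n by (simp add: field_simps)
qed

section \<open>The excess and the sub-action\<close>

definition E :: "nat \<Rightarrow> real \<Rightarrow> real" where "E n x = S n x - real n * alph"

lemma E_shift [simp]: "E n (x + of_int k) = E n x" by (simp add: E_def)
lemma E_add: "E (m + n) x = E m x + E n ((F ^^ m) x)"
  by (simp add: E_def S_add algebra_simps)

lemma E_per_nonneg: assumes "per n p" shows "0 \<le> E n p"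
proof -
  have "alph \<le> S n p / n"
    unfolding alph_def using cINF_lower[OF means_bdd_below, of "(n, p)"] assms by simp
  moreover have "1 \<le> n" using assms by (simp add: per_def)
  ultimately show ?thesis by (simp add: E_def field_simps)
qed

lemma E_per_small:
  assumes "0 < e" shows "\<exists>n p. per n p \<and> E n p < real n * e"
proof -
  have "\<exists>q\<in>{(n, p). per n p}. S (fst q) (snd q) / fst q < alph + e"
    unfolding alph_def using per_exists assms
    by (subst cINF_less_iff[symmetric]) (use means_bdd_below in auto)
  then obtain n p where np: "per n p" "S n p / n < alph + e" by auto
  then have "1 \<le> n" by (simp add: per_def)
  then have "E n p < real n * e" using np by (simp add: E_def field_simps)
  then show ?thesis using np by blast
qed

lemma E_closing_segment:
  assumes "1 \<le> n"
  shows "\<exists>p. per n p \<and> \<bar>E n p - E n y\<bar> \<le> Q * D ((F ^^ n) y) (y + of_int k) powr chi"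
  using closing_segment[OF assms, of y k] by (simp add: E_def)

text \<open>After an integer translation every segment closes with a jump of length at most 1 on the
  line, and the closing orbit has nonnegative excess.\<close>

lemma E_lower: "- (Q * M powr chi) \<le> E n y"
proof (cases "n = 0")
  case True
  then show ?thesis using Q_nonneg by (simp add: E_def S_def)
next
  case False
  define k where "k = \<lfloor>(F ^^ n) y - y\<rfloor>"
  obtain p where p: "per n p" "\<bar>E n p - E n y\<bar> \<le> Q * D ((F ^^ n) y) (y + of_int k) powr chi"
    using E_closing_segment[of n y k] False by auto
  have "D ((F ^^ n) y) (y + of_int k) \<le> M * \<bar>(F ^^ n) y - (y + of_int k)\<bar>" by (rule D_upper)
  also have "\<dots> \<le> M * 1" unfolding k_def using M_ge_1 by (intro mult_left_mono; linarith)
  finally have "D ((F ^^ n) y) (y + of_int k) powr chi \<le> M powr chi"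
    using chi by (intro powr_mono2) auto
  then have "Q * D ((F ^^ n) y) (y + of_int k) powr chi \<le> Q * M powr chi"
    using Q_nonneg by (rule mult_left_mono)
  then show ?thesis using p E_per_nonneg[OF p(1)] by linarith
qed

text \<open>Least excess of an orbit segment arriving at \<open>x\<close> on the circle, the empty
  segment included. \<open>E_lower\<close> makes it finite.\<close>

definition u :: "real \<Rightarrow> real" where
  "u x = (INF q\<in>{(n, y). \<exists>k::int. (F ^^ n) y = x + of_int k}. E (fst q) (snd q))"

lemma u_bdd: "bdd_below ((\<lambda>q. E (fst q) (snd q)) ` A)"
  by (rule bdd_belowI2[of _ "- (Q * M powr chi)"]) (rule E_lower)

lemma u_le: assumes "(F ^^ n) y = x + of_int k" shows "u x \<le> E n y"
  unfolding u_def using cINF_lower[OF u_bdd, of "(n, y)"] assms by auto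

lemma u_greatest: assumes "\<And>n y k. (F ^^ n) y = x + of_int k \<Longrightarrow> b \<le> E n y" shows "b \<le> u x"
  unfolding u_def
proof (rule cINF_greatest)
  have "(0, x) \<in> {(n, y). \<exists>k::int. (F ^^ n) y = x + of_int k}"
    by (auto intro: exI[of _ 0])
  then show "{(n, y). \<exists>k::int. (F ^^ n) y = x + of_int k} \<noteq> {}" by blast
qed (use assms in auto)

lemma u_shift_int [simp]: "u (x + of_int k) = u x"
proof (rule antisym)
  show "u (x + of_int k) \<le> u x"
  proof (rule u_greatest)
    fix n y and l :: int assume "(F ^^ n) y = x + of_int l"
    then show "u (x + of_int k) \<le> E n y" by (intro u_le[of _ _ _ "l - k"]) simp
  qed
  show "u x \<le> u (x + of_int k)"
  proof (rule u_greatest)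
    fix n y and l :: int assume "(F ^^ n) y = x + of_int k + of_int l"
    then show "u x \<le> E n y" by (intro u_le[of _ _ _ "l + k"]) simp
  qed
qed

text \<open>Read backwards from the common end time, the \<open>chi\<close>-th powers of the
  distances decay geometrically: \<open>lamc * a i\<close> is at most
  \<open>a (Suc i) - a i\<close>, and the sum telescopes.\<close>

lemma S_diff_backward:
  "\<bar>S n y - S n y'\<bar> \<le> Q * D ((F ^^ n) y) ((F ^^ n) y') powr chi"
proof -
  define a where "a i = D ((F ^^ i) y) ((F ^^ i) y') powr chi" for i
  have step: "lam powr chi * a i \<le> a (Suc i)" for i
    using powr_mono2[OF _ _ D_expand[of "(F ^^ i) y" "(F ^^ i) y'"], of chi] chi lam
    by (simp add: a_def powr_mult)
  have "lamc * (\<Sum>i<n. a i) \<le> a n - a 0" for n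
  proof (induction n)
    case (Suc n)
    then show ?case using step[of n] by (simp add: lamc_def algebra_simps)
  qed simp
  moreover have "0 \<le> a 0" by (simp add: a_def)
  ultimately have le: "(\<Sum>i<n. a i) \<le> a n / lamc"
    using lamc_pos by (simp add: field_simps) (smt (verit))
  have "\<bar>S n y - S n y'\<bar> \<le> (\<Sum>i<n. \<bar>f ((F ^^ i) y) - f ((F ^^ i) y')\<bar>)"
    unfolding S_def sum_subtractf[symmetric] by (rule sum_abs)
  also have "\<dots> \<le> (\<Sum>i<n. K * a i)"
    using f_holder by (intro sum_mono) (auto simp: a_def D_def)
  also have "\<dots> \<le> K * (a n / lamc)"
    unfolding sum_distrib_left[symmetric] using le K_nonneg by (rule mult_left_mono)
  finally show ?thesis by (simp add: Q_def a_def)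
qed

text \<open>By \<open>iter_surj\<close>, a segment arriving at \<open>x\<close> has a companion
  arriving at \<open>x'\<close> with the same translation, and their excesses differ by no more than
  the distance at the end allows.\<close>

lemma u_holder: "\<bar>u x - u x'\<bar> \<le> Q * D x x' powr chi"
proof -
  have "u x' - Q * D x x' powr chi \<le> u x" for x x'
  proof (rule u_greatest)
    fix n y and k :: int assume y: "(F ^^ n) y = x + of_int k"
    obtain y' where y': "(F ^^ n) y' = x' + of_int k" using iter_surj by blast
    have "u x' \<le> E n y'" using y' by (rule u_le)
    also have "\<dots> \<le> E n y + Q * D ((F ^^ n) y) ((F ^^ n) y') powr chi"
      using S_diff_backward[of n y y'] by (simp add: E_def)
    finally show "u x' - Q * D x x' powr chi \<le> E n y" by (simp add: y y')
  qed
  from this[of x x'] this[of x' x] show ?thesis by (simp add: D_sym abs_le_iff)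
qed

definition fbar :: "real \<Rightarrow> real" where "fbar x = f x - alph + u x - u (F x)"

text \<open>A segment arriving at \<open>x\<close>, prolonged by one step, is a competitor in the
  infimum for \<open>u (F x)\<close>.\<close>

lemma fbar_nonneg: "0 \<le> fbar x"
proof -
  have "u (F x) - (f x - alph) \<le> u x"
  proof (rule u_greatest)
    fix n y and k :: int assume y: "(F ^^ n) y = x + of_int k"
    then have "(F ^^ Suc n) y = F x + of_int (d * k)" by (simp add: F_shift_int)
    then have "u (F x) \<le> E (Suc n) y" by (rule u_le)
    also have "\<dots> = E n y + (f x - alph)"
      using y E_add[of n 1 y] by (simp add: E_def S_def)
    finally show "u (F x) - (f x - alph) \<le> E n y" by simp
  qed
  then show ?thesis by (simp add: fbar_def)
qed

lemma fbar_sum: "(\<Sum>i<n. fbar ((F ^^ i) x)) = E n x + u x - u ((F ^^ n) x)"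
  by (induction n) (simp_all add: fbar_def E_def S_def algebra_simps)

lemma fbar_shift [simp]: "fbar (x + of_int k) = fbar x"
  by (simp only: fbar_def f_shift_int u_shift_int F_shift_int)

definition Kbar :: real where "Kbar = K + Q + Q * Lam powr chi"

lemma Kbar_nonneg: "0 \<le> Kbar"
  using K_nonneg Q_nonneg by (simp add: Kbar_def)

lemma fbar_holder: "\<bar>fbar x - fbar y\<bar> \<le> Kbar * D x y powr chi"
proof -
  have "D (F x) (F y) powr chi \<le> (Lam * D x y) powr chi"
    using chi D_lip by (intro powr_mono2) auto
  then have "Q * D (F x) (F y) powr chi \<le> Q * (Lam powr chi * D x y powr chi)"
    using Q_nonneg by (intro mult_left_mono) (simp_all add: powr_mult)
  then show ?thesis
    using f_D_holder[of x y] u_holder[of x y] u_holder[of "F x" "F y"] unfolding fbar_def Kbar_def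
    by (simp add: algebra_simps)
qed

lemma holder_continuous: 
  assumes "\<And>x y. \<bar>g x - g y\<bar> \<le> C * D x y powr chi" shows "continuous_on UNIV g"
proof (rule continuous_at_imp_continuous_on, intro ballI)
  fix x
  have C: "C \<ge> 0" using assms[of 1 0] D_lower[of 1 0]
    by (smt (verit, best) mult_neg_pos powr_gt_zero)
  have "((\<lambda>y. C * (M * \<bar>y - x\<bar>) powr chi) \<longlongrightarrow> C * (M * \<bar>x - x\<bar>) powr chi) (at x)"
    using chi M_ge_1 by (intro tendsto_intros) auto
  then have lim: "((\<lambda>y. C * (M * \<bar>y - x\<bar>) powr chi) \<longlongrightarrow> 0) (at x)" using chi by simp
  have "((\<lambda>y. g y - g x) \<longlongrightarrow> 0) (at x)"
  proof (rule Lim_null_comparison[OF _ lim], rule always_eventually, rule allI)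
    fix y
    have "D y x powr chi \<le> (M * \<bar>y - x\<bar>) powr chi"
      using chi D_upper by (intro powr_mono2) auto
    then show "norm (g y - g x) \<le> C * (M * \<bar>y - x\<bar>) powr chi"
      using assms[of y x] C by (smt (verit) mult_left_mono real_norm_def)
  qed
  then show "isCont g x" by (simp add: LIM_zero_iff isCont_def)
qed

end

section \<open>Periodic orbits of small excess\<close>

lemma sorted_wrt_strict_unique:
  assumes "transp P" "irreflp P" "sorted_wrt P xs" "sorted_wrt P ys" "set xs = set ys"
  shows "xs = ys"
  using assms(3-5)
proof (induction xs arbitrary: ys)
  case (Cons x xs)
  then obtain y ys' where ys: "ys = y # ys'" by (cases ys) auto
  have irr: "\<not> P a a" for a using assms(2) by (simp add: irreflp_def)
  have "x = y"
  proof (rule ccontr)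
    assume "x \<noteq> y"
    then have "P x y" "P y x" using Cons.prems ys by auto
    then have "P x x" using assms(1) by (blast dest: transpD)
    then show False using irr by blast
  qed
  moreover have "x \<notin> set xs" "y \<notin> set ys'" using Cons.prems ys irr by auto
  then have "set xs = set ys'" using Cons.prems ys \<open>x = y\<close> by auto
  then have "xs = ys'" using Cons ys by auto
  ultimately show ?case using ys by simp
qed simp

lemma relpow_subset: "(R :: ('a \<times> 'a) set) \<subseteq> R' \<Longrightarrow> R ^^ m \<subseteq> R' ^^ m"
  by (induction m) (auto intro: relcomp_mono)

text \<open>In an acyclic relation a walk is determined by the set of its vertices. This is the argument
  of Bressaud and Quas bounding the length of the shortest cycle.\<close>

lemma cycle_of_many_walks:
  assumes fin: "finite V"
    and walks: "\<And>xs. xs \<in> X \<Longrightarrow> length xs = k \<and> set xs \<subseteq> V \<and> successively (\<lambda>a b. (a, b) \<in> R) xs"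
    and many: "card V choose k < card X"
  shows "\<exists>a m. 1 \<le> m \<and> m \<le> k * k \<and> (a, a) \<in> R ^^ m"
proof (rule ccontr)
  assume no: "\<not> ?thesis"
  have sorted: "sorted_wrt (\<lambda>a b. (a, b) \<in> (R \<inter> set xs \<times> set xs)\<^sup>+) xs
      \<and> irrefl ((R \<inter> set xs \<times> set xs)\<^sup>+)" if "xs \<in> X" for xs
  proof -
    let ?R = "R \<inter> set xs \<times> set xs"
    have "successively (\<lambda>a b. (a, b) \<in> ?R\<^sup>+) xs"
      using walks[OF that]
      by (auto intro!: successively_mono[of "\<lambda>a b. (a, b) \<in> R" xs "\<lambda>a b. (a, b) \<in> ?R\<^sup>+"])
    then have 1: "sorted_wrt (\<lambda>a b. (a, b) \<in> ?R\<^sup>+) xs"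
      by (subst successively_conv_sorted_wrt[symmetric])
         (auto simp: transp_def intro: trancl_trans)
    have finR: "finite ?R" by simp
    \<comment> \<open>The relation is restricted to the vertices of one walk. A cycle of a finite
      relation can be taken no longer than its number of pairs, whence the bound
      \<open>k * k\<close>.\<close>
    have "card ?R \<le> card (set xs \<times> set xs)" by (intro card_mono) auto
    also have "\<dots> \<le> k * k"
      using walks[OF that] card_length[of xs] by (simp add: card_cartesian_product mult_le_mono)
    finally have card: "card ?R \<le> k * k" .
    have "(a, a) \<notin> ?R\<^sup>+" for a
    proof
      assume "(a, a) \<in> ?R\<^sup>+"
      then obtain m where m: "0 < m" "m \<le> card ?R" "(a, a) \<in> ?R ^^ m"
        unfolding trancl_finite_eq_relpow[OF finR] by auto
      then have "(a, a) \<in> R ^^ m" using relpow_subset[of ?R R m] by blast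
      moreover have "1 \<le> m" "m \<le> k * k" using m card by simp_all
      ultimately show False using no by blast
    qed
    then show ?thesis using 1 by (simp add: irrefl_def)
  qed
  have "inj_on set X"
  proof (rule inj_onI)
    fix xs ys assume xy: "xs \<in> X" "ys \<in> X" "set xs = set ys"
    show "xs = ys"
      by (rule sorted_wrt_strict_unique[of "\<lambda>a b. (a, b) \<in> (R \<inter> set xs \<times> set xs)\<^sup>+"])
         (use sorted[OF xy(1)] sorted[OF xy(2)] xy(3) in
           \<open>auto simp: transp_def irreflp_def irrefl_def intro: trancl_trans\<close>)
  qed
  moreover have "set ` X \<subseteq> {A. A \<subseteq> V \<and> card A = k}"
  proof clarify
    fix xs assume xs: "xs \<in> X"
    have "distinct xs"
      using sorted[OF xs] unfolding sorted_wrt_iff_nth_less distinct_conv_nth irrefl_def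
      by (metis nat_neq_iff)
    then show "set xs \<subseteq> V \<and> card (set xs) = k" using walks[OF xs] distinct_card by blast
  qed
  moreover have "card {A. A \<subseteq> V \<and> card A = k} = card V choose k" using fin by (rule n_subsets)
  moreover have "finite {A. A \<subseteq> V \<and> card A = k}" using fin by simp
  ultimately show False using many
    by (metis card_image card_mono not_le)
qed

lemma fact_ge_exp: "(real k / exp 1) ^ k \<le> fact k"
proof -
  have "real k ^ k /\<^sub>R fact k \<le> exp (real k)"
  proof -
    have "(\<Sum>n\<in>{k}. real k ^ n /\<^sub>R fact n) \<le> (\<Sum>n. real k ^ n /\<^sub>R fact n)"
      by (rule sum_le_suminf) (rule summable_exp_generic, auto)
    then show ?thesis by (simp add: exp_def)
  qed
  then have "real k ^ k \<le> exp (real k) * fact k" by (simp add: field_simps)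
  moreover have "exp (real k) = exp 1 ^ k" by (simp add: exp_of_nat_mult[symmetric])
  ultimately show ?thesis by (simp add: power_divide field_simps)
qed

text \<open>Since \<open>fact k\<close> is at least \<open>(k / e) ^ k\<close>, there are at most
  \<open>(e * P / k) ^ k\<close> subsets. In the application \<open>P\<close> counts the blocks of
  length \<open>N\<close> and \<open>t\<close> is \<open>N * ent\<close>, so
  \<open>P * exp (- t)\<close>, and with it the required \<open>k\<close>, is at most of order
  \<open>exp (N * eta)\<close> for a freely chosen \<open>eta\<close>.\<close>

lemma choose_less_growth:
  assumes k: "exp 1 * real P * exp (- t) < real k"
  shows "real (P choose k) < exp (real k * t)"
proof -
  have kpos: "0 < k" using k by (cases k) (auto simp: mult_less_0_iff not_less)
  have "real P < real k / exp 1 * exp t"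
    using k by (simp add: exp_minus field_simps)
  then have "real P ^ k < (real k / exp 1 * exp t) ^ k"
    using kpos by (intro power_strict_mono) auto
  also have "\<dots> = (real k / exp 1) ^ k * exp (real k * t)"
    by (simp only: power_mult_distrib exp_of_nat_mult)
  also have "\<dots> \<le> fact k * exp (real k * t)"
    using fact_ge_exp by (intro mult_right_mono) auto
  finally have lt: "real P ^ k < fact k * exp (real k * t)" .
  have "real ((P choose k) * fact k) \<le> real (P ^ k)"
    using binomial_fact_pow by (rule of_nat_mono)
  then have "fact k * real (P choose k) \<le> real P ^ k" by (simp add: mult.commute)
  then have "fact k * real (P choose k) < fact k * exp (real k * t)" using lt by linarith
  then show ?thesis by (rule mult_left_less_imp_less) simp
qed

lemma funpow_funpow: "(g ^^ i) ((g ^^ a) x) = (g ^^ (i + a)) x"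
  by (simp add: funpow_add)

section \<open>Words read along orbits of zero excess\<close>

context lift_system
begin

lemma per_orbit:
  assumes "per n p"
  shows "per n ((F ^^ i) p)" "E n ((F ^^ i) p) = E n p" "u ((F ^^ n) p) = u p"
    "(\<Sum>a<n. fbar ((F ^^ a) p)) = E n p"
proof -
  obtain k where k: "(F ^^ n) p = p + of_int k" "1 \<le> n" using assms by (auto simp: per_def)
  have "(F ^^ n) ((F ^^ i) p) = (F ^^ i) ((F ^^ n) p)"
    by (metis add.commute comp_apply funpow_add)
  then show "per n ((F ^^ i) p)" using k by (auto simp: per_def iter_shift simp del: of_int_mult of_int_power)
  have "E n p + E i ((F ^^ n) p) = E i p + E n ((F ^^ i) p)"
    by (metis E_add add.commute)
  then show "E n ((F ^^ i) p) = E n p" by (simp add: k)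
  show "u ((F ^^ n) p) = u p" by (simp add: k)
  then show "(\<Sum>a<n. fbar ((F ^^ a) p)) = E n p" by (simp add: fbar_sum)
qed

text \<open>Along these orbits the sums of \<open>f - alph\<close> reduce to the bounded coboundary
  of \<open>u\<close>. For pseudo-orbits glued from such segments, the excess after closing is
  controlled by the jumps alone.\<close>

definition Zs :: "real set" where "Zs = {x. \<forall>i. fbar ((F ^^ i) x) = 0}"

lemma Zs_invariant: "x \<in> Zs \<Longrightarrow> (F ^^ i) x \<in> Zs"
  by (auto simp: Zs_def funpow_funpow)

text \<open>Averaging along a periodic orbit of small mean excess: the \<open>n\<close> windows of
  length \<open>j\<close> count each of its terms \<open>j\<close> times, so their sums add up to
  \<open>j * E n p\<close> and some window does not exceed the average.\<close>

lemma fbar_small_segment: "\<exists>x\<in>{0..1}. \<forall>i<j. fbar ((F ^^ i) x) \<le> 1 / real (Suc j)"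
proof -
  define e where "e = 1 / (real (Suc j) * real (Suc j))"
  have "real j * e = real j / real (Suc j) * (1 / real (Suc j))" by (simp add: e_def)
  also have "\<dots> \<le> 1 * (1 / real (Suc j))" by (intro mult_right_mono) auto
  finally have e: "0 < e" "real j * e \<le> 1 / real (Suc j)" by (simp_all add: e_def)
  obtain n p where np: "per n p" "E n p < real n * e" using E_per_small[OF e(1)] by blast
  define g where "g a = (\<Sum>i<j. fbar ((F ^^ i) ((F ^^ a) p)))" for a
  have "(\<Sum>a<n. g a) = (\<Sum>i<j. \<Sum>a<n. fbar ((F ^^ a) ((F ^^ i) p)))"
    unfolding g_def by (subst sum.swap) (simp add: funpow_funpow add.commute)
  also have "\<dots> = real j * E n p"
    using per_orbit(4)[OF per_orbit(1)[OF np(1)]] per_orbit(2)[OF np(1)] by simp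
  finally have g: "(\<Sum>a<n. g a) = real j * E n p" .
  have "\<exists>a<n. g a \<le> real j * e"
  proof (rule ccontr)
    assume "\<not> ?thesis"
    moreover have "0 \<in> {..<n}" using np(1) by (simp add: per_def)
    ultimately have "(\<Sum>a<n. real j * e) < (\<Sum>a<n. g a)"
      by (intro sum_strict_mono) auto
    moreover have "real j * E n p \<le> real j * (real n * e)" using np(2) by (intro mult_left_mono) auto
    ultimately show False using g by (simp add: algebra_simps)
  qed
  then obtain a where a: "g a \<le> real j * e" by blast
  define x where "x = frac ((F ^^ a) p)"
  have x: "(F ^^ a) p = x + of_int \<lfloor>(F ^^ a) p\<rfloor>" by (simp add: x_def frac_def)
  have "fbar ((F ^^ i) x) \<le> 1 / real (Suc j)" if "i < j" for i
  proof -
    have "fbar ((F ^^ i) x) = fbar ((F ^^ i) ((F ^^ a) p))"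
      by (subst x) (simp only: iter_shift fbar_shift)
    also have "\<dots> \<le> g a"
      unfolding g_def using that fbar_nonneg by (intro member_le_sum) auto
    finally show ?thesis using a e by linarith
  qed
  moreover have "x \<in> {0..1}" unfolding x_def using frac_ge_0 frac_lt_1 by (auto intro: less_imp_le)
  ultimately show ?thesis by blast
qed

text \<open>Take a limit of starting points of ever longer windows. Each fixed iterate is controlled
  by all late windows, with bounds tending to 0.\<close>

lemma Zs_nonempty: "Zs \<noteq> {}"
proof -
  obtain X where X: "\<And>j. X j \<in> {0..1}" "\<And>j i. i < j \<Longrightarrow> fbar ((F ^^ i) (X j)) \<le> 1 / real (Suc j)"
    using fbar_small_segment by metis
  obtain x r where xr: "x \<in> {0..1}" "strict_mono r" "(X \<circ> r) \<longlonglongrightarrow> x"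
    using compact_Icc[of 0 "1::real"] X(1) unfolding compact_def by blast
  have "fbar ((F ^^ i) x) = 0" for i
  proof -
    have "continuous_on UNIV (\<lambda>x. fbar ((F ^^ i) x))"
      by (rule continuous_on_compose2[OF holder_continuous iter_cont]) (auto intro: fbar_holder)
    then have "(\<lambda>j. fbar ((F ^^ i) ((X \<circ> r) j))) \<longlonglongrightarrow> fbar ((F ^^ i) x)"
      using xr(3) continuous_on_tendsto_compose[of UNIV "\<lambda>x. fbar ((F ^^ i) x)" "X \<circ> r" x sequentially] by simp
    moreover have "(\<lambda>j. 1 / real (Suc (r j))) \<longlonglongrightarrow> 0"
      using LIMSEQ_subseq_LIMSEQ[OF LIMSEQ_Suc[OF lim_1_over_n] xr(2)] by (simp add: comp_def)
    moreover have "eventually (\<lambda>j. fbar ((F ^^ i) ((X \<circ> r) j)) \<le> 1 / real (Suc (r j))) sequentially"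
    proof (rule eventually_sequentiallyI[of "Suc i"])
      fix j assume "Suc i \<le> j"
      then have "i < r j" using seq_suble[OF xr(2), of j] by simp
      then show "fbar ((F ^^ i) ((X \<circ> r) j)) \<le> 1 / real (Suc (r j))" using X(2) by simp
    qed
    ultimately have "fbar ((F ^^ i) x) \<le> 0"
      by (intro tendsto_le[OF sequentially_bot]) auto
    then show ?thesis using fbar_nonneg by (simp add: antisym)
  qed
  then show ?thesis by (auto simp: Zs_def)
qed

text \<open>So many arcs that points of one arc, at distance below \<open>1 / nlet\<close>, have
  images closer than \<open>1 - 1 / nlet\<close>. If the images again share a letter, no nonzero
  integer translation can separate them.\<close>

definition nlet :: nat where "nlet = nat \<lceil>Lam * M + 2\<rceil>"

lemma nlet_gt: "Lam * M + 1 < real nlet" "0 < nlet"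
proof -
  have "0 \<le> Lam * M" using Lam_ge lam M_ge_1 by simp
  then show "Lam * M + 1 < real nlet" unfolding nlet_def by linarith
  then show "0 < nlet" using \<open>0 \<le> Lam * M\<close> by (cases nlet) auto
qed

definition letter :: "real \<Rightarrow> int" where "letter x = \<lfloor>real nlet * frac x\<rfloor>"
definition word :: "nat \<Rightarrow> real \<Rightarrow> int list" where "word N x = map (\<lambda>i. letter ((F ^^ i) x)) [0..<N]"

lemma letter_shift [simp]: "letter (x + of_int k) = letter x"
  by (simp add: letter_def frac_def)

lemma letter_close: assumes "letter x = letter y" shows "\<exists>l::int. \<bar>x - (y + of_int l)\<bar> < 1 / real nlet"
proof -
  have "\<bar>real nlet * frac x - real nlet * frac y\<bar> < 1"
    using assms unfolding letter_def by linarith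
  then have "real nlet * \<bar>frac x - frac y\<bar> < 1" by (simp add: abs_mult flip: right_diff_distrib)
  then have "\<bar>frac x - frac y\<bar> < 1 / real nlet" using nlet_gt by (simp add: field_simps)
  then show ?thesis by (intro exI[of _ "\<lfloor>x\<rfloor> - \<lfloor>y\<rfloor>"]) (simp add: frac_def algebra_simps)
qed

lemma word_nth: "i < N \<Longrightarrow> word N x ! i = letter ((F ^^ i) x)"
  by (simp add: word_def)

text \<open>Equal letters keep two suitable lifts within an arc length at the times 0 to
  \<open>N\<close>, with no change of translation, and expansion carries closeness at time
  \<open>N\<close> back to time 0. Hence words of length \<open>Suc N\<close> give the exponent
  \<open>N\<close>.\<close>

lemma word_close:
  assumes w: "word (Suc N) x = word (Suc N) y"
  shows "\<exists>l::int. D x (y + of_int l) \<le> M / lam ^ N"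
proof -
  have same: "letter ((F ^^ i) x) = letter ((F ^^ i) y)" if "i \<le> N" for i
    using w word_nth[of i "Suc N"] that by (metis le_imp_less_Suc)
  obtain l :: int where l: "\<bar>x - (y + of_int l)\<bar> < 1 / real nlet"
    using letter_close[OF same[of 0]] by auto
  have close: "i \<le> N \<Longrightarrow> \<bar>(F ^^ i) x - (F ^^ i) (y + of_int l)\<bar> < 1 / real nlet" for i
  proof (induction i)
    case (Suc i)
    let ?a = "(F ^^ i) x" and ?b = "(F ^^ i) (y + of_int l)"
    have "\<bar>F ?a - F ?b\<bar> \<le> Lam * D ?a ?b" using D_lower D_lip by (rule order_trans)
    also have "\<dots> \<le> Lam * (M * \<bar>?a - ?b\<bar>)" using Lam_ge lam by (intro mult_left_mono D_upper) auto
    also have "\<dots> \<le> Lam * M * (1 / real nlet)"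
      unfolding mult.assoc[symmetric] using Suc Lam_ge lam M_ge_1 by (intro mult_left_mono) auto
    finally have near: "\<bar>F ?a - F ?b\<bar> \<le> Lam * M / real nlet" by simp
    have "letter (F ?a) = letter (F ?b)"
    proof -
      have "F ?b = (F ^^ Suc i) y + of_int (d ^ Suc i * l)" using iter_shift[of "Suc i" y l] by simp
      then have "letter (F ?b) = letter ((F ^^ Suc i) y)" by (simp only: letter_shift)
      then show ?thesis using same[OF Suc.prems] by simp
    qed
    then obtain l' :: int where l': "\<bar>F ?a - (F ?b + of_int l')\<bar> < 1 / real nlet"
      using letter_close by blast
    have "\<bar>of_int l'\<bar> < Lam * M / real nlet + 1 / real nlet" using near l' by linarith
    also have "\<dots> < 1" using nlet_gt by (simp add: field_simps)
    finally have "l' = 0" by linarith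
    then show ?case using l' by simp
  qed (use l in simp)
  have "lam ^ N * D x (y + of_int l) \<le> D ((F ^^ N) x) ((F ^^ N) (y + of_int l))" by (rule iter_expand)
  also have "\<dots> \<le> M * \<bar>(F ^^ N) x - (F ^^ N) (y + of_int l)\<bar>" by (rule D_upper)
  also have "\<dots> \<le> M * 1"
  proof (intro mult_left_mono)
    have "1 / real nlet \<le> 1" using nlet_gt by simp
    then show "\<bar>(F ^^ N) x - (F ^^ N) (y + of_int l)\<bar> \<le> 1" using close[of N] by simp
  qed (use M_ge_1 in simp)
  finally have "D x (y + of_int l) \<le> M / lam ^ N" using lam by (simp add: field_simps)
  then show ?thesis by blast
qed

lemma word_append: "word (a + b) x = word a x @ word b ((F ^^ a) x)"
proof -
  have "[0..<a + b] = [0..<a] @ map (\<lambda>i. i + a) [0..<b]"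
    using upt_add_eq_append[of 0 a b] by (simp add: map_add_upt add.commute)
  then show ?thesis by (simp add: word_def funpow_add)
qed

lemma word_concat: "word (k * N) x = concat (map (\<lambda>i. word N ((F ^^ (i * N)) x)) [0..<k])"
  by (induction k) (simp_all add: word_def[of 0] word_append add.commute[of N])

definition pw :: "nat \<Rightarrow> nat" where "pw N = card (word N ` Zs)"

lemma words_finite: "finite (word N ` Zs)"
proof (rule finite_subset)
  show "word N ` Zs \<subseteq> {xs. set xs \<subseteq> {0..<int nlet} \<and> length xs = N}"
  proof (clarsimp simp: word_def)
    fix x i
    have "real nlet * frac x < real nlet * 1" for x
      using frac_lt_1 nlet_gt by (intro mult_strict_left_mono) auto
    then show "0 \<le> letter ((F ^^ i) x) \<and> letter ((F ^^ i) x) < int nlet"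
      by (simp add: letter_def floor_less_iff)
  qed
  show "finite {xs. set xs \<subseteq> {0..<int nlet} \<and> length xs = N}"
    by (rule finite_lists_length_eq) simp
qed

lemma pw_pos: "0 < pw N"
  using Zs_nonempty words_finite by (simp add: pw_def card_gt_0_iff)

lemma pw_mult: "pw (a + b) \<le> pw a * pw b"
proof -
  have "word (a + b) ` Zs \<subseteq> (\<lambda>(v, w). v @ w) ` (word a ` Zs \<times> word b ` Zs)"
    using Zs_invariant by (auto simp: word_append)
  then have "pw (a + b) \<le> card ((\<lambda>(v, w). v @ w) ` (word a ` Zs \<times> word b ` Zs))"
    unfolding pw_def using words_finite by (intro card_mono) auto
  also have "\<dots> \<le> card (word a ` Zs \<times> word b ` Zs)"
    using words_finite by (intro card_image_le) auto
  finally show ?thesis by (simp add: pw_def card_cartesian_product)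
qed

lemma pw_power: "pw (j * N) \<le> pw N ^ j"
proof (induction j)
  case 0
  have "word 0 ` Zs = {[]}" using Zs_nonempty by (auto simp: word_def)
  then show ?case by (simp add: pw_def)
next
  case (Suc j)
  have "pw (Suc j * N) \<le> pw N * pw (j * N)" using pw_mult[of N "j * N"] by simp
  also have "\<dots> \<le> pw N * pw N ^ j" using Suc by simp
  finally show ?case by simp
qed

text \<open>Exponential growth rate of the words of \<open>Zs\<close>. Being an infimum, it bounds
  every \<open>pw N\<close> from below; submultiplicativity provides matching upper bounds for
  arbitrarily large \<open>N\<close>.\<close>

definition ent :: real where "ent = (INF N\<in>{1..}. ln (real (pw N)) / real N)"

lemma ent_bdd: "bdd_below ((\<lambda>N. ln (real (pw N)) / real N) ` {1..})"
  using pw_pos by (intro bdd_belowI2[of _ 0]) (auto simp: Suc_leI)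

lemma ent_lower: assumes "1 \<le> N" shows "exp (real N * ent) \<le> real (pw N)"
proof -
  have "ent \<le> ln (real (pw N)) / real N"
    unfolding ent_def using ent_bdd assms by (intro cINF_lower) auto
  then have "real N * ent \<le> ln (real (pw N))" using assms by (simp add: field_simps)
  then show ?thesis using pw_pos by (simp add: ln_ge_iff)
qed

lemma ent_upper: assumes "0 < eta" shows "\<exists>N\<ge>N0. 1 \<le> N \<and> real (pw N) \<le> exp (real N * (ent + eta))"
proof -
  have "\<exists>N\<in>{1..}. ln (real (pw N)) / real N < ent + eta"
    unfolding ent_def using ent_bdd assms by (subst cINF_less_iff[symmetric]) auto
  then obtain N where N: "1 \<le> N" "ln (real (pw N)) / real N < ent + eta" by auto
  then have "ln (real (pw N)) \<le> real N * (ent + eta)" by (simp add: field_simps)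
  then have le: "real (pw N) \<le> exp (real N * (ent + eta))" using pw_pos
    by (metis exp_le_cancel_iff exp_ln of_nat_0_less_iff)
  \<comment> \<open>The upper bound passes to all multiples of \<open>N\<close>, and this multiple
    lies beyond \<open>N0\<close>.\<close>
  define j where "j = Suc N0"
  have "real (pw (j * N)) \<le> real (pw N) ^ j" using pw_power[of j N] by (metis of_nat_mono of_nat_power)
  also have "\<dots> \<le> exp (real N * (ent + eta)) ^ j" using le by (intro power_mono) auto
  also have "\<dots> = exp (real (j * N) * (ent + eta))" by (simp add: exp_of_nat_mult[symmetric] mult.assoc)
  finally have "real (pw (j * N)) \<le> exp (real (j * N) * (ent + eta))" .
  moreover have *: "Suc N0 \<le> j * N"
    unfolding j_def using mult_le_mono2[OF N(1), of "Suc N0"] by (simp only: mult_1_right)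
  then have "N0 \<le> j * N" by simp
  moreover have "1 \<le> j * N" using * by (simp only: One_nat_def)
  ultimately show ?thesis by blast
qed

text \<open>Consecutive blocks of length \<open>N\<close> along an orbit of \<open>Zs\<close>.
  Different edges may come from different orbits, so a cycle yields only a pseudo-orbit.\<close>

definition link :: "nat \<Rightarrow> (int list \<times> int list) set" where
  "link N = {(word N z, word N ((F ^^ N) z)) | z. z \<in> Zs}"

text \<open>Cutting words of length \<open>k * N\<close> into blocks produces walks, at least
  \<open>exp (k * N * ent)\<close> of them. This exceeds the number of \<open>k\<close>-element sets
  of blocks, so the walks cannot all be determined by their vertex sets.\<close>

lemma short_cycle:
  assumes N: "1 \<le> N" and k: "exp 1 * real (pw N) * exp (- (real N * ent)) < real k"
  shows "\<exists>a m. 1 \<le> m \<and> m \<le> k * k \<and> (a, a) \<in> link N ^^ m"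
proof -
  let ?walk = "\<lambda>z. map (\<lambda>i. word N ((F ^^ (i * N)) z)) [0..<k]"
  show ?thesis
  proof (rule cycle_of_many_walks[of "word N ` Zs" "?walk ` Zs"])
    show "finite (word N ` Zs)" by (rule words_finite)
    have kpos: "1 \<le> k" using k by (cases k) (auto simp: mult_less_0_iff not_less)
    have "word (k * N) ` Zs = concat ` ?walk ` Zs"
      by (simp add: image_image word_concat)
    moreover have "finite (?walk ` Zs)"
      by (rule finite_subset[OF _ finite_lists_length_eq[OF words_finite[of N], of k]])
         (use Zs_invariant in auto)
    ultimately have le: "pw (k * N) \<le> card (?walk ` Zs)"
      unfolding pw_def by (metis card_image_le)
    have "real (pw N choose k) < exp (real k * (real N * ent))" using k by (rule choose_less_growth)
    also have "\<dots> \<le> real (pw (k * N))" using ent_lower[of "k * N"] N kpos by (simp add: mult.assoc)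
    finally have "pw N choose k < pw (k * N)" by simp
    then show "card (word N ` Zs) choose k < card (?walk ` Zs)"
      using le by (simp add: pw_def)
    fix xs assume "xs \<in> ?walk ` Zs"
    then obtain z where z: "z \<in> Zs" and xs: "xs = map (\<lambda>i. word N ((F ^^ (i * N)) z)) [0..<k]" by blast
    have "(word N ((F ^^ (i * N)) z), word N ((F ^^ (Suc i * N)) z)) \<in> link N" for i
      unfolding link_def using Zs_invariant[OF z, of "i * N"] by (auto simp: funpow_add)
    then show "length xs = k \<and> set xs \<subseteq> word N ` Zs \<and> successively (\<lambda>a b. (a, b) \<in> link N) xs"
      using Zs_invariant[OF z] by (auto simp: xs successively_conv_nth)
  qed
qed

text \<open>Segments of \<open>Zs\<close> realising the edges have equal words where they meet, so
  they form a closed pseudo-orbit with \<open>m\<close> small jumps. As \<open>fbar\<close> vanishes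
  on it, the excess of the closing orbit is bounded by the Hoelder sum of the distances between the
  two.\<close>

lemma cycle_orbit:
  assumes m: "1 \<le> m" and cyc: "(a, a) \<in> link (Suc N) ^^ m"
  shows "\<exists>p. per (m * Suc N) p \<and> E (m * Suc N) p \<le> Kbar / lamc * (real m * (M / lam ^ N) powr chi)"
proof -
  define L where "L = Suc N"
  have L: "0 < L" by (simp add: L_def)
  have cyc: "(a, a) \<in> link L ^^ m" using cyc by (simp add: L_def)
  obtain w where w: "w 0 = a" "w m = a" "\<And>i. i < m \<Longrightarrow> (w i, w (Suc i)) \<in> link L"
    using cyc unfolding relpow_fun_conv by blast
  have "\<exists>z. z \<in> Zs \<and> word L z = w i \<and> word L ((F ^^ L) z) = w (Suc i)" if "i < m" for i
    using w(3)[OF that] unfolding link_def by auto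
  then obtain z0 where z0: "\<And>i. i < m \<Longrightarrow> z0 i \<in> Zs \<and> word L (z0 i) = w i \<and> word L ((F ^^ L) (z0 i)) = w (Suc i)"
    by metis
  \<comment> \<open>The default value closes the cycle: \<open>z m\<close> is
    \<open>z0 0\<close>.\<close>
  define z where "z i = (if i < m then z0 i else z0 0)" for i
  have zZ: "z i \<in> Zs" for i using z0 m by (auto simp: z_def)
  have "word L ((F ^^ L) (z i)) = word L (z (Suc i))" if "i < m" for i
  proof (cases "Suc i < m")
    case True
    then show ?thesis using z0[of i] z0[of "Suc i"] that by (simp add: z_def)
  next
    case False
    then have "Suc i = m" using that by simp
    then show ?thesis using z0[of i] z0[of 0] that w m by (simp add: z_def)
  qed
  then have "\<exists>l::int. D ((F ^^ L) (z i)) (z (Suc i) + of_int l) \<le> M / lam ^ N" if "i < m" for i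
    using word_close[of N] that by (auto simp: L_def)
  then obtain l :: "nat \<Rightarrow> int" where l: "\<And>i. i < m \<Longrightarrow> D ((F ^^ L) (z i)) (z (Suc i) + of_int (l i)) \<le> M / lam ^ N"
    by metis
  \<comment> \<open>Accumulated translations that bring consecutive lifts close on the line;
    crossing a block multiplies an earlier translation by \<open>d ^ L\<close>.\<close>
  define t where "t = rec_nat (0::int) (\<lambda>i s. l i + d ^ L * s)"
  have t: "t 0 = 0" "t (Suc i) = l i + d ^ L * t i" for i by (simp_all add: t_def)
  define y where "y i = z i + of_int (t i)" for i
  have y: "D ((F ^^ L) (y i)) (y (Suc i)) \<le> M / lam ^ N" if "i < m" for i
  proof -
    have "(F ^^ L) (y i) = (F ^^ L) (z i) + of_int (d ^ L * t i)" unfolding y_def by (rule iter_shift)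
    moreover have "y (Suc i) = (z (Suc i) + of_int (l i)) + of_int (d ^ L * t i)" by (simp add: y_def t)
    ultimately have "D ((F ^^ L) (y i)) (y (Suc i)) = D ((F ^^ L) (z i)) (z (Suc i) + of_int (l i))"
      by (simp only: D_shift)
    then show ?thesis using l[OF that] by simp
  qed
  define x where "x n = (F ^^ (n mod L)) (y (n div L))" for n
  have "x (m * L) = x 0 + of_int (t m)"
    using m L by (simp add: x_def y_def t z_def)
  moreover have "1 \<le> m * L" using m L by (simp add: Suc_leI)
  ultimately obtain p where p: "(F ^^ (m * L)) p = p + of_int (t m)"
    and le: "(\<Sum>i<m * L. D ((F ^^ i) p) (x i) powr chi) \<le> (\<Sum>i<m * L. D (F (x i)) (x (Suc i)) powr chi) / lamc"
    using closing[of "m * L" x "t m"] by blast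
  have jump: "D (F (x (i * L + j))) (x (Suc (i * L + j))) powr chi
      \<le> (if j = N then (M / lam ^ N) powr chi else 0)" if "i < m" "j < L" for i j
  proof -
    have 1: "x (i * L + j) = (F ^^ j) (y i)" if "j < L" for i j using that by (simp add: x_def)
    show ?thesis
    proof (cases "j = N")
      case True
      have "Suc (i * L + j) = Suc i * L + 0" using True by (simp add: L_def)
      then have "x (Suc (i * L + j)) = y (Suc i)" using 1[of 0 "Suc i"] L by (metis funpow_0)
      then have "D (F (x (i * L + j))) (x (Suc (i * L + j))) = D ((F ^^ L) (y i)) (y (Suc i))"
        using 1[OF that(2)] True by (simp add: L_def)
      then show ?thesis using True y[OF that(1)] chi by (auto intro!: powr_mono2)
    next
      case False
      then have "Suc j < L" using that by (simp add: L_def)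
      then have "x (Suc (i * L + j)) = (F ^^ Suc j) (y i)"
        using 1[of "Suc j" i] by simp
      then show ?thesis using 1[OF that(2)] False chi by simp
    qed
  qed
  have "(\<Sum>i<m * L. D (F (x i)) (x (Suc i)) powr chi)
      = (\<Sum>i<m. \<Sum>n\<in>{i * L..<i * L + L}. D (F (x n)) (x (Suc n)) powr chi)"
    by (rule sum.nat_group[symmetric])
  also have "\<dots> = (\<Sum>i<m. \<Sum>j<L. D (F (x (i * L + j))) (x (Suc (i * L + j))) powr chi)"
  proof (rule sum.cong[OF refl])
    fix i
    show "(\<Sum>n\<in>{i * L..<i * L + L}. D (F (x n)) (x (Suc n)) powr chi) = (\<Sum>j<L. D (F (x (i * L + j))) (x (Suc (i * L + j))) powr chi)"
      by (rule sum.reindex_bij_witness[of _ "\<lambda>j. i * L + j" "\<lambda>n. n - i * L"]) auto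
  qed
  also have "\<dots> \<le> (\<Sum>i<m. \<Sum>j<L. if j = N then (M / lam ^ N) powr chi else 0)"
    using jump by (intro sum_mono) auto
  also have "\<dots> = real m * (M / lam ^ N) powr chi" by (simp add: L_def)
  finally have jumps: "(\<Sum>i<m * L. D (F (x i)) (x (Suc i)) powr chi) \<le> real m * (M / lam ^ N) powr chi" .
  have per: "per (m * L) p" using p m L by (auto simp: per_def)
  have fx: "fbar (x n) = 0" for n
  proof -
    have "fbar (x n) = fbar ((F ^^ (n mod L)) (z (n div L)))"
      by (simp only: x_def y_def iter_shift fbar_shift)
    then show ?thesis using zZ by (auto simp: Zs_def)
  qed
  have "E (m * L) p = (\<Sum>i<m * L. fbar ((F ^^ i) p))" using per_orbit(4)[OF per] by simp
  also have "\<dots> \<le> (\<Sum>i<m * L. Kbar * D ((F ^^ i) p) (x i) powr chi)"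
  proof (rule sum_mono)
    fix i
    show "fbar ((F ^^ i) p) \<le> Kbar * D ((F ^^ i) p) (x i) powr chi"
      using fbar_holder[of "(F ^^ i) p" "x i"] fx by simp
  qed
  also have "\<dots> \<le> Kbar * (real m * (M / lam ^ N) powr chi / lamc)"
    unfolding sum_distrib_left[symmetric]
    using lamc_pos Kbar_nonneg
    by (intro mult_left_mono order_trans[OF le divide_right_mono[OF jumps]]) auto
  finally show ?thesis using per by (auto simp: L_def)
qed

end

section \<open>Excess against period and separation\<close>

lemma power_exp_small:
  fixes b C t :: real
  assumes "0 < b" "0 < t"
  shows "\<exists>N0::nat. \<forall>N\<ge>N0. C * real N ^ A * exp (- (b * real N)) \<le> t"
proof -
  have "((\<lambda>x::real. x ^ A / exp x) \<longlongrightarrow> 0) at_top" by (rule tendsto_power_div_exp_0)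
  moreover have "filterlim (\<lambda>N. b * real N) at_top sequentially"
    using assms by (intro filterlim_tendsto_pos_mult_at_top[OF tendsto_const] filterlim_real_sequentially)
  ultimately have "(\<lambda>N. (b * real N) ^ A / exp (b * real N)) \<longlonglongrightarrow> 0"
    by (rule filterlim_compose)
  from tendsto_mult[OF tendsto_const[of "C / b ^ A"] this]
  have "(\<lambda>N. C / b ^ A * ((b * real N) ^ A / exp (b * real N))) \<longlonglongrightarrow> 0" by simp
  moreover have "C / b ^ A * ((b * real N) ^ A / exp (b * real N)) = C * real N ^ A * exp (- (b * real N))" for N
    using assms by (simp add: power_mult_distrib exp_minus field_simps)
  ultimately have "(\<lambda>N. C * real N ^ A * exp (- (b * real N))) \<longlonglongrightarrow> 0" by simp
  then have "eventually (\<lambda>N. C * real N ^ A * exp (- (b * real N)) < t) sequentially"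
    using assms by (intro order_tendstoD) auto
  then show ?thesis unfolding eventually_sequentially by (meson less_imp_le)
qed

context lift_system
begin

text \<open>The period is \<open>m * N\<close> with \<open>m\<close> at most of order
  \<open>exp (2 * N * eta)\<close> and \<open>eta\<close> free, while the excess is at most of order
  \<open>m * exp (- (2 * b * N))\<close>. A positive bound \<open>t'\<close> is recorded because the
  excess itself may vanish, and the scale \<open>s\<close> will be computed from this bound.\<close>

lemma approximating_orbits:
  assumes t: "0 < t"
  shows "\<exists>n p t'. per n p \<and> 0 < t' \<and> E n p \<le> t' \<and> real n ^ A * t' \<le> t"
proof -
  \<comment> \<open>Half of the decay rate of \<open>(M / lam ^ N') powr chi\<close>: one factor
    \<open>exp (- (b * N))\<close> pays for \<open>m ^ Suc A\<close>, the other for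
    \<open>N ^ A\<close>. The value of \<open>eta\<close> is tuned to the first payment.\<close>
  define b where "b = chi * ln lam / 2"
  define eta where "eta = b / (2 * real (Suc A))"
  define C1 where "C1 = Kbar / lamc + 1"
  define C2 where "C2 = 16 ^ Suc A * C1 * (M * lam) powr chi"
  have b: "0 < b" using chi lam by (simp add: b_def)
  have eta: "0 < eta" "real (Suc A) * (2 * eta) = b" using b by (simp_all add: eta_def del: of_nat_Suc)
  have C1: "0 < C1" "Kbar / lamc \<le> C1"
    using Kbar_nonneg lamc_pos by (auto simp: C1_def intro: add_nonneg_pos)
  obtain N0 where N0: "\<And>N. N \<ge> N0 \<Longrightarrow> C2 * real N ^ A * exp (- (b * real N)) \<le> t"
    using power_exp_small[OF b t] by blast
  obtain N where N: "N \<ge> N0" "1 \<le> N" "real (pw N) \<le> exp (real N * (ent + eta))"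
    using ent_upper[OF eta(1)] by blast
  obtain N' where N': "N = Suc N'" using N(2) by (cases N) auto
  define X where "X = exp 1 * real (pw N) * exp (- (real N * ent))"
  define k where "k = nat \<lfloor>X\<rfloor> + 1"
  have "X \<le> 3 * exp (real N * (ent + eta)) * exp (- (real N * ent))"
    unfolding X_def using N(3) exp_le by (intro mult_mono) auto
  also have "\<dots> = 3 * exp (real N * eta)" by (simp add: exp_add[symmetric] algebra_simps)
  finally have X: "X \<le> 3 * exp (real N * eta)" .
  have X0: "0 \<le> X" by (simp add: X_def)
  have kX: "X < real k" "real k \<le> X + 1" unfolding k_def using X0 by linarith+
  have "1 \<le> exp (real N * eta)" using eta by simp
  then have k: "real k \<le> 4 * exp (real N * eta)" using X kX by linarith
  obtain a m where m: "1 \<le> m" "m \<le> k * k" "(a, a) \<in> link N ^^ m"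
    using short_cycle[OF N(2), of k] kX by (auto simp: X_def)
  obtain p where p: "per (m * N) p" "E (m * N) p \<le> Kbar / lamc * (real m * (M / lam ^ N') powr chi)"
    using cycle_orbit[OF m(1), of a N'] m(3) by (auto simp: N')
  define t' where "t' = C1 * (real m * (M / lam ^ N') powr chi)"
  have "E (m * N) p \<le> t'"
    unfolding t'_def using C1 by (intro order_trans[OF p(2)] mult_right_mono) auto
  moreover have "0 < t'" unfolding t'_def using C1 m M_ge_1 lam by simp
  moreover have "real (m * N) ^ A * t' \<le> t"
  proof -
    have "real m \<le> real k * real k" using m(2) by (metis of_nat_le_iff of_nat_mult)
    also have "\<dots> \<le> (4 * exp (real N * eta)) * (4 * exp (real N * eta))"
      using k by (intro mult_mono) auto
    also have "\<dots> = 16 * exp (real N * (2 * eta))" by (simp add: exp_add[symmetric] algebra_simps)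
    finally have "real m ^ Suc A \<le> (16 * exp (real N * (2 * eta))) ^ Suc A" by (intro power_mono) auto
    also have "\<dots> = 16 ^ Suc A * exp (real (Suc A) * (real N * (2 * eta)))"
      by (simp only: power_mult_distrib exp_of_nat_mult)
    also have "real (Suc A) * (real N * (2 * eta)) = b * real N"
      unfolding eta(2)[symmetric] by (simp add: algebra_simps)
    finally have m': "real m ^ Suc A \<le> 16 ^ Suc A * exp (b * real N)" .
    have "M / lam ^ N' = M * lam / lam ^ N" using lam by (simp add: N')
    moreover have "(lam ^ N) powr chi = exp (b * real N) * exp (b * real N)"
      using lam by (simp add: powr_def ln_realpow exp_add[symmetric] b_def algebra_simps)
    ultimately have pw: "(M / lam ^ N') powr chi = (M * lam) powr chi * exp (- (b * real N)) * exp (- (b * real N))"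
      by (simp add: powr_divide exp_minus field_simps)
    have "real (m * N) ^ A * t' = real m ^ Suc A * (real N ^ A * C1 * (M / lam ^ N') powr chi)"
      by (simp add: t'_def power_mult_distrib)
    also have "\<dots> \<le> 16 ^ Suc A * exp (b * real N) * (real N ^ A * C1 * (M / lam ^ N') powr chi)"
      using m' C1 by (intro mult_right_mono) auto
    also have "\<dots> = C2 * real N ^ A * exp (- (b * real N)) * (exp (b * real N) * exp (- (b * real N)))"
      by (simp add: pw C2_def)
    also have "exp (b * real N) * exp (- (b * real N)) = 1" by (simp add: exp_minus)
    finally show ?thesis using N0[OF N(1)] by simp
  qed
  ultimately show ?thesis using p(1) by blast
qed

text \<open>Cut at two close points, each half closes with the same jump. The two excesses add up to
  at most \<open>t + 2 * r\<close> and neither is negative, so each half obeys this bound, and one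
  of them has at most half the period.\<close>

lemma split_orbit:
  assumes per: "per n p" and ij: "i < j" "j < n"
    and E: "E n p \<le> t" and close: "Q * D ((F ^^ i) p) ((F ^^ j) p + of_int m) powr chi \<le> r"
  shows "\<exists>n' p'. per n' p' \<and> 2 * n' \<le> n \<and> E n' p' \<le> t + 2 * r"
proof -
  obtain k where k: "(F ^^ n) p = p + of_int k" using per by (auto simp: per_def)
  define l where "l = j - i"
  define q1 where "q1 = (F ^^ i) p"
  define q2 where "q2 = (F ^^ j) p"
  have l: "1 \<le> l" "1 \<le> n - l" "l < n" using ij by (auto simp: l_def)
  have F1: "(F ^^ l) q1 = q2" using ij by (simp add: q1_def q2_def l_def funpow_funpow)
  have "(F ^^ (n - l)) q2 = (F ^^ (i + n)) p"
    using ij by (simp add: q2_def l_def funpow_funpow add.commute)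
  also have "\<dots> = q1 + of_int (d ^ i * k)" by (simp only: q1_def iter_shift k flip: funpow_funpow)
  finally have F2: "(F ^^ (n - l)) q2 = q1 + of_int (d ^ i * k)" .
  have D1: "D ((F ^^ l) q1) (q1 + of_int (- m)) = D q1 (q2 + of_int m)"
    using D_shift[of q2 m "q1 + of_int (- m)"] by (simp add: F1 D_sym)
  have D2: "D ((F ^^ (n - l)) q2) (q2 + of_int (m + d ^ i * k)) = D q1 (q2 + of_int m)"
    using D_shift[of q1 "d ^ i * k" "q2 + of_int m"] by (simp only: F2 of_int_add add.assoc)
  obtain p1 where p1: "per l p1" "\<bar>E l p1 - E l q1\<bar> \<le> Q * D q1 (q2 + of_int m) powr chi"
    using E_closing_segment[OF l(1), of q1 "- m"] unfolding D1 by blast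
  obtain p2 where p2: "per (n - l) p2" "\<bar>E (n - l) p2 - E (n - l) q2\<bar> \<le> Q * D q1 (q2 + of_int m) powr chi"
    using E_closing_segment[OF l(2), of q2 "m + d ^ i * k"] unfolding D2 by blast
  have "E l q1 + E (n - l) q2 = E n q1" using E_add[of l "n - l" q1] l by (simp add: F1)
  also have "\<dots> = E n p" unfolding q1_def by (rule per_orbit(2)[OF per])
  finally have sum: "E l q1 + E (n - l) q2 \<le> t" using E by simp
  have r: "Q * D q1 (q2 + of_int m) powr chi \<le> r" using close by (simp add: q1_def q2_def)
  have "E l p1 \<le> t + 2 * r" "E (n - l) p2 \<le> t + 2 * r"
    using p1 p2 sum r E_per_nonneg[OF p1(1)] E_per_nonneg[OF p2(1)] by linarith+
  moreover have "2 * l \<le> n \<or> 2 * (n - l) \<le> n" by linarith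
  ultimately show ?thesis using p1(1) p2(1) by blast
qed

text \<open>A failure of the separation allows a cut, which multiplies the bound \<open>t\<close> by
  at most \<open>1 + 2 * R\<close> and at least halves the period. With \<open>2 ^ A\<close> above
  that factor, \<open>n ^ A * t\<close> never increases, and this keeps the scale below
  \<open>smax\<close> until the separation holds. \<open>A\<close> depends on \<open>del\<close> and
  \<open>Cs\<close>, so orbits beating any prescribed power are needed at the start.\<close>

lemma good_orbit:
  assumes del: "0 < del" and Cs: "0 < Cs" and smax: "0 < smax"
  shows "\<exists>n p s. per n p \<and> 0 < s \<and> s \<le> smax \<and> E n p \<le> del * s powr chi \<and>
    (\<forall>i j m. i < j \<longrightarrow> j < n \<longrightarrow> Cs * s \<le> D ((F ^^ i) p) ((F ^^ j) p + of_int m))"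
    (is "\<exists>n p s. ?good n p s")
proof -
  define R where "R = Q * Cs powr chi / del"
  have R: "0 \<le> R" using Q_nonneg del by (simp add: R_def)
  obtain A :: nat where A: "1 + 2 * R \<le> 2 ^ A"
    using real_arch_pow[of 2 "1 + 2 * R"] by (auto intro: less_imp_le)
  have key: "\<exists>n p s. ?good n p s"
    if "per n p" "0 < t" "E n p \<le> t" "real n ^ A * t \<le> del * smax powr chi" for n p t
    using that
  proof (induction n arbitrary: p t rule: less_induct)
    case (less n)
    note per = less.prems(1) and t = less.prems(2) and E = less.prems(3) and nt = less.prems(4)
    have n: "1 \<le> n" using per by (simp add: per_def)
    \<comment> \<open>The scale at which \<open>del * s powr chi\<close> equals the current bound
      \<open>t\<close>; it is recomputed after each cut.\<close>
    define s where "s = (t / del) powr (1 / chi)"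
    have s: "0 < s" "s powr chi = t / del"
      using t del chi by (simp_all add: s_def powr_powr)
    have "1 * t \<le> real n ^ A * t" using n t by (intro mult_right_mono) auto
    then have "s powr chi \<le> smax powr chi" using nt del s by (simp add: pos_divide_le_eq mult.commute)
    then have smax': "s \<le> smax"
      using chi smax powr_less_mono2[of chi smax s] by (meson less_imp_le not_le)
    show ?case
    proof (cases "?good n p s")
      case True
      then show ?thesis by blast
    next
      case False
      have "E n p \<le> del * s powr chi" using E s del by simp
      then obtain i j m where ij: "i < j" "j < n" "D ((F ^^ i) p) ((F ^^ j) p + of_int m) < Cs * s"
        using False per s smax' by (auto simp: not_le)
      then have "D ((F ^^ i) p) ((F ^^ j) p + of_int m) powr chi \<le> (Cs * s) powr chi"
        using chi by (intro powr_mono2) auto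
      then have "Q * D ((F ^^ i) p) ((F ^^ j) p + of_int m) powr chi \<le> Q * (Cs powr chi * (t / del))"
        using Q_nonneg s by (intro mult_left_mono) (simp_all add: powr_mult)
      also have "\<dots> = R * t" by (simp add: R_def)
      finally obtain n' p' where np: "per n' p'" "2 * n' \<le> n" "E n' p' \<le> t + 2 * (R * t)"
        using split_orbit[OF per ij(1,2) E] by blast
      have n': "1 \<le> n'" using np(1) by (simp add: per_def)
      have "real n' ^ A * (t + 2 * (R * t)) = real n' ^ A * ((1 + 2 * R) * t)" by (simp add: algebra_simps)
      also have "\<dots> \<le> real n' ^ A * (2 ^ A * t)"
        using A t by (intro mult_left_mono mult_right_mono) auto
      also have "\<dots> = real (2 * n') ^ A * t" by (simp add: power_mult_distrib)
      also have "\<dots> \<le> real n ^ A * t"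
        using np(2) t by (intro mult_right_mono power_mono) auto
      finally have "real n' ^ A * (t + 2 * (R * t)) \<le> del * smax powr chi" using nt by linarith
      moreover have "n' < n" using np(2) n' by simp
      moreover have "0 < t + 2 * (R * t)" using t R by (simp add: add_pos_nonneg)
      ultimately show ?thesis using less.IH[of n' p' "t + 2 * (R * t)"] np by blast
    qed
  qed
  have "0 < del * smax powr chi" using del smax by simp
  from approximating_orbits[OF this, of A] show ?thesis using key by blast
qed

end

section \<open>Locking onto a periodic orbit\<close>

text \<open>The preimage of an orbit point contains the preceding one, so the masses of the points
  increase along the orbit; returning after \<open>n\<close> steps, they are all equal. The
  cardinality of the orbit appears because \<open>n\<close> may be a multiple of the least
  period.\<close>

lemma invariant_measure_on_orbit_unique:
  fixes tau :: "real \<Rightarrow> real" and x0 :: real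
  assumes tau: "tau \<in> borel_measurable borel" and per: "(tau ^^ n) x0 = x0"
    and mu: "prob_space mu" "sets mu = sets borel" "distr mu borel tau = mu"
      "measure mu {(tau ^^ k) x0 | k. k < n} = 1" (is "measure mu ?O = 1")
  shows "\<And>A. A \<in> sets borel \<Longrightarrow>
    measure mu A = real (card (A \<inter> ?O)) / real (card ?O)"
proof -
  interpret mu: prob_space mu by fact
  have fin: "finite ?O" by simp
  have sp: "space mu = UNIV" using mu(2) sets_eq_imp_space_eq by fastforce
  define g where "g k = measure mu {(tau ^^ k) x0}" for k
  have step: "g k \<le> g (Suc k)" for k
  proof -
    have "g (Suc k) = measure (distr mu borel tau) {(tau ^^ Suc k) x0}" by (simp add: g_def mu)
    also have "\<dots> = measure mu (tau -` {(tau ^^ Suc k) x0} \<inter> space mu)"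
      using tau mu(2) by (intro measure_distr) (auto simp: measurable_cong_sets[OF mu(2) refl])
    also have "\<dots> \<ge> g k"
      unfolding g_def
    proof (rule mu.finite_measure_mono)
      have "tau \<in> measurable mu borel" using tau mu(2) by (simp cong: measurable_cong_sets)
      then show "tau -` {(tau ^^ Suc k) x0} \<inter> space mu \<in> mu.events" by (rule measurable_sets) simp
    qed (simp add: sp)
    finally show ?thesis .
  qed
  then have mono: "mono g" by (simp add: mono_iff_le_Suc)
  have gc: "g k = g 0" if "k < n" for k
    using monoD[OF mono, of 0 k] monoD[OF mono, of k n] that per by (simp add: g_def)
  have single: "measure mu {x} = g 0" if "x \<in> ?O" for x using that gc by (auto simp: g_def)
  have cnt: "measure mu B = real (card B) * g 0" if "B \<subseteq> ?O" for B
  proof -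
    have "measure mu B = (\<Sum>x\<in>B. measure mu {x})"
      using finite_subset[OF that fin] mu(2) by (intro mu.finite_measure_eq_sum_singleton) auto
    also have "\<dots> = (\<Sum>x\<in>B. g 0)" using that single by (intro sum.cong) auto
    finally show ?thesis by simp
  qed
  fix A :: "real set" assume A: "A \<in> sets borel"
  have Os: "?O \<in> mu.events" using fin mu(2) by (simp add: finite_imp_closed borel_closed)
  have "AE x in mu. x \<in> ?O" using mu(4) mu.AE_in_set_eq_1[OF Os] by blast
  then have "measure mu A = measure mu (A \<inter> ?O)"
    using A Os mu(2) by (intro mu.finite_measure_eq_AE) auto
  also have "\<dots> = real (card (A \<inter> ?O)) * g 0" by (rule cnt) simp
  also have "g 0 = 1 / real (card ?O)"
  proof -
    define c where "c = real (card ?O)"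
    have "c * g 0 = 1" unfolding c_def using cnt[OF order_refl, symmetric] mu(4) by (rule trans)
    moreover from this have "c \<noteq> 0" by auto
    ultimately have "g 0 = 1 / c" by (simp add: field_simps)
    then show ?thesis unfolding c_def .
  qed
  finally show "measure mu A = real (card (A \<inter> ?O)) / real (card ?O)" by simp
qed

text \<open>The image of the uniform distribution on the indices below \<open>n\<close>; invariance
  is the cyclic rotation of the indices. Multiplicities are harmless when \<open>n\<close> is not
  the least period.\<close>

lemma orbit_measure_exists:
  fixes tau :: "real \<Rightarrow> real" and x0 :: real
  assumes tau: "tau \<in> borel_measurable borel" and per: "(tau ^^ n) x0 = x0" and n: "1 \<le> n"
  shows "\<exists>mu. prob_space mu \<and> sets mu = sets borel \<and> distr mu borel tau = mu \<and>
    measure mu {(tau ^^ k) x0 | k. k < n} = 1 \<and>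
    (\<forall>g\<in>borel_measurable borel. integral\<^sup>L mu g = (\<Sum>k<n. g ((tau ^^ k) x0)) / real n)"
proof -
  define P where "P = pmf_of_set {..<n}"
  have ne: "{..<n} \<noteq> {}" "finite {..<n}" using n by (auto simp: lessThan_empty_iff)
  have setP: "set_pmf P = {..<n}" using ne by (simp add: P_def)
  define X where "X k = (tau ^^ k) x0" for k
  define mu where "mu = distr (measure_pmf P) borel X"
  have pr: "prob_space mu" unfolding mu_def by (rule measure_pmf.prob_space_distr) simp
  have "bij_betw (\<lambda>k. Suc k mod n) {..<n} {..<n}"
  proof (rule bij_betw_imageI)
    show inj: "inj_on (\<lambda>k. Suc k mod n) {..<n}"
      by (rule inj_onI) (auto simp: mod_Suc split: if_splits)
    show "(\<lambda>k. Suc k mod n) ` {..<n} = {..<n}"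
      using n by (intro endo_inj_surj[OF _ _ inj]) auto
  qed
  then have rot: "map_pmf (\<lambda>k. Suc k mod n) P = P"
    unfolding P_def using ne by (intro map_pmf_of_set_bij_betw) auto
  have X: "tau (X k) = X (Suc k mod n)" if "k < n" for k
  proof -
    have "X (Suc k mod n) = X (Suc k)" unfolding X_def using per by (rule funpow_mod_eq)
    then show ?thesis by (simp add: X_def)
  qed
  have "distr mu borel tau = distr (measure_pmf P) borel (tau \<circ> X)"
    unfolding mu_def using tau by (intro distr_distr) auto
  also have "\<dots> = distr (measure_pmf P) borel (X \<circ> (\<lambda>k. Suc k mod n))"
    by (intro distr_cong_AE refl) (auto simp: AE_measure_pmf_iff setP X)
  also have "\<dots> = distr (distr (measure_pmf P) (count_space UNIV) (\<lambda>k. Suc k mod n)) borel X"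
    by (intro distr_distr[symmetric]) auto
  also have "\<dots> = mu" unfolding mu_def map_pmf_rep_eq[symmetric] rot ..
  finally have inv: "distr mu borel tau = mu" .
  have "measure mu {(tau ^^ k) x0 | k. k < n} = measure (measure_pmf P) (X -` {(tau ^^ k) x0 | k. k < n} \<inter> space (measure_pmf P))"
    unfolding mu_def by (intro measure_distr) (auto simp: finite_imp_closed borel_closed)
  also have "\<dots> = 1"
    by (rule measure_pmf.prob_eq_1[THEN iffD2]) (auto simp: AE_measure_pmf_iff setP X_def)
  finally have supp: "measure mu {(tau ^^ k) x0 | k. k < n} = 1" .
  have "integral\<^sup>L mu g = (\<Sum>k<n. g ((tau ^^ k) x0)) / real n" if "g \<in> borel_measurable borel" for g :: "real \<Rightarrow> real"
  proof -
    have "integral\<^sup>L mu g = measure_pmf.expectation P (\<lambda>k. g (X k))"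
      unfolding mu_def using that by (intro integral_distr) auto
    also have "\<dots> = (\<Sum>k<n. g (X k)) / real n"
      unfolding P_def using ne by (subst integral_pmf_of_set) auto
    finally show ?thesis by (simp add: X_def)
  qed
  then show ?thesis using pr inv supp by (intro exI[of _ mu]) (auto simp: mu_def)
qed

section \<open>Birkhoff sums around a periodic orbit\<close>

context lift_system
begin

text \<open>The full lift of the orbit to the line, translations included, so that conditions on the
  \<open>D\<close>-distance to it descend to the circle.\<close>

definition orb :: "real \<Rightarrow> real set" where "orb p = {(F ^^ i) p + of_int k | i k. True}"

definition far :: "real \<Rightarrow> real \<Rightarrow> real \<Rightarrow> bool" where "far p s x \<longleftrightarrow> (\<forall>q\<in>orb p. s \<le> D x q)"

lemma orb_F: "q \<in> orb p \<Longrightarrow> F q \<in> orb p"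
proof -
  assume "q \<in> orb p"
  then obtain i k where q: "q = (F ^^ i) p + of_int k" by (auto simp: orb_def)
  then have "F q = (F ^^ Suc i) p + of_int (d * k)" by (simp only: F_shift_int funpow.simps comp_apply)
  then show ?thesis unfolding orb_def by blast
qed

lemma orb_iter: "q \<in> orb p \<Longrightarrow> (F ^^ i) q \<in> orb p"
  by (induction i) (auto intro: orb_F)

lemma orb_shift: "q \<in> orb p \<Longrightarrow> q + of_int k \<in> orb p"
proof -
  assume "q \<in> orb p"
  then obtain i l where q: "q = (F ^^ i) p + of_int l" by (auto simp: orb_def)
  then have "q + of_int k = (F ^^ i) p + of_int (l + k)" by simp
  then show ?thesis unfolding orb_def by blast
qed

lemma far_mono: "far p s x \<Longrightarrow> s' \<le> s \<Longrightarrow> far p s' x"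
  unfolding far_def by (meson order_trans)

lemma far_shift [simp]: "far p s (x + of_int k) = far p s x"
proof -
  have *: "far p s (x + of_int k)" if far: "far p s x" for x and k :: int
    unfolding far_def
  proof
    fix q assume "q \<in> orb p"
    then have "s \<le> D x (q + of_int (- k))" using far orb_shift unfolding far_def by blast
    then show "s \<le> D (x + of_int k) q" using D_shift[of x k "q + of_int (- k)"] by simp
  qed
  show ?thesis using *[of x k] *[of "x + of_int k" "- k"] by auto
qed

lemma orb_per:
  assumes "per n p" "q \<in> orb p"
  shows "S (j * n) q = real j * S n p" "\<exists>k::int. (F ^^ (j * n)) q = q + of_int k"
proof -
  obtain i l where q: "q = (F ^^ i) p + of_int l" using assms(2) by (auto simp: orb_def)
  have Sq: "S n q = S n p" using per_orbit(2)[OF assms(1), of i] by (simp add: q E_def)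
  obtain k0 where k0: "(F ^^ n) ((F ^^ i) p) = (F ^^ i) p + of_int k0"
    using per_orbit(1)[OF assms(1), of i] by (auto simp: per_def)
  have "(F ^^ n) q = q + of_int (k0 + d ^ n * l - l)" by (simp add: q k0 iter_shift)
  then obtain k1 :: int where k1: "(F ^^ n) q = q + of_int k1" by blast
  show 2: "\<exists>k::int. (F ^^ (j * n)) q = q + of_int k" for j
  proof (induction j)
    case (Suc j)
    then obtain k :: int where "(F ^^ (j * n)) q = q + of_int k" by blast
    then have "(F ^^ (Suc j * n)) q = q + of_int (k1 + d ^ n * k)" by (simp add: funpow_add iter_shift k1)
    then show ?case by blast
  qed (auto intro: exI[of _ 0])
  show "S (j * n) q = real j * S n p"
  proof (induction j)
    case (Suc j)
    have "S (Suc j * n) q = S (j * n) q + S n ((F ^^ (j * n)) q)" using S_add[of "j * n" n q] by (simp add: add.commute)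
    moreover obtain k :: int where "(F ^^ (j * n)) q = q + of_int k" using 2 by blast
    ultimately show ?case using Suc Sq by (simp add: algebra_simps)
  qed (simp add: S_def)
qed

end

text \<open>\<open>G\<close> may be slightly negative near the orbit, which is what survives a
  perturbation of the map. \<open>G_shell\<close> demands \<open>B + eta\<close>: here
  \<open>B\<close> bounds the loss during one shadowing period, and the extra \<open>eta\<close>
  covers the penalty subtracted in \<open>H\<close>. Separation \<open>(Lam + 1) * s\<close> ensures
  that a point leaving the \<open>s\<close>-neighbourhood of one orbit point, then at distance below
  \<open>Lam * s\<close>, is not yet near another.\<close>

locale locked = lift_system +
  fixes p :: real and n :: nat and v :: "real \<Rightarrow> real" and Kv s s0 eta :: real
  assumes per: "per n p"
    and sep: "\<And>q q'. q \<in> orb p \<Longrightarrow> q' \<in> orb p \<Longrightarrow> q \<noteq> q' \<Longrightarrow> (Lam + 1) * s \<le> D q q'"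
    and v_holder: "\<And>x y. \<bar>v x - v y\<bar> \<le> Kv * D x y powr chi"
    and v_shift: "\<And>x. v (x + 1) = v x"
    and s0: "0 < s0" "s0 \<le> s" and eta: "0 < eta"
    and G_all: "\<And>x. - eta \<le> f x - S n p / real n + v x - v (F x)"
    and G_far: "\<And>x. far p s0 x \<Longrightarrow> eta \<le> f x - S n p / real n + v x - v (F x)"
    and G_shell: "\<And>x. far p s x \<Longrightarrow>
      real (n + 1) * eta + (Q + 2 * Kv) * s0 powr chi \<le> f x - S n p / real n + v x - v (F x)"
begin

definition a :: real where "a = S n p / real n"
definition G :: "real \<Rightarrow> real" where "G x = f x - a + v x - v (F x)"
definition B :: real where "B = real n * eta + (Q + 2 * Kv) * s0 powr chi"
text \<open>The penalty on the far region does not spoil the lower bound for the sums, and it makes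
  the integral of \<open>H\<close> detect the mass of that region.\<close>

definition H :: "real \<Rightarrow> real" where "H x = G x - eta * indicator {x. far p s0 x} x"

lemma n_pos: "1 \<le> n" using per by (simp add: per_def)

lemma v_shift_int [simp]: "v (x + of_int k) = v x"
  using shift_of_int[of v 0 x k] v_shift by simp

lemma Kv_nonneg: "0 \<le> Kv"
  using v_holder[of 1 0] D_lower[of 1 0] by (smt (verit, best) mult_neg_pos powr_gt_zero)

lemma B_nonneg: "0 \<le> B"
  using Q_nonneg Kv_nonneg eta by (simp add: B_def)

lemma G_sum: "(\<Sum>i<m. G ((F ^^ i) x)) = S m x - real m * a + v x - v ((F ^^ m) x)"
  by (induction m) (simp_all add: G_def S_def algebra_simps)

text \<open>Over full periods the sum is compared with the orbit by \<open>S_diff_backward\<close>,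
  with an error independent of their number; only the at most \<open>n\<close> remaining terms are
  estimated one by one.\<close>

lemma shadow_sum:
  assumes q: "q \<in> orb p" and close: "\<And>i. i < m \<Longrightarrow> D ((F ^^ i) x) ((F ^^ i) q) < s0"
  shows "- B \<le> (\<Sum>i<m. G ((F ^^ i) x))"
proof (cases "m = 0")
  case True
  then show ?thesis using B_nonneg by simp
next
  case False
  define j where "j = (m - 1) div n"
  \<comment> \<open>The remainder runs from 1 to \<open>n\<close>, not from 0 to
    \<open>n - 1\<close>, so that \<open>j * n < m\<close> is a time at which closeness is
    assumed.\<close>
  define r where "r = (m - 1) mod n + 1"
  have m: "m = j * n + r" using False by (simp add: j_def r_def)
  have "r \<le> n" using n_pos by (simp add: r_def Suc_leI)
  moreover have "0 < r" by (simp add: r_def)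
  then have "j * n < m" using m by linarith
  ultimately have r: "r \<le> n" "j * n < m" by auto
  obtain k :: int where k: "(F ^^ (j * n)) q = q + of_int k" using orb_per(2)[OF per q] by blast
  let ?y = "(F ^^ (j * n)) x"
  have Dy: "D ?y (q + of_int k) < s0" using close[OF r(2)] by (simp add: k)
  have Dx: "D x q < s0" using close[of 0] False by simp
  have "\<bar>S (j * n) x - S (j * n) q\<bar> \<le> Q * D ?y (q + of_int k) powr chi"
    using S_diff_backward[of "j * n" x q] by (simp add: k)
  also have "\<dots> \<le> Q * s0 powr chi"
    using Dy chi Q_nonneg by (intro mult_left_mono powr_mono2) auto
  finally have S: "real j * S n p - Q * s0 powr chi \<le> S (j * n) x" using orb_per(1)[OF per q, of j] by simp
  have "Kv * D x q powr chi \<le> Kv * s0 powr chi" "Kv * D ?y (q + of_int k) powr chi \<le> Kv * s0 powr chi"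
    using Dx Dy chi Kv_nonneg by (intro mult_left_mono powr_mono2; simp)+
  then have v: "- 2 * Kv * s0 powr chi \<le> v x - v ?y"
    using v_holder[of x q] v_holder[of ?y "q + of_int k"] by simp
  have ja: "real (j * n) * a = real j * S n p" using n_pos by (simp add: a_def)
  have "(Q + 2 * Kv) * s0 powr chi = Q * s0 powr chi + 2 * Kv * s0 powr chi" by (simp add: algebra_simps)
  then have first: "- ((Q + 2 * Kv) * s0 powr chi) \<le> (\<Sum>i<j * n. G ((F ^^ i) x))"
    unfolding G_sum ja using S v by linarith
  have "(\<Sum>i<j * n + r'. G ((F ^^ i) x)) = (\<Sum>i<j * n. G ((F ^^ i) x)) + (\<Sum>i<r'. G ((F ^^ (j * n + i)) x))" for r'
    by (induction r') simp_all
  from this[of r] have "(\<Sum>i<m. G ((F ^^ i) x)) = (\<Sum>i<j * n. G ((F ^^ i) x)) + (\<Sum>i<r. G ((F ^^ (j * n + i)) x))"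
    by (simp flip: m)
  moreover have "(\<Sum>i<r. - eta) \<le> (\<Sum>i<r. G ((F ^^ (j * n + i)) x))"
    using G_all by (intro sum_mono) (auto simp: G_def a_def)
  moreover have "real r * eta \<le> real n * eta" using r eta by (intro mult_right_mono) auto
  ultimately show ?thesis using first by (simp add: B_def algebra_simps)
qed

text \<open>Any other orbit point is at distance at least \<open>(Lam + 1) * s - Lam * s = s\<close>
  by the triangle inequality.\<close>

lemma unique_nearest:
  assumes q: "q \<in> orb p" and "t \<le> s" "t \<le> D x q" "D x q < Lam * s"
  shows "far p t x"
  unfolding far_def
proof
  fix q' assume q': "q' \<in> orb p"
  show "t \<le> D x q'"
  proof (cases "q' = q")
    case False
    then have "(Lam + 1) * s \<le> D q q'" using sep[OF q q'] by simp
    also have "\<dots> \<le> D x q + D x q'" using D_triangle[of q q' x] by (simp add: D_sym)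
    finally show ?thesis using assms by (simp add: algebra_simps)
  qed (use assms in simp)
qed

lemma s_pos: "0 < s" "s \<le> Lam * s"
  using s0 Lam_ge lam by (auto simp: mult_le_cancel_right1)

lemma D_iter_mono: "i \<le> j \<Longrightarrow> D ((F ^^ i) x) ((F ^^ i) y) \<le> D ((F ^^ j) x) ((F ^^ j) y)"
proof (induction j rule: dec_induct)
  case (step j)
  have "1 * D ((F ^^ j) x) ((F ^^ j) y) \<le> lam * D ((F ^^ j) x) ((F ^^ j) y)"
    using lam by (intro mult_right_mono) auto
  also have "\<dots> \<le> D ((F ^^ Suc j) x) ((F ^^ Suc j) y)" using D_expand by simp
  finally show ?case using step by simp
qed simp

text \<open>The distance to the shadowed orbit never decreases, so losses occur only before it
  reaches \<open>s0\<close>. From then on it lies between \<open>s0\<close> and \<open>s\<close>,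
  where \<open>G_far\<close> makes the terms of \<open>H\<close> nonnegative.\<close>

lemma near_sum:
  assumes q: "q \<in> orb p" and close: "\<And>i. i < m \<Longrightarrow> D ((F ^^ i) x) ((F ^^ i) q) < s"
  shows "- B \<le> (\<Sum>i<m. H ((F ^^ i) x))"
proof -
  define m0 where "m0 = (LEAST i. i = m \<or> s0 \<le> D ((F ^^ i) x) ((F ^^ i) q))"
  have m0: "m0 = m \<or> s0 \<le> D ((F ^^ m0) x) ((F ^^ m0) q)"
    unfolding m0_def by (rule LeastI[of _ m]) simp
  have m0_le: "m0 \<le> m" unfolding m0_def by (rule Least_le) simp
  have before: "D ((F ^^ i) x) ((F ^^ i) q) < s0" if "i < m0" for i
    using not_less_Least[of i "\<lambda>i. i = m \<or> s0 \<le> D ((F ^^ i) x) ((F ^^ i) q)"] that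
    unfolding m0_def by auto
  have H1: "H ((F ^^ i) x) = G ((F ^^ i) x)" if "i < m0" for i
  proof -
    have "\<not> far p s0 ((F ^^ i) x)" using before[OF that] orb_iter[OF q] by (auto simp: far_def not_le)
    then show ?thesis by (simp add: H_def)
  qed
  have H2: "0 \<le> H ((F ^^ i) x)" if "m0 \<le> i" "i < m" for i
  proof -
    have "s0 \<le> D ((F ^^ i) x) ((F ^^ i) q)"
      using m0 that D_iter_mono[OF that(1), of x q] by auto
    moreover have "D ((F ^^ i) x) ((F ^^ i) q) < Lam * s" using less_le_trans[OF close[OF that(2)] s_pos(2)] .
    ultimately have "far p s0 ((F ^^ i) x)" using unique_nearest[OF orb_iter[OF q]] s0 by blast
    then show ?thesis using G_far by (simp add: H_def G_def a_def)
  qed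
  have "(\<Sum>i<m. H ((F ^^ i) x)) = (\<Sum>i<m0. H ((F ^^ i) x)) + (\<Sum>i\<in>{m0..<m}. H ((F ^^ i) x))"
    using sum.atLeastLessThan_concat[of 0 m0 m "\<lambda>i. H ((F ^^ i) x)"] m0_le by (simp add: atLeast0LessThan)
  moreover have "0 \<le> (\<Sum>i\<in>{m0..<m}. H ((F ^^ i) x))" using H2 by (intro sum_nonneg) auto
  moreover have "(\<Sum>i<m0. H ((F ^^ i) x)) = (\<Sum>i<m0. G ((F ^^ i) x))" using H1 by (intro sum.cong) auto
  moreover have "- B \<le> (\<Sum>i<m0. G ((F ^^ i) x))" using shadow_sum[OF q, of m0 x] before by blast
  ultimately show ?thesis by linarith
qed

lemma far_nonneg: "far p s0 x \<Longrightarrow> 0 \<le> H x"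
  using G_far by (simp add: H_def G_def a_def)

text \<open>Every excursion away from the periodic orbit crosses the shell at distance between \<open>s\<close> and
  \<open>Lam * s\<close>, where the gain pays for whatever was lost while shadowing.\<close>

lemma locking_sum: "- B \<le> (\<Sum>i<j. H ((F ^^ i) x))"
proof (induction j arbitrary: x rule: less_induct)
  case (less j)
  show ?case
  proof (cases "j = 0")
    case True
    then show ?thesis using B_nonneg by simp
  next
    case False
    have split: "(\<Sum>i<j. H ((F ^^ i) x))
        = (\<Sum>i<l. H ((F ^^ i) x)) + H ((F ^^ l) x) + (\<Sum>i<j - Suc l. H ((F ^^ i) ((F ^^ Suc l) x)))"
      if "l < j" for l
    proof -
      define r where "r = j - Suc l"
      have r: "j = Suc l + r" using that by (simp add: r_def)
      have "(\<Sum>i<Suc l + r. H ((F ^^ i) x)) = (\<Sum>i<Suc l. H ((F ^^ i) x)) + (\<Sum>i<r. H ((F ^^ i) ((F ^^ Suc l) x)))"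
      proof -
        have "(\<Sum>i<Suc l + r. H ((F ^^ i) x)) = (\<Sum>i<Suc l. H ((F ^^ i) x)) + (\<Sum>i<r. H ((F ^^ (i + Suc l)) x))"
          by (induction r) (simp_all add: add.commute)
        then show ?thesis by (simp only: funpow_funpow)
      qed
      then show ?thesis unfolding r by simp
    qed
    show ?thesis
    proof (cases "far p s0 x")
      case True
      then show ?thesis using split[of 0] False far_nonneg[OF True] less.IH[of "j - 1" "F x"] by simp
    next
      case False
      then obtain q where q: "q \<in> orb p" "D x q < s0" by (auto simp: far_def not_le)
      show ?thesis
      proof (cases "\<forall>i<j. D ((F ^^ i) x) ((F ^^ i) q) < s")
        case True
        then show ?thesis using near_sum[OF q(1)] by blast
      next
        case False
        define l where "l = (LEAST i. s \<le> D ((F ^^ i) x) ((F ^^ i) q))"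
        obtain i0 where i0: "i0 < j" "s \<le> D ((F ^^ i0) x) ((F ^^ i0) q)" using False by (auto simp: not_less)
        have l: "s \<le> D ((F ^^ l) x) ((F ^^ l) q)" unfolding l_def using i0(2) by (rule LeastI)
        have "l \<le> i0" unfolding l_def using i0(2) by (rule Least_le)
        then have lj: "l < j" using i0 by simp
        have before: "D ((F ^^ i) x) ((F ^^ i) q) < s" if "i < l" for i
          using that not_less_Least[of i "\<lambda>i. s \<le> D ((F ^^ i) x) ((F ^^ i) q)"] unfolding l_def by auto
        have "l \<noteq> 0" using l q(2) s0 by (auto intro: ccontr)
        then obtain l' where l': "l = Suc l'" by (cases l) auto
        have "D ((F ^^ l) x) ((F ^^ l) q) \<le> Lam * D ((F ^^ l') x) ((F ^^ l') q)" using D_lip by (simp add: l')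
        also have "\<dots> < Lam * s" using before[of l'] Lam_ge lam by (simp add: l')
        finally have shell: "far p s ((F ^^ l) x)" using unique_nearest[OF orb_iter[OF q(1)]] l by blast
        \<comment> \<open>The term at the exit time cancels the loss before it; only the
          \<open>- B\<close> of the induction hypothesis is left, so losses do not accumulate over
          excursions.\<close>
        have "B \<le> H ((F ^^ l) x)"
          using G_shell[OF shell] far_mono[OF shell s0(2)] by (simp add: H_def G_def a_def B_def algebra_simps)
        moreover have "- B \<le> (\<Sum>i<l. H ((F ^^ i) x))" using near_sum[OF q(1) before] .
        moreover have "- B \<le> (\<Sum>i<j - Suc l. H ((F ^^ i) ((F ^^ Suc l) x)))" using less.IH lj by simp
        ultimately show ?thesis using split[OF lj] by linarith
      qed
    qed
  qed
qed

text \<open>The shadowed orbit point cannot be exchanged for another because of the separation, so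
  \<open>x\<close> stays \<open>s0\<close>-close to the orbit of a single \<open>q\<close>;
  expansion forces \<open>x = q\<close>.\<close>

lemma never_far:
  assumes "\<And>i. \<not> far p s0 ((F ^^ i) x)" shows "x \<in> orb p"
proof -
  obtain q where q: "q \<in> orb p" "D x q < s0" using assms[of 0] by (auto simp: far_def not_le)
  have close: "D ((F ^^ i) x) ((F ^^ i) q) < s0" for i
  proof (induction i)
    case (Suc i)
    have "D ((F ^^ Suc i) x) ((F ^^ Suc i) q) \<le> Lam * D ((F ^^ i) x) ((F ^^ i) q)" using D_lip by simp
    also have "\<dots> < Lam * s" using Suc Lam_ge lam s0 by simp
    finally show ?case
      using unique_nearest[OF orb_iter[OF q(1)] s0(2), of "(F ^^ Suc i) x" "Suc i"] assms[of "Suc i"] by (meson not_le)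
  qed (use q in simp)
  have "D x q = 0"
  proof (rule ccontr)
    assume "D x q \<noteq> 0"
    then have pos: "0 < D x q" using D_nonneg[of x q] by linarith
    obtain i where "s0 / D x q < lam ^ i" using real_arch_pow[OF lam] by blast
    then have "s0 < lam ^ i * D x q" using pos by (simp add: field_simps)
    then show False using iter_expand[of i x q] close[of i] by simp
  qed
  then show ?thesis using q by simp
qed

end

section \<open>Integrals against invariant measures\<close>

lemma frac_add_of_int: "frac (x + of_int k) = frac x"
  by (simp add: frac_def)

context lift_system
begin

lemma F_borel: "F \<in> borel_measurable borel"
  using F_cont by (rule borel_measurable_continuous_onI)

lemma circ_borel: "circ_map F \<in> borel_measurable borel"
  unfolding circ_map_def frac_def using F_borel by measurable

lemma circ_iter: "\<exists>k::int. (circ_map F ^^ i) x = (F ^^ i) x + of_int k"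
proof (induction i)
  case 0
  show ?case by (auto intro: exI[of _ 0])
next
  case (Suc i)
  then obtain k :: int where k: "(circ_map F ^^ i) x = (F ^^ i) x + of_int k" by blast
  have "(circ_map F ^^ Suc i) x = F ((F ^^ i) x + of_int k) - of_int \<lfloor>F ((F ^^ i) x + of_int k)\<rfloor>"
    by (simp add: k circ_map_def frac_def)
  also have "\<dots> = (F ^^ Suc i) x + of_int (d * k - \<lfloor>F ((F ^^ i) x + of_int k)\<rfloor>)"
    by (simp add: F_shift_int)
  finally show ?case by blast
qed

lemma inv_measureD:
  assumes "nu \<in> inv_measures F"
  shows "prob_space nu" "sets nu = sets borel" "distr nu borel (circ_map F) = nu"
    "measure nu {0..<1} = 1" "\<And>g. g \<in> borel_measurable borel \<Longrightarrow> g \<in> borel_measurable nu"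
  using assms by (auto simp: inv_measures_def cong: measurable_cong_sets)

lemma integral_iter:
  fixes g :: "real \<Rightarrow> real"
  assumes nu: "nu \<in> inv_measures F" and g: "g \<in> borel_measurable borel"
    and shift: "\<And>x k. g (x + of_int k) = g x"
  shows "integral\<^sup>L nu (\<lambda>x. g ((F ^^ i) x)) = integral\<^sup>L nu g"
proof -
  have step: "integral\<^sup>L nu (\<lambda>x. h (circ_map F x)) = integral\<^sup>L nu h" if "h \<in> borel_measurable borel" for h :: "real \<Rightarrow> real"
    using integral_distr[OF inv_measureD(5)[OF nu circ_borel] that] inv_measureD(3)[OF nu] by simp
  have meas: "(\<lambda>x. g ((circ_map F ^^ i) x)) \<in> borel_measurable borel" for i
  proof (induction i)
    case (Suc i)
    show ?case using measurable_compose[OF circ_borel Suc] by (simp add: funpow_swap1)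
  qed (use g in simp)
  have "integral\<^sup>L nu (\<lambda>x. g ((circ_map F ^^ i) x)) = integral\<^sup>L nu g"
  proof (induction i)
    case (Suc i)
    then show ?case using step[OF meas[of i]] by (simp add: funpow_swap1)
  qed simp
  moreover have "g ((circ_map F ^^ i) x) = g ((F ^^ i) x)" for x
    using circ_iter[of i x] shift by auto
  ultimately show ?thesis by simp
qed

text \<open>By invariance, integrating a sum of \<open>j\<close> terms gives \<open>j\<close> times
  the integral, bounded below by \<open>- B\<close> for every \<open>j\<close>. This replaces an
  appeal to an ergodic theorem.\<close>

lemma inv_integral_nonneg:
  fixes h :: "real \<Rightarrow> real"
  assumes nu: "nu \<in> inv_measures F" and h: "h \<in> borel_measurable borel" and bound: "\<And>x. \<bar>h x\<bar> \<le> C"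
    and shift: "\<And>x k. h (x + of_int k) = h x" and sums: "\<And>j x. - B \<le> (\<Sum>i<j. h ((F ^^ i) x))"
  shows "0 \<le> integral\<^sup>L nu h"
proof (rule ccontr)
  assume "\<not> ?thesis"
  then have neg: "integral\<^sup>L nu h < 0" by simp
  interpret nu: prob_space nu using nu by (rule inv_measureD)
  have "F ^^ i \<in> borel_measurable borel" for i
    using iter_cont by (rule borel_measurable_continuous_onI)
  then have hi: "(\<lambda>x. h ((F ^^ i) x)) \<in> borel_measurable nu" for i
    using h measurable_compose[of "F ^^ i" borel borel h borel] inv_measureD(5)[OF nu] by blast
  have int: "integrable nu (\<lambda>x. h ((F ^^ i) x))" for i
    using bound hi by (intro nu.integrable_const_bound[of _ C]) auto
  have le: "- B \<le> real j * integral\<^sup>L nu h" for j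
  proof -
    have "- B = integral\<^sup>L nu (\<lambda>x. - B)" using nu.prob_space by simp
    also have "\<dots> \<le> integral\<^sup>L nu (\<lambda>x. \<Sum>i<j. h ((F ^^ i) x))"
      using sums int by (intro integral_mono) auto
    also have "\<dots> = (\<Sum>i<j. integral\<^sup>L nu (\<lambda>x. h ((F ^^ i) x)))" using int by (intro Bochner_Integration.integral_sum) auto
    also have "\<dots> = real j * integral\<^sup>L nu h" using integral_iter[OF nu h shift] by simp
    finally show ?thesis .
  qed
  obtain j :: nat where "B / (- integral\<^sup>L nu h) < real j" using reals_Archimedean2 by blast
  then have "B < real j * (- integral\<^sup>L nu h)" using neg by (simp add: field_simps)
  then show False using le[of j] by simp
qed

end

context locked
begin

lemma far_borel: "{x. far p s0 x} \<in> sets borel"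
proof -
  have "continuous_on UNIV W"
  proof -
    have "M-lipschitz_on UNIV W"
      using W_upper M_ge_1 by (intro lipschitz_onI) (auto simp: dist_real_def)
    then show ?thesis by (rule lipschitz_on_continuous_on)
  qed
  then have "closed {x. s0 \<le> D x q}" for q
    unfolding D_def by (intro closed_Collect_le continuous_intros) auto
  then have "closed (\<Inter>q\<in>orb p. {x. s0 \<le> D x q})" by blast
  moreover have "{x. far p s0 x} = (\<Inter>q\<in>orb p. {x. s0 \<le> D x q})" by (auto simp: far_def)
  ultimately show ?thesis by (simp add: borel_closed)
qed

lemma f_borel: "f \<in> borel_measurable borel"
  by (rule borel_measurable_continuous_onI, rule holder_continuous, rule f_D_holder)

lemma v_cont: "continuous_on UNIV v" by (rule holder_continuous, rule v_holder)

lemma v_borel: "v \<in> borel_measurable borel"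
  by (intro borel_measurable_continuous_onI v_cont)

lemma vF_borel: "(\<lambda>x. v (F x)) \<in> borel_measurable borel"
  using F_borel v_borel by (rule measurable_compose)

lemma H_borel: "H \<in> borel_measurable borel"
  unfolding H_def[abs_def] G_def using f_borel v_borel vF_borel far_borel by measurable

lemma H_bounded: "\<exists>C. \<forall>x. \<bar>H x\<bar> \<le> C"
proof -
  obtain Cf Cv where C: "\<And>x. \<bar>f x\<bar> \<le> Cf" "\<And>x. \<bar>v x\<bar> \<le> Cv"
    using holder_bounded[of f K, OF f_D_holder f_shift_int] holder_bounded[of v Kv, OF v_holder v_shift_int] by blast
  have "\<bar>H x\<bar> \<le> Cf + \<bar>a\<bar> + 2 * Cv + eta" for x
    using C(1)[of x] C(2)[of x] C(2)[of "F x"] eta unfolding H_def G_def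
    by (auto simp: indicator_def abs_le_iff)
  then show ?thesis by blast
qed

lemma H_shift: "H (x + of_int k) = H x"
proof -
  have "v (F (x + of_int k)) = v (F x)" by (simp only: F_shift_int v_shift_int)
  then show ?thesis by (simp add: H_def G_def indicator_def)
qed

text \<open>The coboundary of \<open>v\<close> integrates to zero, so the nonnegative integral of
  \<open>H\<close> is that of \<open>f\<close>, less \<open>a\<close> and less the penalty.\<close>

lemma integral_lower:
  assumes nu: "nu \<in> inv_measures F"
  shows "a + eta * measure nu {x. far p s0 x} \<le> integral\<^sup>L nu f"
proof -
  interpret nu: prob_space nu using nu by (rule inv_measureD)
  obtain C where C: "\<And>x. \<bar>H x\<bar> \<le> C" using H_bounded by blast
  have "0 \<le> integral\<^sup>L nu H"
    using inv_integral_nonneg[OF nu H_borel C H_shift] locking_sum by blast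
  moreover have "integral\<^sup>L nu H = integral\<^sup>L nu f - a - eta * measure nu {x. far p s0 x}"
  proof -
    obtain Cf Cv where C: "\<And>x. \<bar>f x\<bar> \<le> Cf" "\<And>x. \<bar>v x\<bar> \<le> Cv"
      using holder_bounded[of f K, OF f_D_holder f_shift_int] holder_bounded[of v Kv, OF v_holder v_shift_int] by blast
    have i1: "integrable nu f" using C f_borel inv_measureD(5)[OF nu] by (intro nu.integrable_const_bound[of _ Cf]) auto
    have i2: "integrable nu v" using C v_borel inv_measureD(5)[OF nu] by (intro nu.integrable_const_bound[of _ Cv]) auto
    have i3: "integrable nu (\<lambda>x. v (F x))" using C vF_borel inv_measureD(5)[OF nu] by (intro nu.integrable_const_bound[of _ Cv]) auto
    have i4: "integrable nu (indicator {x. far p s0 x} :: real \<Rightarrow> real)"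
      using far_borel inv_measureD(2)[OF nu] by (intro nu.integrable_const_bound[of _ 1]) (auto simp: indicator_def)
    have v: "integral\<^sup>L nu (\<lambda>x. v (F x)) = integral\<^sup>L nu v"
      using integral_iter[OF nu v_borel v_shift_int, of 1] by simp
    have "integral\<^sup>L nu (indicator {x. far p s0 x} :: real \<Rightarrow> real) = measure nu {x. far p s0 x}"
      using far_borel inv_measureD(2)[OF nu] by simp
    then show ?thesis unfolding H_def G_def using i1 i2 i3 i4 v nu.prob_space by simp
  qed
  ultimately show ?thesis by simp
qed

lemma circ_per: "(circ_map F ^^ n) (frac p) = frac p"
proof -
  obtain k :: int where k: "(circ_map F ^^ n) (frac p) = (F ^^ n) (frac p) + of_int k" using circ_iter by blast
  obtain l :: int where l: "(F ^^ n) p = p + of_int l" using per by (auto simp: per_def)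
  have fp: "frac p = p + of_int (- \<lfloor>p\<rfloor>)" by (simp add: frac_def)
  have "(F ^^ n) (frac p) = p + of_int (l + d ^ n * - \<lfloor>p\<rfloor>)" unfolding fp iter_shift l by simp
  then have "(circ_map F ^^ n) (frac p) = p + of_int (l + d ^ n * - \<lfloor>p\<rfloor> + k)" using k by simp
  moreover obtain y where "(circ_map F ^^ n) (frac p) = frac y"
    using n_pos by (cases n) (auto simp: circ_map_def)
  ultimately have "frac y = p + of_int (l + d ^ n * - \<lfloor>p\<rfloor> + k)" by simp
  then have "frac (frac y) = frac p" by (simp only: frac_add_of_int)
  then show ?thesis using \<open>(circ_map F ^^ n) (frac p) = frac y\<close> by simp
qed

text \<open>A measure with mean at most \<open>a\<close> gives no mass to the far region. By
  invariance almost no orbit ever visits it, and \<open>never_far\<close> places almost every point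
  on the periodic orbit.\<close>

lemma minimal_support:
  assumes nu: "nu \<in> inv_measures F" and le: "integral\<^sup>L nu f \<le> a"
  shows "measure nu {(circ_map F ^^ k) (frac p) | k. k < n} = 1"
proof -
  interpret nu: prob_space nu using nu by (rule inv_measureD)
  let ?O = "{(circ_map F ^^ k) (frac p) | k. k < n}"
  have "eta * measure nu {x. far p s0 x} \<le> 0" using integral_lower[OF nu] le by simp
  then have "\<not> 0 < measure nu {x. far p s0 x}" using eta by (meson mult_pos_pos not_le)
  then have "measure nu {x. far p s0 x} = 0" using measure_nonneg[of nu "{x. far p s0 x}"] by linarith
  then have "{x. far p s0 x} \<in> null_sets nu"
    using far_borel inv_measureD(2)[OF nu] by (intro null_setsI) (auto simp: nu.emeasure_eq_measure)
  then have near: "AE x in nu. \<not> far p s0 x" by (intro AE_I') auto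
  have circ: "circ_map F \<in> measurable nu borel" using circ_borel inv_measureD(5)[OF nu] by blast
  have "AE x in nu. \<not> far p s0 ((circ_map F ^^ i) x)" for i
  proof (induction i)
    case (Suc i)
    then have "AE x in distr nu borel (circ_map F). \<not> far p s0 ((circ_map F ^^ i) x)"
      by (subst inv_measureD(3)[OF nu])
    from AE_distrD[OF circ this] show ?case by (simp add: funpow_swap1)
  qed (use near in simp)
  then have all: "AE x in nu. \<forall>i. \<not> far p s0 ((circ_map F ^^ i) x)" by (simp add: AE_all_countable)
  have inO: "x \<in> ?O" if xo: "x \<in> orb p" and xu: "x \<in> {0..<1}" for x
  proof -
    obtain i and k :: int where x: "x = (F ^^ i) p + of_int k" using xo unfolding orb_def by blast
    \<comment> \<open>With \<open>i + n\<close> in place of \<open>i\<close> at least one step is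
      taken, so the iterate is visibly a fractional part even for \<open>i = 0\<close>.\<close>
    obtain l :: int where l: "(circ_map F ^^ (i + n)) (frac p) = (F ^^ (i + n)) (frac p) + of_int l" using circ_iter by blast
    have red: "(circ_map F ^^ (i + n)) (frac p) = (circ_map F ^^ i) (frac p)" by (simp add: funpow_add circ_per)
    obtain m :: int where m: "(F ^^ n) p = p + of_int m" using per by (auto simp: per_def)
    have fp: "frac p = p + of_int (- \<lfloor>p\<rfloor>)" by (simp add: frac_def)
    have "(F ^^ (i + n)) (frac p) = (F ^^ i) p + of_int (d ^ i * m + d ^ (i + n) * - \<lfloor>p\<rfloor>)"
      unfolding fp iter_shift by (simp add: funpow_add m iter_shift)
    then have "(circ_map F ^^ i) (frac p) = x + of_int (d ^ i * m + d ^ (i + n) * - \<lfloor>p\<rfloor> + l - k)"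
      using l red x by simp
    moreover obtain y where "(circ_map F ^^ (i + n)) (frac p) = frac y"
      using n_pos by (cases n) (auto simp: circ_map_def)
    ultimately have "frac y = x + of_int (d ^ i * m + d ^ (i + n) * - \<lfloor>p\<rfloor> + l - k)" using red by simp
    then have "frac (frac y) = frac x" by (simp only: frac_add_of_int)
    then have "x = (circ_map F ^^ i) (frac p)"
      using xu red \<open>(circ_map F ^^ (i + n)) (frac p) = frac y\<close> by (simp add: frac_eq)
    also have "\<dots> = (circ_map F ^^ (i mod n)) (frac p)" using funpow_mod_eq[OF circ_per, of i] by simp
    finally show ?thesis using n_pos by (auto intro!: exI[of _ "i mod n"])
  qed
  have ev: "{0..<1::real} \<in> nu.events" using inv_measureD(2)[OF nu] by simp
  have unit: "AE x in nu. x \<in> {0..<1}"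
    using inv_measureD(4)[OF nu] nu.AE_in_set_eq_1[OF ev] by blast
  have "AE x in nu. x \<in> ?O"
    using all unit
  proof eventually_elim
    case (elim x)
    have "\<not> far p s0 ((F ^^ i) x)" for i
    proof -
      obtain k :: int where "(circ_map F ^^ i) x = (F ^^ i) x + of_int k" using circ_iter by blast
      then show ?thesis using elim(1) far_shift by metis
    qed
    then have "x \<in> orb p" by (rule never_far)
    then show ?case using inO elim(2) by blast
  qed
  moreover have "?O \<in> nu.events" using inv_measureD(2)[OF nu] by (simp add: finite_imp_closed borel_closed)
  ultimately show ?thesis using nu.AE_in_set_eq_1 by blast
qed

lemma circ_orbit_unit: "(circ_map F ^^ k) (frac p) \<in> {0..<1}"
  by (cases k) (auto simp: circ_map_def frac_lt_1)

lemma f_circ: "f ((circ_map F ^^ k) (frac p)) = f ((F ^^ k) p)"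
proof -
  obtain l :: int where l: "(circ_map F ^^ k) (frac p) = (F ^^ k) (frac p) + of_int l" using circ_iter by blast
  have fp: "frac p = p + of_int (- \<lfloor>p\<rfloor>)" by (simp add: frac_def)
  have "f ((F ^^ k) (frac p)) = f ((F ^^ k) p)" unfolding fp iter_shift by (rule f_shift_int)
  then show ?thesis by (simp add: l)
qed

lemma minimizing_measure:
  "\<exists>mu. mu \<in> inv_measures F \<and> integral\<^sup>L mu f = a \<and>
    (\<forall>nu\<in>inv_measures F. a \<le> integral\<^sup>L nu f \<and> (integral\<^sup>L nu f = a \<longrightarrow> nu = mu))"
proof -
  let ?O = "{(circ_map F ^^ k) (frac p) | k. k < n}"
  obtain mu where mu: "prob_space mu" "sets mu = sets borel" "distr mu borel (circ_map F) = mu"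
    "measure mu ?O = 1" "\<And>g. g \<in> borel_measurable borel \<Longrightarrow> integral\<^sup>L mu g = (\<Sum>k<n. g ((circ_map F ^^ k) (frac p))) / real n"
    using orbit_measure_exists[OF circ_borel circ_per n_pos] by blast
  interpret mu: prob_space mu by fact
  have "?O \<subseteq> {0..<1}" using circ_orbit_unit by blast
  then have "measure mu ?O \<le> measure mu {0..<1}" using mu(2) by (intro mu.finite_measure_mono) auto
  then have "measure mu {0..<1} = 1" using mu(4) mu.prob_le_1[of "{0..<1}"] by linarith
  then have inv: "mu \<in> inv_measures F" using mu by (simp add: inv_measures_def)
  have int: "integral\<^sup>L mu f = a" using mu(5)[OF f_borel] by (simp add: f_circ a_def S_def)
  have "nu = mu" if nu: "nu \<in> inv_measures F" "integral\<^sup>L nu f = a" for nu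
  proof -
    interpret nu: prob_space nu using nu(1) by (rule inv_measureD)
    have supp: "measure nu ?O = 1" using minimal_support[OF nu(1)] nu(2) by simp
    show ?thesis
    proof (rule measure_eqI)
      show "sets nu = sets mu" using mu(2) inv_measureD(2)[OF nu(1)] by simp
      fix A assume "A \<in> sets nu"
      then have A: "A \<in> sets borel" using inv_measureD(2)[OF nu(1)] by simp
      have "measure nu A = measure mu A"
        using invariant_measure_on_orbit_unique[OF circ_borel circ_per inv_measureD(1-3)[OF nu(1)] supp A]
          invariant_measure_on_orbit_unique[OF circ_borel circ_per mu(1-4) A] by simp
      then show "emeasure nu A = emeasure mu A" by (simp add: nu.emeasure_eq_measure mu.emeasure_eq_measure)
    qed
  qed
  moreover have "a \<le> integral\<^sup>L nu f" if "nu \<in> inv_measures F" for nu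
    using integral_lower[OF that] eta measure_nonneg[of nu "{x. far p s0 x}"]
    by (smt (verit) mult_nonneg_nonneg)
  ultimately show ?thesis using inv int by blast
qed

end

definition uniquely_minimized :: "(real \<Rightarrow> real) \<Rightarrow> bool" where
  "uniquely_minimized T \<longleftrightarrow> (\<exists>!mu. lyap_minimizing T mu) \<and>
    (\<forall>mu. lyap_minimizing T mu \<longrightarrow> supported_on_periodic_orbit T mu)"

abbreviation ln_deriv :: "(real \<Rightarrow> real) \<Rightarrow> real \<Rightarrow> real" where
  "ln_deriv F \<equiv> \<lambda>x. ln \<bar>deriv F x\<bar>"

lemma locked_uniquely_minimized:
  assumes "locked F W (ln_deriv F) d c M lam Lam chi K p n v Kv s s0 eta"
  shows "uniquely_minimized F"
proof -
  interpret locked F W "ln_deriv F" d c M lam Lam chi K p n v Kv s s0 eta by fact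
  obtain mu where mu: "mu \<in> inv_measures F" "lyap F mu = a"
    "\<And>nu. nu \<in> inv_measures F \<Longrightarrow> a \<le> lyap F nu"
    "\<And>nu. nu \<in> inv_measures F \<Longrightarrow> lyap F nu = a \<Longrightarrow> nu = mu"
    using minimizing_measure unfolding lyap_def by blast
  have alpha: "alpha F = a"
    unfolding alpha_def
  proof (rule cInf_eq_minimum)
    show "a \<in> lyap F ` inv_measures F" by (rule image_eqI[where x = mu], rule mu(2)[symmetric], rule mu(1))
  qed (use mu(3) in auto)
  have iff: "lyap_minimizing F nu \<longleftrightarrow> nu = mu" for nu
    unfolding lyap_minimizing_def alpha using mu(1,2,4) by blast
  moreover have "supported_on_periodic_orbit F mu"
    unfolding supported_on_periodic_orbit_def
  proof (intro bexI[of _ "frac p"] exI[of _ n] conjI)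
    show "measure mu {(circ_map F ^^ k) (frac p) | k. k < n} = 1"
      using minimal_support[OF mu(1)] mu(2) by (simp add: lyap_def)
  qed (use circ_per n_pos frac_lt_1 in auto)
  ultimately show ?thesis
    unfolding uniquely_minimized_def by (intro conjI ex1I[of _ mu] allI impI) (simp_all only: iff)
qed

section \<open>Uniform expansion near a given map\<close>

lemma cdist_nonneg [simp]: "0 \<le> cdist x y" by (simp add: cdist_def)

lemma cdist_le: "cdist x y \<le> \<bar>x - (y + of_int k)\<bar>"
  using round_diff_minimal[of "x - y" k] by (simp add: cdist_def algebra_simps)

lemma cdist_le_abs: "cdist x y \<le> \<bar>x - y\<bar>"
  using cdist_le[of x y 0] by simp

lemma cdist_attained: "\<exists>k::int. cdist x y = \<bar>x - (y + of_int k)\<bar>"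
  by (rule exI[of _ "round (x - y)"]) (simp add: cdist_def algebra_simps)

lemma cdist_le_1: "cdist x y \<le> 1"
  using of_int_round_abs_le[of "x - y"] by (simp add: cdist_def abs_minus_commute)

lemma cdist_triangle: "cdist x z \<le> cdist x y + cdist y z"
proof -
  obtain k l :: int where "cdist x y = \<bar>x - (y + of_int k)\<bar>" "cdist y z = \<bar>y - (z + of_int l)\<bar>"
    using cdist_attained by metis
  then show ?thesis using cdist_le[of x z "k + l"] by simp
qed

lemma periodic_int:
  fixes g :: "real \<Rightarrow> real"
  assumes "\<And>x. g (x + 1) = g x" shows "g (x + of_int k) = g x"
  using shift_of_int[of g 0 x k] assms by simp

lemma periodic_frac:
  fixes g :: "real \<Rightarrow> real"
  assumes "\<And>x. g (x + 1) = g x" shows "g x = g (frac x)"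
proof -
  have "g x = g (frac x + of_int \<lfloor>x\<rfloor>)" by (simp add: frac_def)
  then show ?thesis using periodic_int[of g, OF assms] by simp
qed

lemma periodic_bounded:
  fixes g :: "real \<Rightarrow> real"
  assumes cont: "continuous_on UNIV g" and per: "\<And>x. g (x + 1) = g x"
  shows "\<exists>C>0. \<forall>x. \<bar>g x\<bar> \<le> C"
proof -
  have "compact (g ` {0..1})"
    using cont by (intro compact_continuous_image) (auto intro: continuous_on_subset)
  then have "bounded (g ` {0..1})" by (rule compact_imp_bounded)
  then obtain C where C: "0 < C" "\<And>x. x \<in> {0..1} \<Longrightarrow> \<bar>g x\<bar> \<le> C"
    unfolding bounded_pos by auto
  have "\<bar>g x\<bar> \<le> C" for x
    using C(2)[of "frac x"] periodic_frac[of g x, OF per] frac_lt_1[of x] by (simp add: less_imp_le)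
  then show ?thesis using C(1) by blast
qed

lemma periodic_uniformly_continuous:
  fixes g :: "real \<Rightarrow> real"
  assumes cont: "continuous_on UNIV g" and per: "\<And>x. g (x + 1) = g x" and "0 < e"
  shows "\<exists>del>0. \<forall>x y. cdist x y < del \<longrightarrow> \<bar>g x - g y\<bar> < e"
proof -
  have "uniformly_continuous_on {-1..2} g"
    using cont by (intro compact_uniformly_continuous) (auto intro: continuous_on_subset)
  then obtain del where del: "0 < del" "\<And>x y. x \<in> {-1..2} \<Longrightarrow> y \<in> {-1..2} \<Longrightarrow> \<bar>y - x\<bar> < del \<Longrightarrow> \<bar>g y - g x\<bar> < e"
    using \<open>0 < e\<close> unfolding uniformly_continuous_on_def dist_real_def by metis
  have "\<bar>g x - g y\<bar> < e" if c: "cdist x y < min del 1" for x y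
  proof -
    obtain k :: int where k: "cdist x y = \<bar>x - (y + of_int k)\<bar>" using cdist_attained by blast
    define y' where "y' = y + of_int (k - \<lfloor>x\<rfloor>)"
    have "\<bar>frac x - y'\<bar> = cdist x y" unfolding k y'_def by (simp add: frac_def algebra_simps)
    then have "\<bar>frac x - y'\<bar> < del" "\<bar>frac x - y'\<bar> < 1" using c by auto
    moreover have "0 \<le> frac x" "frac x < 1" by (simp_all add: frac_lt_1)
    ultimately have "\<bar>y' - frac x\<bar> < del" "y' \<in> {-1..2}" "frac x \<in> {-1..2}"
      unfolding atLeastAtMost_iff by linarith+
    then have "\<bar>g (frac x) - g y'\<bar> < e" using del(2)[of "frac x" y'] by (simp add: abs_minus_commute)
    moreover have "g y' = g y" unfolding y'_def by (rule periodic_int[of g, OF per])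
    ultimately show ?thesis using periodic_frac[of g x, OF per] by simp
  qed
  then show ?thesis using del(1) by (intro exI[of _ "min del 1"]) auto
qed

lemma periodic_holder_cdist:
  fixes g :: "real \<Rightarrow> real"
  assumes per: "\<And>x. g (x + 1) = g x" and h: "\<And>x y. \<bar>g x - g y\<bar> \<le> C * \<bar>x - y\<bar> powr chi"
  shows "\<bar>g x - g y\<bar> \<le> C * cdist x y powr chi"
proof -
  obtain k :: int where k: "cdist x y = \<bar>x - (y + of_int k)\<bar>" using cdist_attained by blast
  show ?thesis using h[of x "y + of_int k"] periodic_int[of g y k, OF per] by (simp add: k)
qed

lemma C1_liftD:
  assumes "C1_circle_lift F"
  shows "(F has_real_derivative deriv F x) (at x)" "continuous_on UNIV (deriv F)" "continuous_on UNIV F"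
    "\<exists>d::int. \<forall>x. F (x + 1) = F x + of_int d" "deriv F (x + 1) = deriv F x"
proof -
  show der: "(F has_real_derivative deriv F x) (at x)" for x
    using assms by (simp add: C1_circle_lift_def DERIV_deriv_iff_real_differentiable)
  show "continuous_on UNIV (deriv F)" using assms by (simp add: C1_circle_lift_def)
  show cont: "continuous_on UNIV F"
    using der by (intro continuous_at_imp_continuous_on) (auto intro: DERIV_isCont)
  have "(\<lambda>x. F (x + 1) - F x) constant_on UNIV"
  proof (rule continuous_discrete_range_constant)
    show "continuous_on UNIV (\<lambda>x. F (x + 1) - F x)"
      by (intro continuous_intros continuous_on_compose2[OF cont]) auto
    show "\<exists>e>0. \<forall>y. y \<in> UNIV \<and> F (y + 1) - F y \<noteq> F (x + 1) - F x \<longrightarrow> e \<le> norm (F (y + 1) - F y - (F (x + 1) - F x))" for x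
    proof (intro exI[of _ 1] conjI allI impI)
      fix y assume ne: "y \<in> UNIV \<and> F (y + 1) - F y \<noteq> F (x + 1) - F x"
      obtain i j :: int where "F (y + 1) - F y = of_int i" "F (x + 1) - F x = of_int j"
        using assms unfolding C1_circle_lift_def by (metis Ints_cases)
      then show "1 \<le> norm (F (y + 1) - F y - (F (x + 1) - F x))" using ne by simp
    qed simp
  qed simp
  then obtain r where r: "\<And>x. F (x + 1) - F x = r" by (auto simp: constant_on_def)
  moreover obtain d :: int where "F (0 + 1) - F 0 = of_int d"
    using assms unfolding C1_circle_lift_def by (metis Ints_cases)
  ultimately have d: "F (x + 1) = F x + of_int d" for x using r[of x] r[of 0] by linarith
  then show "\<exists>d::int. \<forall>x. F (x + 1) = F x + of_int d" by blast
  have "((\<lambda>x. F (x + 1)) has_real_derivative deriv F (x + 1)) (at x)"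
    using der[of "x + 1"] by (simp add: DERIV_shift)
  moreover have "((\<lambda>x. F (x + 1)) has_real_derivative deriv F x) (at x)"
    unfolding d using DERIV_add[OF der[of x] DERIV_const] by simp
  ultimately show "deriv F (x + 1) = deriv F x" by (rule DERIV_unique)
qed

lemma nonzero_continuous_sign:
  fixes g :: "real \<Rightarrow> real"
  assumes cont: "continuous_on UNIV g" and nz: "\<And>x. g x \<noteq> 0"
  shows "\<exists>sg. (sg = 1 \<or> sg = -1) \<and> (\<forall>x. \<bar>g x\<bar> = sg * g x)"
proof -
  have "connected (g ` UNIV)" using cont by (intro connected_continuous_image) auto
  have *: "\<not> (\<exists>x y. g x < 0 \<and> 0 < g y)"
  proof clarify
    fix x y assume "g x < 0" "0 < g y"
    then have "0 \<in> range g"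
      using connectedD_interval[OF \<open>connected (range g)\<close>, of "g x" "g y" 0] by simp
    then show False using nz by (metis imageE)
  qed
  show ?thesis
  proof (cases "0 < g 0")
    case True
    then have "0 < g x" for x using * nz[of x] by (meson linorder_neqE_linordered_idom)
    then show ?thesis by (intro exI[of _ 1]) (simp add: abs_of_pos)
  next
    case False
    then have "g 0 < 0" using nz[of 0] by simp
    then have "g x < 0" for x using * nz[of x] by (meson linorder_neqE_linordered_idom)
    then show ?thesis by (intro exI[of _ "-1"]) (simp add: abs_of_neg)
  qed
qed

text \<open>The metric \<open>W' = (\<Sum>i<m. \<bar>(F ^^ i)'\<bar> / lam ^ i)\<close> absorbs the constant \<open>C\<close> in the definition of
  an expanding map; it is the derivative of a combination of the iterates.\<close>

lemma adapted_coordinate: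
  assumes C1: "C1_circle_lift F" and exp: "expanding F"
  shows "\<exists>W w lam c. (\<forall>x. (W has_real_derivative w x) (at x)) \<and> continuous_on UNIV w \<and>
    (\<forall>x. w (x + 1) = w x) \<and> (\<forall>x. W (x + 1) = W x + c) \<and> (\<forall>x. 1 \<le> w x) \<and> 1 < lam \<and>
    (\<forall>x. lam * w x \<le> w (F x) * \<bar>deriv F x\<bar>)"
proof -
  obtain C lam0 where C: "0 < C" "1 < lam0" "\<And>x n. 1 \<le> n \<Longrightarrow> C * lam0 ^ n \<le> \<bar>deriv (F ^^ n) x\<bar>"
    using exp unfolding expanding_def by blast
  obtain d :: int where d: "\<And>x. F (x + 1) = F x + of_int d" using C1_liftD(4)[OF C1] by blast
  have F'nz: "deriv F x \<noteq> 0" for x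
    using C(3)[of 1 x] C(1,2) by (auto simp: mult_le_0_iff)
  obtain sg where sg: "sg = 1 \<or> sg = -1" "\<And>x. \<bar>deriv F x\<bar> = sg * deriv F x"
    using nonzero_continuous_sign[OF C1_liftD(2)[OF C1] F'nz] by blast
  \<comment> \<open>Any rate strictly between 1 and \<open>lam0\<close> would do: the gap lets
    \<open>(lam0 / lam) ^ m\<close> exceed \<open>1 / C\<close>.\<close>
  define lam where "lam = (1 + lam0) / 2"
  have lam: "1 < lam" "lam < lam0" using C(2) by (auto simp: lam_def)
  obtain m0 where m0: "1 / C < (lam0 / lam) ^ m0" using real_arch_pow[of "lam0 / lam" "1 / C"] lam by auto
  define m where "m = Suc m0"
  have "(lam0 / lam) ^ m0 \<le> (lam0 / lam) ^ m" using lam by (intro power_increasing) (auto simp: m_def)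
  then have "1 / C < (lam0 / lam) ^ m" using m0 by linarith
  then have m: "lam ^ m \<le> C * lam0 ^ m" using C(1) lam by (simp add: power_divide field_simps)
  define P where "P i x = (\<Prod>j<i. deriv F ((F ^^ j) x))" for i x
  have iter_shift: "(F ^^ i) (x + 1) = (F ^^ i) x + of_int (d ^ i)" for i x
  proof (induction i)
    case (Suc i)
    have "F ((F ^^ i) x + of_int (d ^ i)) = F ((F ^^ i) x) + of_int (d ^ i) * of_int d"
      by (rule shift_of_int) (rule d)
    then show ?case using Suc by simp
  qed simp
  have P_der: "((F ^^ i) has_real_derivative P i x) (at x)" for i x
  proof (induction i)
    case (Suc i)
    show ?case using DERIV_chain2[OF C1_liftD(1)[OF C1] Suc] by (simp add: P_def comp_def mult.commute)
  qed (simp add: P_def id_def)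
  have iter_cont: "continuous_on UNIV (F ^^ i)" for i
    using P_der by (intro continuous_at_imp_continuous_on) (auto intro: DERIV_isCont)
  have P_cont: "continuous_on UNIV (P i)" for i
    unfolding P_def[abs_def] by (intro continuous_intros continuous_on_compose2[OF C1_liftD(2)[OF C1] iter_cont]) auto
  have P_per: "P i (x + 1) = P i x" for i x
    unfolding P_def iter_shift by (intro prod.cong refl periodic_int C1_liftD(5)[OF C1])
  have P_abs: "\<bar>P i x\<bar> = sg ^ i * P i x" for i x
    unfolding P_def abs_prod sg(2) by (simp add: prod.distrib)
  have P_step: "P i (F x) * deriv F x = P (Suc i) x" for i x
    unfolding P_def by (subst prod.lessThan_Suc_shift) (simp add: funpow_swap1 mult.commute)
  define w where "w x = (\<Sum>i<m. \<bar>P i x\<bar> / lam ^ i)" for x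
  \<comment> \<open>Since \<open>F'\<close> has the constant sign \<open>sg\<close>, the factor
    \<open>sg ^ i\<close> turns the derivative of the iterate into its absolute value.\<close>
  define W where "W x = (\<Sum>i<m. (sg / lam) ^ i * (F ^^ i) x)" for x
  have "(W has_real_derivative (\<Sum>i<m. (sg / lam) ^ i * P i x)) (at x)" for x
    unfolding W_def by (intro DERIV_sum DERIV_cmult P_der)
  moreover have "(\<Sum>i<m. (sg / lam) ^ i * P i x) = w x" for x
    unfolding w_def P_abs by (intro sum.cong refl) (simp add: power_divide)
  ultimately have der: "(W has_real_derivative w x) (at x)" for x by simp
  have "continuous_on UNIV w" unfolding w_def[abs_def] using lam by (intro continuous_intros P_cont) auto
  moreover have "w (x + 1) = w x" for x by (simp add: w_def P_per)
  moreover have "W (x + 1) = W x + (\<Sum>i<m. (sg / lam) ^ i * of_int (d ^ i))" for x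
    unfolding W_def iter_shift sum.distrib[symmetric] by (simp only: distrib_left)
  moreover have "1 \<le> w x" for x
  proof -
    have "\<bar>P 0 x\<bar> / lam ^ 0 \<le> w x" unfolding w_def using lam by (intro member_le_sum) (auto simp: m_def)
    then show ?thesis by (simp add: P_def)
  qed
  moreover have "lam * w x \<le> w (F x) * \<bar>deriv F x\<bar>" for x
  proof -
    have "deriv (F ^^ m) x = P m x" using P_der by (rule DERIV_imp_deriv)
    then have Pm: "lam ^ m \<le> \<bar>P m x\<bar>" using C(3)[of m x] m by (simp add: m_def)
    \<comment> \<open>The sum shifts by one index: its first term 1 is lost and a last term, at
      least 1 by the choice of \<open>m\<close>, is gained.\<close>
    have "w (F x) * \<bar>deriv F x\<bar> = (\<Sum>i<m. \<bar>P (Suc i) x\<bar> / lam ^ i)"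
      unfolding w_def sum_distrib_right P_step[symmetric] abs_mult by simp
    also have "\<dots> = lam * (\<Sum>i<m. \<bar>P (Suc i) x\<bar> / lam ^ Suc i)"
      unfolding sum_distrib_left using lam by (intro sum.cong) auto
    also have "(\<Sum>i<m. \<bar>P (Suc i) x\<bar> / lam ^ Suc i) = w x + \<bar>P m x\<bar> / lam ^ m - 1"
      using sum.lessThan_Suc_shift[of "\<lambda>i. \<bar>P i x\<bar> / lam ^ i" m] by (simp add: w_def P_def)
    finally have "w (F x) * \<bar>deriv F x\<bar> = lam * (w x + (\<bar>P m x\<bar> / lam ^ m - 1))" by simp
    moreover have "1 \<le> \<bar>P m x\<bar> / lam ^ m" using Pm lam by simp
    ultimately show ?thesis using lam by simp
  qed
  ultimately show ?thesis using der lam(1) by blast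
qed

text \<open>The three parts of \<open>dC1chi\<close> are bounded pointwise, without suprema.
  Expansion is not demanded: close to an expanding map it comes from the common
  \<open>lift_system\<close>.\<close>

definition near_map :: "real \<Rightarrow> real \<Rightarrow> (real \<Rightarrow> real) \<Rightarrow> (real \<Rightarrow> real) \<Rightarrow> bool" where
  "near_map chi e S T \<longleftrightarrow> C1_circle_lift S \<and> (\<forall>x. cdist (S x) (T x) \<le> e) \<and>
    (\<forall>x. \<bar>deriv S x - deriv T x\<bar> \<le> e) \<and>
    (\<forall>x y. \<bar>(deriv S x - deriv T x) - (deriv S y - deriv T y)\<bar> \<le> e * \<bar>x - y\<bar> powr chi)"

lemma near_map_trans:
  assumes "near_map chi e S T" "near_map chi e' S' S" shows "near_map chi (e + e') S' T"
  unfolding near_map_def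
proof (intro conjI allI)
  show "C1_circle_lift S'" using assms(2) by (simp add: near_map_def)
  fix x y
  have "cdist (S' x) (S x) \<le> e'" "cdist (S x) (T x) \<le> e" using assms by (auto simp: near_map_def)
  then show "cdist (S' x) (T x) \<le> e + e'" using cdist_triangle[of "S' x" "T x" "S x"] by linarith
  have "\<bar>deriv S' x - deriv S x\<bar> \<le> e'" "\<bar>deriv S x - deriv T x\<bar> \<le> e" using assms by (auto simp: near_map_def)
  then show "\<bar>deriv S' x - deriv T x\<bar> \<le> e + e'" by linarith
  have "\<bar>(deriv S' x - deriv S x) - (deriv S' y - deriv S y)\<bar> \<le> e' * \<bar>x - y\<bar> powr chi"
    "\<bar>(deriv S x - deriv T x) - (deriv S y - deriv T y)\<bar> \<le> e * \<bar>x - y\<bar> powr chi"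
    using assms by (auto simp: near_map_def)
  then show "\<bar>(deriv S' x - deriv T x) - (deriv S' y - deriv T y)\<bar> \<le> (e + e') * \<bar>x - y\<bar> powr chi"
    unfolding distrib_right by linarith
qed

lemma near_map_mono: "near_map chi e S T \<Longrightarrow> e \<le> e' \<Longrightarrow> near_map chi e' S T"
  unfolding near_map_def by (meson mult_right_mono order_trans powr_ge_zero)

lemma ln_abs_diff_le:
  fixes x y :: real
  assumes "0 < b" "b \<le> \<bar>x\<bar>" "b \<le> \<bar>y\<bar>"
  shows "\<bar>ln \<bar>x\<bar> - ln \<bar>y\<bar>\<bar> \<le> \<bar>x - y\<bar> / b"
proof -
  have *: "ln \<bar>x\<bar> - ln \<bar>y\<bar> \<le> \<bar>x - y\<bar> / b" if "b \<le> \<bar>x\<bar>" "b \<le> \<bar>y\<bar>" for x y :: real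
  proof -
    have "ln \<bar>x\<bar> - ln \<bar>y\<bar> \<le> (\<bar>x\<bar> - \<bar>y\<bar>) / \<bar>y\<bar>" using that assms(1) by (intro ln_diff_le) auto
    also have "\<dots> \<le> \<bar>x - y\<bar> / \<bar>y\<bar>" using that assms(1) by (intro divide_right_mono) auto
    also have "\<dots> \<le> \<bar>x - y\<bar> / b" using that assms(1) by (intro divide_left_mono) auto
    finally show ?thesis .
  qed
  show ?thesis using *[OF assms(2,3)] *[OF assms(3,2)] by (simp add: abs_le_iff abs_minus_commute)
qed

text \<open>The strict inequality for \<open>w\<close> at \<open>T\<close> survives small
  \<open>C^1\<close> changes with the same coordinate \<open>W\<close>. Uniformity of
  \<open>K\<close>, \<open>Lam\<close> and the other constants lets later choices depend on
  \<open>T\<close> alone.\<close>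

lemma uniform_lift_system:
  assumes chi: "0 < chi" "chi \<le> 1" and T: "T \<in> E1chi chi"
  shows "\<exists>W c M lam Lam K e0 b L H. 0 < e0 \<and> 0 < b \<and> 0 \<le> H \<and> (\<forall>S. near_map chi e0 S T \<longrightarrow>
    (\<exists>d. lift_system S W (ln_deriv S) d c M lam Lam chi K) \<and> (\<forall>x. b \<le> \<bar>deriv S x\<bar>) \<and>
    (\<forall>x. \<bar>deriv S x\<bar> \<le> L) \<and> (\<forall>x y. \<bar>deriv S x - deriv S y\<bar> \<le> H * \<bar>x - y\<bar> powr chi))"
proof -
  have C1: "C1_circle_lift T" and ho: "holder_deriv chi T" and ex: "expanding T"
    using T by (auto simp: E1chi_def)
  obtain W w lam1 c where W: "\<And>x. (W has_real_derivative w x) (at x)" and w_cont: "continuous_on UNIV w"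
    and w_per: "\<And>x. w (x + 1) = w x" and W_shift: "\<And>x. W (x + 1) = W x + c"
    and w1: "\<And>x. 1 \<le> w x" and lam1: "1 < lam1" and wT: "\<And>x. lam1 * w x \<le> w (T x) * \<bar>deriv T x\<bar>"
    using adapted_coordinate[OF C1 ex] by blast
  obtain M where M: "0 < M" "\<And>x. \<bar>w x\<bar> \<le> M" using periodic_bounded[OF w_cont w_per] by blast
  have wM: "w x \<le> M" for x using M(2)[of x] by simp
  have T'_cont: "continuous_on UNIV (deriv T)" using C1_liftD(2)[OF C1] .
  obtain L0 where L0: "0 < L0" "\<And>x. \<bar>deriv T x\<bar> \<le> L0"
    using periodic_bounded[OF T'_cont C1_liftD(5)[OF C1]] by blast
  obtain H0 where H0: "\<And>x y. \<bar>deriv T x - deriv T y\<bar> \<le> H0 * cdist x y powr chi" using ho by (auto simp: holder_deriv_def)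
  have H0': "\<bar>deriv T x - deriv T y\<bar> \<le> \<bar>H0\<bar> * \<bar>x - y\<bar> powr chi" for x y
  proof -
    have "H0 * cdist x y powr chi \<le> \<bar>H0\<bar> * cdist x y powr chi" by (intro mult_right_mono) auto
    also have "\<dots> \<le> \<bar>H0\<bar> * \<bar>x - y\<bar> powr chi" using chi cdist_le_abs by (intro mult_left_mono powr_mono2) auto
    finally show ?thesis using H0[of x y] by linarith
  qed
  obtain Ce le where Ce: "0 < Ce" "1 < le" "\<And>x n. 1 \<le> n \<Longrightarrow> Ce * le ^ n \<le> \<bar>deriv (T ^^ n) x\<bar>"
    using ex unfolding expanding_def by blast
  define b where "b = Ce * le / 2"
  have b: "0 < b" using Ce by (simp add: b_def)
  have Tb: "2 * b \<le> \<bar>deriv T x\<bar>" for x using Ce(3)[of 1 x] by (simp add: b_def)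
  define lam where "lam = (1 + lam1) / 2"
  have lam: "1 < lam" "lam < lam1" using lam1 by (auto simp: lam_def)
  define L where "L = L0 + 1"
  define H where "H = \<bar>H0\<bar> + 1"
  \<comment> \<open>Half of the gap between the rates: one half is spent on moving the argument of
    \<open>w\<close>, the other on changing the derivative. As \<open>w\<close> is at least 1, a
    total loss of \<open>lam1 - lam\<close> is absorbed.\<close>
  define g where "g = (lam1 - lam) / 2"
  have g: "0 < g" using lam by (simp add: g_def)
  obtain del where del: "0 < del" "\<And>x y. cdist x y < del \<Longrightarrow> \<bar>w x - w y\<bar> < g / L"
    using periodic_uniformly_continuous[OF w_cont w_per, of "g / L"] g L0 by (auto simp: L_def)
  define e0 where "e0 = min (min 1 b) (min (del / 2) (g / M))"
  have "e0 \<le> del / 2" unfolding e0_def by linarith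
  moreover have "0 < e0" using b del g M by (simp add: e0_def)
  ultimately have e0: "0 < e0" "e0 \<le> 1" "e0 \<le> b" "e0 < del" "e0 \<le> g / M"
    using del by (simp_all add: e0_def min_le_iff_disj)
  define Lam where "Lam = M * L"
  define K where "K = H / b"
  have main: "(\<exists>d. lift_system S W (ln_deriv S) d c M lam Lam chi K) \<and> (\<forall>x. b \<le> \<bar>deriv S x\<bar>) \<and>
    (\<forall>x. \<bar>deriv S x\<bar> \<le> L) \<and> (\<forall>x y. \<bar>deriv S x - deriv S y\<bar> \<le> H * \<bar>x - y\<bar> powr chi)"
    if S: "near_map chi e0 S T" for S
  proof -
    have S1: "C1_circle_lift S" and S0: "\<And>x. cdist (S x) (T x) \<le> e0" and S': "\<And>x. \<bar>deriv S x - deriv T x\<bar> \<le> e0"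
      and SH: "\<And>x y. \<bar>(deriv S x - deriv T x) - (deriv S y - deriv T y)\<bar> \<le> e0 * \<bar>x - y\<bar> powr chi"
      using S by (auto simp: near_map_def)
    obtain d :: int where d: "\<And>x. S (x + 1) = S x + of_int d" using C1_liftD(4)[OF S1] by blast
    have Sb: "b \<le> \<bar>deriv S x\<bar>" for x using Tb[of x] S'[of x] e0 by linarith
    have SL: "\<bar>deriv S x\<bar> \<le> L" for x using L0(2)[of x] S'[of x] e0 by (simp add: L_def)
    have SHo: "\<bar>deriv S x - deriv S y\<bar> \<le> H * \<bar>x - y\<bar> powr chi" for x y
    proof -
      have "e0 * \<bar>x - y\<bar> powr chi \<le> 1 * \<bar>x - y\<bar> powr chi" using e0 by (intro mult_right_mono) auto
      then show ?thesis using SH[of x y] H0'[of x y] unfolding H_def distrib_right by linarith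
    qed
    have wS: "lam * w x \<le> w (S x) * \<bar>deriv S x\<bar>" for x
    proof -
      have "\<bar>w (S x) - w (T x)\<bar> \<le> g / L" using del(2)[of "S x" "T x"] S0[of x] e0 by simp
      then have "\<bar>w (S x) - w (T x)\<bar> * \<bar>deriv S x\<bar> \<le> g / L * L"
        using SL[of x] g L0 by (intro mult_mono) (auto simp: L_def)
      then have 1: "\<bar>w (S x) - w (T x)\<bar> * \<bar>deriv S x\<bar> \<le> g" using L0 by (simp add: L_def)
      have "w (T x) * \<bar>\<bar>deriv S x\<bar> - \<bar>deriv T x\<bar>\<bar> \<le> M * (g / M)"
        using wM[of "T x"] w1[of "T x"] S'[of x] e0 M by (intro mult_mono) auto
      then have 2: "w (T x) * \<bar>\<bar>deriv S x\<bar> - \<bar>deriv T x\<bar>\<bar> \<le> g" using M by simp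
      have "- (\<bar>w (S x) - w (T x)\<bar> * \<bar>deriv S x\<bar>) \<le> (w (S x) - w (T x)) * \<bar>deriv S x\<bar>"
        using mult_right_mono[of "- \<bar>w (S x) - w (T x)\<bar>" "w (S x) - w (T x)" "\<bar>deriv S x\<bar>"] by simp
      moreover have "- (w (T x) * \<bar>\<bar>deriv S x\<bar> - \<bar>deriv T x\<bar>\<bar>) \<le> w (T x) * (\<bar>deriv S x\<bar> - \<bar>deriv T x\<bar>)"
        using mult_left_mono[of "- \<bar>\<bar>deriv S x\<bar> - \<bar>deriv T x\<bar>\<bar>" "\<bar>deriv S x\<bar> - \<bar>deriv T x\<bar>" "w (T x)"] w1[of "T x"] by simp
      ultimately have "w (T x) * \<bar>deriv T x\<bar> - 2 * g \<le> w (S x) * \<bar>deriv S x\<bar>"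
        using 1 2 by (simp add: algebra_simps)
      moreover have "2 * g = lam1 - lam" by (simp add: g_def)
      ultimately have "lam1 * w x - (lam1 - lam) \<le> w (S x) * \<bar>deriv S x\<bar>"
        using order_trans[OF diff_right_mono[OF wT[of x], of "lam1 - lam"]] by simp
      moreover have "(lam1 - lam) * 1 \<le> (lam1 - lam) * w x" using lam w1 by (intro mult_left_mono) auto
      ultimately show ?thesis by (simp add: algebra_simps)
    qed
    have wS2: "w (S x) * \<bar>deriv S x\<bar> \<le> Lam * w x" for x
    proof -
      have "w (S x) * \<bar>deriv S x\<bar> \<le> M * L" using wM SL M by (intro mult_mono) auto
      also have "\<dots> \<le> M * L * w x" using mult_left_mono[OF w1[of x], of "M * L"] M L0 by (simp add: L_def)
      finally show ?thesis by (simp add: Lam_def)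
    qed
    have WS: "((\<lambda>x. W (S x)) has_real_derivative w (S x) * deriv S x) (at x)" for x
      by (rule DERIV_chain2[OF W C1_liftD(1)[OF S1]])
    \<comment> \<open>Cauchy's mean value theorem evaluates both increments at one common point, so
      the pointwise bounds \<open>wS\<close> and \<open>wS2\<close> hold at all distances with the
      same constants.\<close>
    have gm: "\<exists>z. \<bar>W (S x) - W (S y)\<bar> * w z = \<bar>W x - W y\<bar> * (w (S z) * \<bar>deriv S z\<bar>)" for x y
    proof -
      have *: "\<exists>z. \<bar>W (S y) - W (S x)\<bar> * w z = \<bar>W y - W x\<bar> * (w (S z) * \<bar>deriv S z\<bar>)" if xy: "x < y" for x y
      proof -
        obtain z where "(W (S y) - W (S x)) * w z = (W y - W x) * (w (S z) * deriv S z)"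
          using GMVT'[OF xy DERIV_isCont[OF WS] DERIV_isCont[OF W] W WS] by blast
        then have "\<bar>(W (S y) - W (S x)) * w z\<bar> = \<bar>(W y - W x) * (w (S z) * deriv S z)\<bar>" by simp
        moreover have "0 \<le> w z" "0 \<le> w (S z)" using w1[of z] w1[of "S z"] by linarith+
        ultimately show ?thesis by (auto simp: abs_mult)
      qed
      consider "x < y" | "y < x" | "x = y" by linarith
      then show ?thesis using *[of x y] *[of y x] by cases (auto simp: abs_minus_commute)
    qed
    have wpos: "0 < w x" for x using w1[of x] by linarith
    have "lift_system S W (ln_deriv S) d c M lam Lam chi K"
    proof
      show "0 < chi" "chi \<le> 1" "1 < lam" by fact+
      show "continuous_on UNIV S" using C1_liftD(3)[OF S1] .
      show "S (x + 1) = S x + of_int d" for x by (rule d)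
      show "W (x + 1) = W x + c" for x by (rule W_shift)
      have mv: "\<exists>z. \<bar>W x - W y\<bar> = w z * \<bar>x - y\<bar>" for x y
      proof -
        have *: "\<exists>z. \<bar>W y - W x\<bar> = w z * \<bar>y - x\<bar>" if "x < y" for x y
          using MVT2[OF that, of W w] W wpos by (metis abs_mult abs_of_pos mult.commute)
        consider "x < y" | "y < x" | "x = y" by linarith
        then show ?thesis using *[of x y] *[of y x] by cases (auto simp: abs_minus_commute)
      qed
      fix x y
      obtain z where z: "\<bar>W x - W y\<bar> = w z * \<bar>x - y\<bar>" using mv by blast
      show lower: "\<bar>x - y\<bar> \<le> \<bar>W x - W y\<bar>"
        unfolding z using mult_right_mono[OF w1[of z], of "\<bar>x - y\<bar>"] by simp
      show "\<bar>W x - W y\<bar> \<le> M * \<bar>x - y\<bar>"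
        unfolding z using wM[of z] by (rule mult_right_mono) simp
      obtain z where z: "\<bar>W (S x) - W (S y)\<bar> * w z = \<bar>W x - W y\<bar> * (w (S z) * \<bar>deriv S z\<bar>)" using gm by blast
      have "(lam * \<bar>W x - W y\<bar>) * w z = \<bar>W x - W y\<bar> * (lam * w z)" by simp
      also have "\<dots> \<le> \<bar>W (S x) - W (S y)\<bar> * w z" unfolding z using wS[of z] by (rule mult_left_mono) simp
      finally show "lam * \<bar>W x - W y\<bar> \<le> \<bar>W (S x) - W (S y)\<bar>"
        using wpos[of z] by (rule mult_right_le_imp_le)
      have "\<bar>W (S x) - W (S y)\<bar> * w z \<le> \<bar>W x - W y\<bar> * (Lam * w z)"
        unfolding z using wS2[of z] by (rule mult_left_mono) simp
      then have "\<bar>W (S x) - W (S y)\<bar> * w z \<le> (Lam * \<bar>W x - W y\<bar>) * w z" by (simp add: mult_ac)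
      then show "\<bar>W (S x) - W (S y)\<bar> \<le> Lam * \<bar>W x - W y\<bar>"
        using wpos[of z] by (rule mult_right_le_imp_le)
      show "ln_deriv S (x + 1) = ln_deriv S x" by (simp add: C1_liftD(5)[OF S1])
      have "\<bar>ln_deriv S x - ln_deriv S y\<bar> \<le> \<bar>deriv S x - deriv S y\<bar> / b"
        using b Sb by (intro ln_abs_diff_le) auto
      also have "\<dots> \<le> H * \<bar>x - y\<bar> powr chi / b" using b SHo by (intro divide_right_mono) auto
      also have "\<dots> \<le> H * \<bar>W x - W y\<bar> powr chi / b"
        using b chi lower by (intro divide_right_mono mult_left_mono powr_mono2) (auto simp: H_def)
      finally show "\<bar>ln_deriv S x - ln_deriv S y\<bar> \<le> K * \<bar>W x - W y\<bar> powr chi" by (simp add: K_def)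
    qed
    then show ?thesis using Sb SL SHo by blast
  qed
  have "0 \<le> H" by (simp add: H_def)
  then show ?thesis using main e0(1) b by blast
qed

section \<open>Comparison with the \<open>C^{1,chi}\<close> distance\<close>

lemma E1chi_lift: "T \<in> E1chi chi \<Longrightarrow> C1_circle_lift T" by (simp add: E1chi_def)

lemma E1chi_holder:
  assumes "T \<in> E1chi chi"
  shows "\<exists>H\<ge>0. \<forall>x y. \<bar>deriv T x - deriv T y\<bar> \<le> H * cdist x y powr chi"
proof -
  obtain H where H: "\<And>x y. \<bar>deriv T x - deriv T y\<bar> \<le> H * cdist x y powr chi"
    using assms by (auto simp: E1chi_def holder_deriv_def)
  have "H * cdist x y powr chi \<le> \<bar>H\<bar> * cdist x y powr chi" for x y by (intro mult_right_mono) auto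
  then have "\<bar>deriv T x - deriv T y\<bar> \<le> \<bar>H\<bar> * cdist x y powr chi" for x y using H by (rule order_trans[rotated])
  then show ?thesis by (intro exI[of _ "\<bar>H\<bar>"]) simp
qed

abbreviation holder_quotient :: "real \<Rightarrow> (real \<Rightarrow> real) \<Rightarrow> (real \<Rightarrow> real) \<Rightarrow> real \<times> real \<Rightarrow> real" where
  "holder_quotient chi S T \<equiv> \<lambda>p. \<bar>(deriv S (fst p) - deriv T (fst p)) - (deriv S (snd p) - deriv T (snd p))\<bar>
    / cdist (fst p) (snd p) powr chi"

lemma dC1chi_parts:
  assumes S: "S \<in> E1chi chi" and T: "T \<in> E1chi chi"
  shows "bdd_above (range (\<lambda>x. cdist (S x) (T x)))"
    "bdd_above (range (\<lambda>x. \<bar>deriv S x - deriv T x\<bar>))"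
    "bdd_above (holder_quotient chi S T ` {(x, y). cdist x y \<noteq> 0})"
proof -
  show "bdd_above (range (\<lambda>x. cdist (S x) (T x)))" by (rule bdd_aboveI2) (rule cdist_le_1)
  obtain C1 C2 where C: "\<And>x. \<bar>deriv S x\<bar> \<le> C1" "\<And>x. \<bar>deriv T x\<bar> \<le> C2"
    using periodic_bounded[OF C1_liftD(2,5)[OF E1chi_lift[OF S]]] periodic_bounded[OF C1_liftD(2,5)[OF E1chi_lift[OF T]]] by blast
  have "\<bar>deriv S x - deriv T x\<bar> \<le> C1 + C2" for x using C(1)[of x] C(2)[of x] by linarith
  then show "bdd_above (range (\<lambda>x. \<bar>deriv S x - deriv T x\<bar>))" by (rule bdd_aboveI2)
  obtain H1 H2 where H: "\<And>x y. \<bar>deriv S x - deriv S y\<bar> \<le> H1 * cdist x y powr chi" "\<And>x y. \<bar>deriv T x - deriv T y\<bar> \<le> H2 * cdist x y powr chi"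
    using E1chi_holder[OF S] E1chi_holder[OF T] by blast
  show "bdd_above (holder_quotient chi S T ` {(x, y). cdist x y \<noteq> 0})"
  proof (rule bdd_aboveI2[of _ _ "H1 + H2"], clarify)
    fix x y assume "cdist x y \<noteq> 0"
    then have pos: "0 < cdist x y powr chi" by simp
    have "\<bar>(deriv S x - deriv T x) - (deriv S y - deriv T y)\<bar> \<le> (H1 + H2) * cdist x y powr chi"
      using H(1)[of x y] H(2)[of x y] unfolding distrib_right by linarith
    then show "holder_quotient chi S T (x, y) \<le> H1 + H2"
      using pos by (simp add: pos_divide_le_eq)
  qed
qed

lemma dC1chi_pairs_nonempty: "{(x, y). cdist x y \<noteq> 0} \<noteq> {}"
proof -
  have "cdist (1/4) 0 \<noteq> 0" by (simp add: cdist_def round_def)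
  then show ?thesis by blast
qed

lemma near_map_of_dC1chi:
  assumes S: "S \<in> E1chi chi" and T: "T \<in> E1chi chi" and chi: "0 < chi" and lt: "dC1chi chi S T < e"
  shows "near_map chi e S T"
proof -
  let ?q = "holder_quotient chi S T"
  define A1 where "A1 = (SUP x. cdist (S x) (T x))"
  define A2 where "A2 = (SUP x. \<bar>deriv S x - deriv T x\<bar>)"
  define A3 where "A3 = (SUP p\<in>{(x, y). cdist x y \<noteq> 0}. ?q p)"
  note bdd = dC1chi_parts[OF S T]
  have 1: "cdist (S x) (T x) \<le> A1" for x unfolding A1_def using bdd(1) by (intro cSUP_upper) auto
  have 2: "\<bar>deriv S x - deriv T x\<bar> \<le> A2" for x unfolding A2_def using bdd(2) by (intro cSUP_upper) auto
  have 3: "?q (x, y) \<le> A3" if "cdist x y \<noteq> 0" for x y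
    unfolding A3_def using bdd(3) that by (intro cSUP_upper) auto
  have sum: "A1 + A2 + A3 < e" using lt by (simp add: dC1chi_def A1_def A2_def A3_def)
  obtain x0 y0 where xy0: "cdist x0 y0 \<noteq> 0" using dC1chi_pairs_nonempty by auto
  have nn: "0 \<le> A1" "0 \<le> A2" "0 \<le> A3"
    by (rule order_trans[OF _ 1[of 0]], simp, rule order_trans[OF _ 2[of 0]], simp, rule order_trans[OF _ 3[OF xy0]], simp)
  show ?thesis
    unfolding near_map_def
  proof (intro conjI allI)
    show "C1_circle_lift S" by (rule E1chi_lift[OF S])
    fix x y
    show "cdist (S x) (T x) \<le> e" "\<bar>deriv S x - deriv T x\<bar> \<le> e" using 1[of x] 2[of x] sum nn by linarith+
    show "\<bar>(deriv S x - deriv T x) - (deriv S y - deriv T y)\<bar> \<le> e * \<bar>x - y\<bar> powr chi"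
    proof (cases "cdist x y = 0")
      \<comment> \<open>Pairs differing by an integer are missing from the supremum; for them
        periodicity makes the left side zero.\<close>
      case True
      obtain k :: int where k: "cdist x y = \<bar>x - (y + of_int k)\<bar>" using cdist_attained by blast
      then have x: "x = y + of_int k" using True by simp
      have "deriv S x = deriv S y" "deriv T x = deriv T y"
        unfolding x by (rule periodic_int, rule C1_liftD(5)[OF E1chi_lift], fact)+
      then show ?thesis using sum nn by simp
    next
      case False
      then have "0 < cdist x y powr chi" by simp
      moreover have "?q (x, y) \<le> e" using 3[OF False] sum nn by linarith
      ultimately have "\<bar>(deriv S x - deriv T x) - (deriv S y - deriv T y)\<bar> \<le> e * cdist x y powr chi"
        by (simp add: pos_divide_le_eq)
      also have "\<dots> \<le> e * \<bar>x - y\<bar> powr chi"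
        using sum nn chi cdist_le_abs by (intro mult_left_mono powr_mono2) auto
      finally show ?thesis .
    qed
  qed
qed

lemma dC1chi_of_near_map:
  assumes near: "near_map chi e S T" and T: "C1_circle_lift T"
  shows "dC1chi chi S T \<le> 3 * e"
proof -
  have S: "C1_circle_lift S" and n: "\<And>x. cdist (S x) (T x) \<le> e" "\<And>x. \<bar>deriv S x - deriv T x\<bar> \<le> e"
    "\<And>x y. \<bar>(deriv S x - deriv T x) - (deriv S y - deriv T y)\<bar> \<le> e * \<bar>x - y\<bar> powr chi"
    using near by (auto simp: near_map_def)
  have h: "\<bar>(deriv S x - deriv T x) - (deriv S y - deriv T y)\<bar> \<le> e * cdist x y powr chi" for x y
    by (rule periodic_holder_cdist[of "\<lambda>x. deriv S x - deriv T x"])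
       (use n(3) C1_liftD(5)[OF S] C1_liftD(5)[OF T] in auto)
  have "(SUP x. cdist (S x) (T x)) \<le> e" using n(1) by (intro cSUP_least) auto
  moreover have "(SUP x. \<bar>deriv S x - deriv T x\<bar>) \<le> e" using n(2) by (intro cSUP_least) auto
  moreover have "(SUP p\<in>{(x, y). cdist x y \<noteq> 0}. holder_quotient chi S T p) \<le> e"
  proof (rule cSUP_least[OF dC1chi_pairs_nonempty], clarify)
    fix x y assume "cdist x y \<noteq> 0"
    then have pos: "0 < cdist x y powr chi" by simp
    then show "holder_quotient chi S T (x, y) \<le> e"
      using h[of x y] by (simp add: pos_divide_le_eq)
  qed
  ultimately show ?thesis by (simp add: dC1chi_def)
qed

lemma DERIV_abs_lower:
  fixes g :: "real \<Rightarrow> real"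
  assumes der: "(g has_real_derivative l) (at x)" and low: "\<And>y. C * \<bar>y - x\<bar> \<le> \<bar>g y - g x\<bar>"
  shows "C \<le> \<bar>l\<bar>"
proof -
  have "((\<lambda>y. (g y - g x) / (y - x)) \<longlongrightarrow> l) (at x)" using der by (simp add: has_field_derivative_iff)
  then have "((\<lambda>y. \<bar>(g y - g x) / (y - x)\<bar>) \<longlongrightarrow> \<bar>l\<bar>) (at x)" by (rule tendsto_rabs)
  moreover have "eventually (\<lambda>y. C \<le> \<bar>(g y - g x) / (y - x)\<bar>) (at x)"
    unfolding eventually_at using low by (intro exI[of _ 1]) (auto simp: abs_divide pos_le_divide_eq)
  ultimately show ?thesis by (rule tendsto_lowerbound) simp
qed

text \<open>Expansion of distances bounds the difference quotients from below, hence the derivative.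
  The constant \<open>1 / M\<close> is the price of passing from \<open>D\<close> to the Euclidean
  distance.\<close>

lemma (in lift_system) lift_system_expanding:
  assumes C1: "C1_circle_lift F" shows "expanding F"
  unfolding expanding_def
proof (rule exI[of _ "1 / M"], rule conjI, use M_ge_1 in simp, rule exI[of _ lam], intro conjI allI impI)
  fix x n
  have der: "\<exists>l. ((F ^^ n) has_real_derivative l) (at x)" for n
  proof (induction n)
    case (Suc n)
    then obtain l where "((F ^^ n) has_real_derivative l) (at x)" by blast
    from DERIV_chain2[OF C1_liftD(1)[OF C1] this] show ?case by (auto simp: comp_def)
  qed (auto simp: id_def intro: exI[of _ 1])
  then obtain l where l: "((F ^^ n) has_real_derivative l) (at x)" by blast
  have "1 / M * lam ^ n * \<bar>y - x\<bar> \<le> \<bar>(F ^^ n) y - (F ^^ n) x\<bar>" for y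
  proof -
    have "lam ^ n * \<bar>y - x\<bar> \<le> lam ^ n * D y x" using lam D_lower by (intro mult_left_mono) auto
    also have "\<dots> \<le> M * \<bar>(F ^^ n) y - (F ^^ n) x\<bar>" using iter_expand D_upper by (rule order_trans)
    finally show ?thesis using M_ge_1 by (simp add: field_simps)
  qed
  then have "1 / M * lam ^ n \<le> \<bar>l\<bar>" by (rule DERIV_abs_lower[OF l])
  then show "1 / M * lam ^ n \<le> \<bar>deriv (F ^^ n) x\<bar>" using l by (simp add: DERIV_imp_deriv)
qed (rule lam)

section \<open>The local perturbation\<close>

lemma DERIV_transfer:
  assumes "(f has_real_derivative l) (at x)" "eventually (\<lambda>y. f y = g y) (nhds x)"
  shows "(g has_real_derivative l) (at x)"
  using assms DERIV_cong_ev[OF refl assms(2) refl, of l] by blast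

text \<open>The reason for the square in the bump: the cut-off at distance \<open>s\<close> becomes
  differentiable.\<close>

lemma DERIV_pos_part_square: "((\<lambda>y::real. (max 0 y)\<^sup>2) has_real_derivative 2 * max 0 y) (at y)"
proof -
  consider "y < 0" | "0 < y" | "y = 0" by linarith
  then show ?thesis
  proof cases
    case 1
    have "((\<lambda>y::real. 0) has_real_derivative 0) (at y)" by simp
    moreover have "eventually (\<lambda>z. 0 = (max 0 z)\<^sup>2) (nhds y)"
      using eventually_nhds_in_open[of "{..<0}" y] 1 by (auto elim: eventually_mono)
    ultimately have "((\<lambda>y. (max 0 y)\<^sup>2) has_real_derivative 0) (at y)" by (rule DERIV_transfer)
    then show ?thesis using 1 by simp
  next
    case 2
    have "((\<lambda>y::real. y\<^sup>2) has_real_derivative 2 * y) (at y)" by (auto intro!: derivative_eq_intros)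
    moreover have "eventually (\<lambda>z. z\<^sup>2 = (max 0 z)\<^sup>2) (nhds y)"
      using eventually_nhds_in_open[of "{0<..}" y] 2 by (auto elim: eventually_mono)
    ultimately have "((\<lambda>y. (max 0 y)\<^sup>2) has_real_derivative 2 * y) (at y)" by (rule DERIV_transfer)
    then show ?thesis using 2 by simp
  next
    case 3
    have "((\<lambda>h::real. (max 0 h)\<^sup>2 / h) \<longlongrightarrow> 0) (at 0)"
    proof (rule Lim_null_comparison[OF always_eventually])
      show "((\<lambda>h::real. \<bar>h\<bar>) \<longlongrightarrow> 0) (at 0)" by (intro tendsto_eq_intros) auto
    qed (auto simp: power2_eq_square max_def)
    then show ?thesis using 3 by (simp add: has_field_derivative_iff)
  qed
qed

text \<open>With spacing \<open>4 * s\<close>, a point within \<open>3 * s\<close> of one point of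
  \<open>Ob\<close> is more than \<open>s\<close> away from all others.\<close>

locale bump =
  fixes Ob :: "real set" and s chi :: real
  assumes chi: "0 < chi" "chi \<le> 1" and s: "0 < s" and Ob_ne: "Ob \<noteq> {}"
    and Ob_shift: "\<And>x k. x \<in> Ob \<Longrightarrow> x + of_int k \<in> Ob"
    and Ob_sep: "\<And>x y. x \<in> Ob \<Longrightarrow> y \<in> Ob \<Longrightarrow> x \<noteq> y \<Longrightarrow> 4 * s \<le> \<bar>x - y\<bar>"
begin

text \<open>The derivative of \<open>b\<close> is \<open>psi\<close> of the capped power, largest at \<open>0\<close>; since \<open>b\<close> itself vanishes at \<open>0\<close> and for
  \<open>\<bar>t\<bar> \<ge> s\<close>, the change of derivative is compensated inside the \<open>s\<close>-neighbourhood.\<close>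

definition X :: real where "X = s powr chi"
definition psi :: "real \<Rightarrow> real" where "psi y = (X - y) * (X - (1 + 2 * chi) * y) / X"
definition b :: "real \<Rightarrow> real" where "b t = t * (max 0 (X - \<bar>t\<bar> powr chi))\<^sup>2 / X"
definition m :: "real \<Rightarrow> real" where "m x = min s (infdist x Ob)"
definition bump_fun :: "real \<Rightarrow> real" where
  "bump_fun x = (if \<exists>q\<in>Ob. \<bar>x - q\<bar> < s then b (x - (SOME q. q \<in> Ob \<and> \<bar>x - q\<bar> < s)) else 0)"
definition bump_deriv :: "real \<Rightarrow> real" where "bump_deriv x = psi (m x powr chi)"

lemma X_pos: "0 < X" using s by (simp add: X_def)

lemma powr_min: "min X (\<bar>t\<bar> powr chi) = (min s \<bar>t\<bar>) powr chi"
  unfolding X_def using s chi powr_mono2[of chi s "\<bar>t\<bar>"] powr_mono2[of chi "\<bar>t\<bar>" s]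
  by (cases "s \<le> \<bar>t\<bar>") (auto simp: min_def)

lemma b_deriv_pos:
  assumes "0 < t" shows "(b has_real_derivative psi ((min s \<bar>t\<bar>) powr chi)) (at t)"
proof -
  have p: "((\<lambda>t. t powr chi) has_real_derivative chi * t powr (chi - 1)) (at t)"
    using assms by (rule has_real_derivative_powr)
  have "((\<lambda>t. X - t powr chi) has_real_derivative 0 - chi * t powr (chi - 1)) (at t)"
    by (rule DERIV_diff[OF DERIV_const p])
  from DERIV_chain2[OF DERIV_pos_part_square this]
  have "((\<lambda>t. (max 0 (X - t powr chi))\<^sup>2) has_real_derivative 2 * max 0 (X - t powr chi) * (0 - chi * t powr (chi - 1))) (at t)" .
  from DERIV_cdivide[OF DERIV_mult[OF DERIV_ident this], of X]
  have "((\<lambda>t. t * (max 0 (X - t powr chi))\<^sup>2 / X) has_real_derivative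
     (1 * (max 0 (X - t powr chi))\<^sup>2 + (2 * max 0 (X - t powr chi) * (0 - chi * t powr (chi - 1))) * t) / X) (at t)" .
  moreover have "(1 * (max 0 (X - t powr chi))\<^sup>2 + (2 * max 0 (X - t powr chi) * (0 - chi * t powr (chi - 1))) * t) / X
      = psi ((min s \<bar>t\<bar>) powr chi)"
  proof -
    have "t powr (chi - 1) * t = t powr chi" using assms by (simp add: powr_diff)
    then have "(2 * max 0 (X - t powr chi) * (0 - chi * t powr (chi - 1))) * t = - (2 * chi * max 0 (X - t powr chi) * t powr chi)"
      by (simp add: algebra_simps)
    then have "(1 * (max 0 (X - t powr chi))\<^sup>2 + (2 * max 0 (X - t powr chi) * (0 - chi * t powr (chi - 1))) * t) / X
        = ((max 0 (X - t powr chi))\<^sup>2 + - (2 * chi * max 0 (X - t powr chi) * t powr chi)) / X"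
      by (simp only: mult_1)
    also have "\<dots> = psi (min X (t powr chi))"
      unfolding psi_def by (auto simp: min_def max_def power2_eq_square algebra_simps)
    also have "min X (t powr chi) = (min s \<bar>t\<bar>) powr chi" using powr_min[of t] assms by simp
    finally show ?thesis .
  qed
  moreover have "eventually (\<lambda>t. t * (max 0 (X - t powr chi))\<^sup>2 / X = b t) (nhds t)"
  proof -
    have "eventually (\<lambda>t. t \<in> {0<..}) (nhds t)" using assms by (intro eventually_nhds_in_open) auto
    then show ?thesis by eventually_elim (simp add: b_def)
  qed
  ultimately show ?thesis using DERIV_transfer by simp
qed

lemma b_odd: "b (- t) = - b t" by (simp add: b_def)

lemma b_deriv: "(b has_real_derivative psi ((min s \<bar>t\<bar>) powr chi)) (at t)"
proof -
  consider "0 < t" | "t < 0" | "t = 0" by linarith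
  then show ?thesis
  proof cases
    case 1
    then show ?thesis by (rule b_deriv_pos)
  next
    case 2
    then have "(b has_real_derivative psi ((min s \<bar>t\<bar>) powr chi)) (at (- t))" using b_deriv_pos[of "- t"] by simp
    then have "((\<lambda>t. b (- t)) has_real_derivative - psi ((min s \<bar>t\<bar>) powr chi)) (at t)" by (simp add: DERIV_mirror)
    from DERIV_minus[OF this] show ?thesis by (simp add: b_odd)
  next
    case 3
    have "((\<lambda>h. (max 0 (X - \<bar>h\<bar> powr chi))\<^sup>2 / X) \<longlongrightarrow> (max 0 (X - \<bar>0\<bar> powr chi))\<^sup>2 / X) (at 0)"
      using chi X_pos by (intro tendsto_intros) auto
    then have "((\<lambda>h. (max 0 (X - \<bar>h\<bar> powr chi))\<^sup>2 / X) \<longlongrightarrow> X) (at 0)"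
      using X_pos chi by (simp add: power2_eq_square)
    then have "((\<lambda>h. b h / h) \<longlongrightarrow> X) (at 0)"
      by (rule Lim_transform_eventually) (auto simp: eventually_at_filter b_def)
    moreover have "psi 0 = X" using X_pos by (simp add: psi_def)
    moreover have "b 0 = 0" by (simp add: b_def)
    ultimately show ?thesis using 3 s chi by (simp add: has_field_derivative_iff)
  qed
qed

lemma b_zero: "s \<le> \<bar>t\<bar> \<Longrightarrow> b t = 0"
  using powr_mono2[of chi s "\<bar>t\<bar>"] chi s by (simp add: b_def X_def max_def)

lemma b_bound: "\<bar>b t\<bar> \<le> X * \<bar>t\<bar>"
proof -
  have "(max 0 (X - \<bar>t\<bar> powr chi))\<^sup>2 \<le> X\<^sup>2" using X_pos by (intro power_mono) auto
  then have "(max 0 (X - \<bar>t\<bar> powr chi))\<^sup>2 / X \<le> X" using X_pos by (simp add: pos_divide_le_eq power2_eq_square)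
  then have "\<bar>t\<bar> * ((max 0 (X - \<bar>t\<bar> powr chi))\<^sup>2 / X) \<le> \<bar>t\<bar> * X" by (rule mult_left_mono) simp
  then show ?thesis using X_pos by (simp add: b_def abs_mult mult.commute)
qed

lemma nearest_unique:
  assumes "q \<in> Ob" "q' \<in> Ob" "\<bar>x - q\<bar> < 3 * s" "\<bar>x - q'\<bar> < s" shows "q' = q"
  using Ob_sep[OF assms(1,2)] assms(3,4) by (cases "q = q'") auto

text \<open>The radius \<open>3 * s\<close> exceeds the support radius \<open>s\<close>, so the
  formula holds on an open set around the support and nothing has to be glued at distance
  \<open>s\<close>.\<close>

lemma bump_local:
  assumes q: "q \<in> Ob" "\<bar>x - q\<bar> < 3 * s"
  shows "bump_fun x = b (x - q)" "m x = min s \<bar>x - q\<bar>"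
proof -
  show "bump_fun x = b (x - q)"
  proof (cases "\<exists>q'\<in>Ob. \<bar>x - q'\<bar> < s")
    case True
    then have "(SOME q'. q' \<in> Ob \<and> \<bar>x - q'\<bar> < s) \<in> Ob \<and> \<bar>x - (SOME q'. q' \<in> Ob \<and> \<bar>x - q'\<bar> < s)\<bar> < s"
      by (intro someI_ex[of "\<lambda>q'. q' \<in> Ob \<and> \<bar>x - q'\<bar> < s"]) blast
    then have "(SOME q'. q' \<in> Ob \<and> \<bar>x - q'\<bar> < s) = q" using nearest_unique[OF q(1) _ q(2)] by blast
    then show ?thesis using True by (simp add: bump_fun_def)
  next
    case False
    then have "b (x - q) = 0" using q(1) by (intro b_zero) (auto simp: not_less)
    then show ?thesis using False by (auto simp: bump_fun_def)
  qed
  have le: "infdist x Ob \<le> \<bar>x - q\<bar>" using infdist_le[OF q(1), of x] by (simp add: dist_real_def)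
  have "min s \<bar>x - q\<bar> \<le> dist x q'" if "q' \<in> Ob" for q'
    using Ob_sep[OF q(1) that] q(2) by (cases "q = q'") (auto simp: dist_real_def)
  then have "min s \<bar>x - q\<bar> \<le> infdist x Ob" using Ob_ne by (auto simp: infdist_notempty intro!: cINF_greatest)
  then show "m x = min s \<bar>x - q\<bar>" unfolding m_def using le by linarith
qed

lemma m_far: assumes "\<And>q. q \<in> Ob \<Longrightarrow> t \<le> \<bar>x - q\<bar>" "t \<le> s" shows "t \<le> m x"
proof -
  have "t \<le> infdist x Ob" using assms Ob_ne by (auto simp: infdist_notempty dist_real_def intro!: cINF_greatest)
  then show ?thesis using assms(2) by (simp add: m_def)
qed

lemma m_nonneg: "0 \<le> m x" using s by (simp add: m_def infdist_nonneg)
lemma m_le: "m x \<le> s" by (simp add: m_def)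
lemma m_le_dist: "q \<in> Ob \<Longrightarrow> m x \<le> \<bar>x - q\<bar>"
  using infdist_le[of q Ob x] by (simp add: m_def dist_real_def)

lemma m_attained: "m x = s \<or> (\<exists>q\<in>Ob. m x = \<bar>x - q\<bar>)"
proof (cases "\<exists>q\<in>Ob. \<bar>x - q\<bar> < 3 * s")
  case True
  then obtain q where "q \<in> Ob" "m x = min s \<bar>x - q\<bar>" using bump_local by blast
  then show ?thesis by (auto simp: min_def)
next
  case False
  then have "s \<le> m x" using s by (intro m_far) (auto simp: not_less)
  then show ?thesis using m_le[of x] by auto
qed

lemma m_lipschitz: "\<bar>m x - m y\<bar> \<le> \<bar>x - y\<bar>"
proof -
  have "m x \<le> m y + \<bar>x - y\<bar>" for x y
    using infdist_triangle[of x Ob y] by (auto simp: m_def dist_real_def)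
  from this[of x y] this[of y x] show ?thesis by (simp add: abs_le_iff abs_minus_commute)
qed

lemma mc_bounds: "0 \<le> m x powr chi" "m x powr chi \<le> X"
  unfolding X_def using m_le m_nonneg chi by (auto intro: powr_mono2)

lemma bump_has_deriv: "(bump_fun has_real_derivative bump_deriv x) (at x)"
proof (cases "\<exists>q\<in>Ob. \<bar>x - q\<bar> < 3 * s")
  case True
  then obtain q where q: "q \<in> Ob" "\<bar>x - q\<bar> < 3 * s" by blast
  have "((\<lambda>y. b (y + (- q))) has_real_derivative psi ((min s \<bar>x - q\<bar>) powr chi)) (at x)"
    using b_deriv[of "x - q"] DERIV_shift[of b "psi ((min s \<bar>x - q\<bar>) powr chi)" x "- q"] by simp
  moreover have "eventually (\<lambda>y. b (y + (- q)) = bump_fun y) (nhds x)"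
  proof -
    have "eventually (\<lambda>y. y \<in> ball q (3 * s)) (nhds x)"
      using q by (intro eventually_nhds_in_open) (auto simp: dist_real_def abs_minus_commute)
    then show ?thesis
    proof eventually_elim
      case (elim y)
      then have "\<bar>y - q\<bar> < 3 * s" by (simp add: dist_real_def abs_minus_commute)
      then show ?case using bump_local(1)[OF q(1)] by simp
    qed
  qed
  ultimately have "(bump_fun has_real_derivative psi ((min s \<bar>x - q\<bar>) powr chi)) (at x)"
    by (rule DERIV_transfer)
  then show ?thesis using bump_local(2)[OF q] by (simp add: bump_deriv_def)
next
  case False
  have "m x = s" using m_far[of s x] m_le[of x] False s by (force simp: not_less)
  then have "bump_deriv x = 0" by (simp add: bump_deriv_def psi_def X_def)
  moreover have "eventually (\<lambda>y. 0 = bump_fun y) (nhds x)"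
  proof -
    have "eventually (\<lambda>y. y \<in> ball x s) (nhds x)" using s by (intro eventually_nhds_in_open) auto
    then show ?thesis
    proof eventually_elim
      case (elim y)
      have "\<not> \<bar>y - q\<bar> < s" if "q \<in> Ob" for q
      proof -
        have "3 * s \<le> \<bar>x - q\<bar>" using False that by (auto simp: not_less)
        then show ?thesis using elim s by (auto simp: dist_real_def)
      qed
      then show ?case by (auto simp: bump_fun_def)
    qed
  qed
  then have "(bump_fun has_real_derivative 0) (at x)" by (rule DERIV_transfer[OF DERIV_const])
  ultimately show ?thesis by simp
qed

lemma bump_bound: "\<bar>bump_fun x\<bar> \<le> X * m x"
proof (cases "\<exists>q\<in>Ob. \<bar>x - q\<bar> < s")
  case True
  then obtain q where q: "q \<in> Ob" "\<bar>x - q\<bar> < s" by blast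
  then have q3: "\<bar>x - q\<bar> < 3 * s" using s by simp
  show ?thesis using bump_local[OF q(1) q3] q(2) b_bound[of "x - q"] by (simp add: min_def)
next
  case False
  then show ?thesis using X_pos m_nonneg[of x] by (auto simp: bump_fun_def)
qed

lemma m_Ob: "q \<in> Ob \<Longrightarrow> m q = 0"
  using m_le_dist[of q q] m_nonneg[of q] by simp

lemma bump_Ob: "q \<in> Ob \<Longrightarrow> bump_fun q = 0" "q \<in> Ob \<Longrightarrow> bump_deriv q = X"
  using bump_bound[of q] m_Ob[of q] X_pos chi by (simp_all add: bump_deriv_def psi_def)

lemma psi_gain: assumes "0 \<le> y" "y \<le> X" shows "y \<le> X - psi y"
proof -
  have "X - psi y - y = (1 + 2 * chi) * y * (X - y) / X"
    using X_pos by (simp add: psi_def field_simps)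
  moreover have "0 \<le> (1 + 2 * chi) * y * (X - y) / X" using assms X_pos chi by simp
  ultimately show ?thesis by linarith
qed

lemma psi_lipschitz: assumes "0 \<le> y" "y \<le> X" "0 \<le> z" "z \<le> X" shows "\<bar>psi y - psi z\<bar> \<le> 4 * \<bar>y - z\<bar>"
proof -
  have "psi y - psi z = (y - z) * ((1 + 2 * chi) * ((y + z) / X) - (2 + 2 * chi))"
    using X_pos by (simp add: psi_def field_simps)
  moreover have "\<bar>(1 + 2 * chi) * ((y + z) / X) - (2 + 2 * chi)\<bar> \<le> 4"
  proof -
    define r where "r = (y + z) / X"
    have r: "0 \<le> r" "r \<le> 2" unfolding r_def using assms X_pos by (simp_all add: pos_divide_le_eq)
    have "0 \<le> (1 + 2 * chi) * r" using r chi by simp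
    moreover have "(1 + 2 * chi) * r \<le> (1 + 2 * chi) * 2" using r chi by (intro mult_left_mono) auto
    ultimately show ?thesis unfolding r_def[symmetric] using chi by (simp add: abs_le_iff)
  qed
  ultimately show ?thesis by (simp add: abs_mult mult.commute[of 4] mult_left_mono)
qed

text \<open>Hence \<open>1 - eps * bump_deriv\<close>, the derivative of the map to be composed with
  \<open>T\<close>, is smallest on \<open>Ob\<close> and grows at least like the
  \<open>chi\<close>-th power of the capped distance.\<close>

lemma bump_gain: "m x powr chi \<le> X - bump_deriv x"
  unfolding bump_deriv_def using mc_bounds by (rule psi_gain)

text \<open>\<open>psi\<close> is 4-Lipschitz on the interval from 0 to \<open>X\<close> whatever
  \<open>X\<close> is. The constant does not depend on \<open>s\<close>, so thin bumps are no larger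
  in the Hoelder seminorm.\<close>

lemma bump_deriv_holder: "\<bar>bump_deriv x - bump_deriv y\<bar> \<le> 4 * \<bar>x - y\<bar> powr chi"
proof -
  have "\<bar>bump_deriv x - bump_deriv y\<bar> \<le> 4 * \<bar>m x powr chi - m y powr chi\<bar>"
    unfolding bump_deriv_def using mc_bounds by (intro psi_lipschitz)
  also have "\<dots> \<le> 4 * \<bar>m x - m y\<bar> powr chi" using powr_diff_le[OF m_nonneg m_nonneg chi] by simp
  also have "\<dots> \<le> 4 * \<bar>x - y\<bar> powr chi" using m_lipschitz chi by (intro mult_left_mono powr_mono2) auto
  finally show ?thesis .
qed

lemma bump_deriv_bound: "\<bar>bump_deriv x\<bar> \<le> 4 * X"
proof -
  have "psi X = 0" by (simp add: psi_def)
  then have "\<bar>bump_deriv x\<bar> \<le> 4 * \<bar>m x powr chi - X\<bar>"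
    unfolding bump_deriv_def using psi_lipschitz[of "m x powr chi" X] mc_bounds[of x] X_pos by simp
  also have "\<dots> \<le> 4 * X" using mc_bounds[of x] by simp
  finally show ?thesis .
qed

lemma bump_shift: "bump_fun (x + of_int k) = bump_fun x" "m (x + of_int k) = m x"
proof -
  have *: "bump_fun (x + of_int k) = bump_fun x \<and> m (x + of_int k) = m x"
  proof (cases "\<exists>q\<in>Ob. \<bar>x - q\<bar> < 3 * s")
    case True
    then obtain q where q: "q \<in> Ob" "\<bar>x - q\<bar> < 3 * s" by blast
    then have q': "q + of_int k \<in> Ob" "\<bar>(x + of_int k) - (q + of_int k)\<bar> < 3 * s" using Ob_shift by auto
    show ?thesis using bump_local[OF q] bump_local[OF q'] by simp
  next
    case False
    have far: "s \<le> \<bar>x - q\<bar>" if "q \<in> Ob" for q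
    proof -
      have "3 * s \<le> \<bar>x - q\<bar>" using False that by (meson not_less)
      then show ?thesis using s by linarith
    qed
    have far': "s \<le> \<bar>x + of_int k - q\<bar>" if "q \<in> Ob" for q
      using far[OF Ob_shift[OF that, of "- k"]] by simp
    have "s \<le> m x" using far by (intro m_far) auto
    moreover have "s \<le> m (x + of_int k)" using far' by (intro m_far) auto
    ultimately have "m x = s" "m (x + of_int k) = s" using m_le[of x] m_le[of "x + of_int k"] by linarith+
    moreover have "\<not> (\<exists>q\<in>Ob. \<bar>x - q\<bar> < s)" "\<not> (\<exists>q\<in>Ob. \<bar>x + of_int k - q\<bar> < s)"
      using far far' by (meson not_less)+
    then have "bump_fun x = 0" "bump_fun (x + of_int k) = 0"
      unfolding bump_fun_def by (simp_all only: if_False)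
    ultimately show ?thesis by simp
  qed
  then show "bump_fun (x + of_int k) = bump_fun x" "m (x + of_int k) = m x" by auto
qed

lemma bump_deriv_shift: "bump_deriv (x + of_int k) = bump_deriv x"
  by (simp add: bump_deriv_def bump_shift)

end

section \<open>Open and dense\<close>

lemma (in lift_system) orb_mod:
  assumes "per n p" "q \<in> orb p"
  shows "\<exists>i k. i < n \<and> q = (F ^^ i) p + of_int k"
proof -
  obtain i l where q: "q = (F ^^ i) p + of_int l" using assms(2) unfolding orb_def by blast
  have n: "1 \<le> n" using assms(1) by (simp add: per_def)
  have "(F ^^ (i mod n)) p + of_int 0 \<in> orb p" unfolding orb_def by blast
  then have "(F ^^ (i mod n)) p \<in> orb p" by simp
  from orb_per(2)[OF assms(1) this] obtain k :: int
    where "(F ^^ (i div n * n)) ((F ^^ (i mod n)) p) = (F ^^ (i mod n)) p + of_int k" by blast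
  then have "(F ^^ i) p = (F ^^ (i mod n)) p + of_int k" by (simp add: funpow_funpow)
  then have "q = (F ^^ (i mod n)) p + of_int (k + l)" by (simp add: q)
  moreover have "i mod n < n" using n by simp
  ultimately show ?thesis by blast
qed

lemma half_powr_ge:
  fixes t chi :: real
  assumes "0 \<le> t" "0 < chi" "chi \<le> 1"
  shows "t powr chi / 2 \<le> (t / 2) powr chi"
  using powr_subadditive[of "t / 2" "t / 2" chi] assms by simp

text \<open>The orbit continues to a periodic orbit of \<open>R\<close> by closing. Its points, its
  mean and the inequality \<open>key\<close> change by amounts controlled by \<open>tau\<close>, and
  the growth \<open>A * t powr chi\<close> then exceeds the defect everywhere except very near the
  orbit. The hypothesis on \<open>th\<close> is the inequality that \<open>G_shell\<close>
  requires.\<close>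

lemma robust_locking:
  fixes S W v :: "real \<Rightarrow> real" and n :: nat
  assumes IS: "lift_system S W (ln_deriv S) dS c M lam Lam chi K"
    and e0: "0 < e0" and b: "0 < b"
    and near: "\<And>R. near_map chi e0 R S \<Longrightarrow>
      (\<exists>d. lift_system R W (ln_deriv R) d c M lam Lam chi K) \<and> (\<forall>x. b \<le> \<bar>deriv R x\<bar>)"
    and Sb: "\<And>x. b \<le> \<bar>deriv S x\<bar>"
    and per: "lift_system.per S n p"
    and s: "0 < s" "(Lam + 2) * s \<le> 1"
    and sep: "\<And>i j m. i < n \<Longrightarrow> j < n \<Longrightarrow> i \<noteq> j \<Longrightarrow>
      (Lam + 2) * s \<le> \<bar>W ((S ^^ i) p) - W ((S ^^ j) p + of_int m)\<bar>"
    and v_holder: "\<And>x y. \<bar>v x - v y\<bar> \<le> Kv * \<bar>W x - W y\<bar> powr chi" and v_shift: "\<And>x. v (x + 1) = v x"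
    and A: "0 < A"
    and th: "0 < th" "th * (6 + 8 * (lift_system.Q lam chi K + 2 * Kv) / A) \<le> A / 2 * s powr chi"
    and key: "\<And>x t. 0 \<le> t \<Longrightarrow> t \<le> s \<Longrightarrow> lift_system.far S W p t x \<Longrightarrow>
      A * t powr chi - th / real n \<le> ln_deriv S x - (\<Sum>i<n. ln_deriv S ((S ^^ i) p)) / real n + v x - v (S x)"
  shows "\<exists>e'>0. \<forall>R. near_map chi e' R S \<longrightarrow> uniquely_minimized R"
proof -
  interpret IS: lift_system S W "ln_deriv S" dS c M lam Lam chi K by (rule IS)
  define Q where "Q = lift_system.Q lam chi K"
  have Q: "0 \<le> Q" unfolding Q_def by (rule IS.Q_nonneg)
  have chi: "0 < chi" "chi \<le> 1" by (rule IS.chi)+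
  have n: "1 \<le> n" using per by (simp add: IS.per_def)
  obtain kS :: int where kS: "(S ^^ n) p = p + of_int kS" using per by (auto simp: IS.per_def)
  have Kv: "0 \<le> Kv"
    using v_holder[of 1 0] IS.W_lower[of 1 0] by (smt (verit, best) mult_neg_pos powr_gt_zero)
  \<comment> \<open>One \<open>th / n\<close> is the defect in \<open>key\<close>, the other is
    reserved for the passage from \<open>S\<close> to \<open>R\<close>.\<close>
  define eta where "eta = 2 * th / real n"
  have eta: "0 < eta" using th n by (simp add: eta_def)
  \<comment> \<open>At distance \<open>s0 / 2\<close> the gain is at least
    \<open>A * s0 powr chi / 2 = 2 * eta\<close>, so \<open>eta\<close> remains after the
    defect.\<close>
  define s0 where "s0 = (4 * eta / A) powr (1 / chi)"
  have s0: "0 < s0" "s0 powr chi = 4 * eta / A"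
    using eta A chi by (simp_all add: s0_def powr_powr)
  have th_le: "4 * eta / A \<le> 8 * th / A"
    unfolding eta_def using n th A by (simp add: field_simps)
  have C: "0 \<le> 8 * (Q + 2 * Kv) / A" using Q Kv A by simp
  have s0_s: "s0 \<le> s"
  proof -
    have "th * 6 \<le> th * (6 + 8 * (Q + 2 * Kv) / A)" using th C by (intro mult_left_mono) auto
    also have "\<dots> \<le> A / 2 * s powr chi" using th by (simp add: Q_def)
    finally have "8 * th / A \<le> s powr chi" using A th by (simp add: field_simps)
    then have "s0 powr chi \<le> s powr chi" using s0 th_le by linarith
    then show ?thesis using chi s powr_less_mono2[of chi s s0] by (meson less_imp_le not_le)
  qed
  have shell: "real (n + 1) * eta + (Q + 2 * Kv) * s0 powr chi \<le> A * (s powr chi / 2) - eta"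
  proof -
    have "real (n + 2) * eta \<le> 6 * th"
      using n th by (simp add: eta_def field_simps)
    moreover have "(Q + 2 * Kv) * s0 powr chi \<le> (Q + 2 * Kv) * (8 * th / A)"
      unfolding s0(2) using th_le Q Kv by (intro mult_left_mono) auto
    moreover have "6 * th + (Q + 2 * Kv) * (8 * th / A) = th * (6 + 8 * (Q + 2 * Kv) / A)"
      by (simp add: algebra_simps)
    moreover have "th * (6 + 8 * (Q + 2 * Kv) / A) \<le> A * (s powr chi / 2)" using th(2) by (simp add: Q_def)
    moreover have "real (n + 1) * eta + eta = real (n + 2) * eta" by (simp add: algebra_simps)
    ultimately show ?thesis by linarith
  qed
  \<comment> \<open>Admissible jump, raised to the power \<open>chi\<close>: the first bound limits
    the change of \<open>v\<close> and of the mean, the second keeps the new orbit within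
    \<open>s0 / 2\<close> of the old one.\<close>
  define kap where "kap = min (th / (2 * real n * (Kv + Q + 1))) ((s0 / 2) powr chi * IS.lamc / real n)"
  have kap: "0 < kap" "(Kv + Q) * kap \<le> th / (2 * real n)" "real n * kap / IS.lamc \<le> (s0 / 2) powr chi"
  proof -
    show "0 < kap" unfolding kap_def using th n Kv Q s0 IS.lamc_pos by simp
    have "(Kv + Q) * kap \<le> (Kv + Q + 1) * (th / (2 * real n * (Kv + Q + 1)))"
      using \<open>0 < kap\<close> Kv Q th n by (intro mult_mono) (auto simp: kap_def)
    moreover have "z * (th / (2 * real n * z)) = th / (2 * real n)" if "z \<noteq> 0" for z using that by simp
    from this[of "Kv + Q + 1"] have "(Kv + Q + 1) * (th / (2 * real n * (Kv + Q + 1))) = th / (2 * real n)"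
      using Kv Q by linarith
    ultimately show "(Kv + Q) * kap \<le> th / (2 * real n)" by linarith
    have "kap \<le> (s0 / 2) powr chi * IS.lamc / real n" by (simp add: kap_def)
    then show "real n * kap / IS.lamc \<le> (s0 / 2) powr chi" using n IS.lamc_pos by (simp add: field_simps)
  qed
  define tau where "tau = min (min e0 (b * th / (4 * real n))) (kap powr (1 / chi) / M)"
  have M: "1 \<le> M" by (rule IS.M_ge_1)
  have tau: "0 < tau" "tau \<le> e0" "2 * tau / b \<le> th / (2 * real n)" "(M * tau) powr chi \<le> kap"
  proof -
    show "0 < tau" unfolding tau_def using e0 b th n kap M by simp
    show "tau \<le> e0" by (simp add: tau_def)
    have "tau \<le> b * th / (4 * real n)" by (simp add: tau_def)
    then show "2 * tau / b \<le> th / (2 * real n)" using b n by (simp add: field_simps)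
    have "tau \<le> kap powr (1 / chi) / M" by (simp add: tau_def)
    then have "M * tau \<le> kap powr (1 / chi)" using M by (simp add: field_simps)
    then have "(M * tau) powr chi \<le> (kap powr (1 / chi)) powr chi"
      using chi M \<open>0 < tau\<close> by (intro powr_mono2) auto
    then show "(M * tau) powr chi \<le> kap" using chi kap by (simp add: powr_powr)
  qed
  have "uniquely_minimized R" if R: "near_map chi tau R S" for R
  proof -
    have "near_map chi e0 R S" using R tau(2) by (rule near_map_mono)
    from near[OF this] obtain dR where IR: "lift_system R W (ln_deriv R) dR c M lam Lam chi K"
      and Rb: "\<And>x. b \<le> \<bar>deriv R x\<bar>" by blast
    interpret IR: lift_system R W "ln_deriv R" dR c M lam Lam chi K by (rule IR)
    have "\<exists>l::int. \<bar>R x - (S x + of_int l)\<bar> \<le> tau" for x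
    proof -
      obtain l :: int where "cdist (R x) (S x) = \<bar>R x - (S x + of_int l)\<bar>" using cdist_attained by blast
      moreover have "cdist (R x) (S x) \<le> tau" using R by (simp add: near_map_def)
      ultimately show ?thesis by auto
    qed
    then obtain j :: "real \<Rightarrow> int" where j: "\<And>x. \<bar>R x - (S x + of_int (j x))\<bar> \<le> tau" by metis
    have Dj: "IR.D (R x) (S x + of_int (j x)) powr chi \<le> kap" for x
    proof -
      have "IR.D (R x) (S x + of_int (j x)) \<le> M * tau"
        using M j by (intro order_trans[OF IR.D_upper] mult_left_mono) auto
      then have "IR.D (R x) (S x + of_int (j x)) powr chi \<le> (M * tau) powr chi"
        using chi by (intro powr_mono2) auto
      then show ?thesis using tau(4) by linarith
    qed
    \<comment> \<open>The orbit of \<open>S\<close>, lifted with suitable translations, is a closed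
      pseudo-orbit of \<open>R\<close>.\<close>
    define x where "x i = (S ^^ i) p" for i
    define k where "k = rec_nat (0::int) (\<lambda>i t. j (x i) + dR * t)"
    have k: "k 0 = 0" "k (Suc i) = j (x i) + dR * k i" for i by (simp_all add: k_def)
    define y where "y i = x i + of_int (k i)" for i
    have Dy: "IR.D (R (y i)) (y (Suc i)) powr chi \<le> kap" for i
    proof -
      have "R (y i) = R (x i) + of_int (dR * k i)" unfolding y_def by (rule IR.F_shift_int)
      moreover have "y (Suc i) = (S (x i) + of_int (j (x i))) + of_int (dR * k i)"
        by (simp add: y_def k x_def)
      ultimately show ?thesis using Dj[of "x i"] by (simp only: IR.D_shift)
    qed
    have "y n = y 0 + of_int (kS + k n)" by (simp add: y_def x_def k kS)
    from IR.closing[OF n this] obtain p' where p': "(R ^^ n) p' = p' + of_int (kS + k n)"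
      and cl: "(\<Sum>i<n. IR.D ((R ^^ i) p') (y i) powr chi) \<le> (\<Sum>i<n. IR.D (R (y i)) (y (Suc i)) powr chi) / IR.lamc"
      by blast
    have "(\<Sum>i<n. IR.D (R (y i)) (y (Suc i)) powr chi) \<le> (\<Sum>i<n. kap)" using Dy by (intro sum_mono)
    then have cl': "(\<Sum>i<n. IR.D ((R ^^ i) p') (y i) powr chi) \<le> real n * kap / IR.lamc"
      using IR.lamc_pos by (intro order_trans[OF cl] divide_right_mono) auto
    have per': "IR.per n p'" using p' n unfolding IR.per_def by blast
    have Dp: "IR.D ((R ^^ i) p') (y i) \<le> s0 / 2" if "i < n" for i
    proof -
      have "IR.D ((R ^^ i) p') (y i) powr chi \<le> (\<Sum>i<n. IR.D ((R ^^ i) p') (y i) powr chi)"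
        using that by (intro member_le_sum) auto
      then have "IR.D ((R ^^ i) p') (y i) powr chi \<le> (s0 / 2) powr chi" using cl' kap(3) by linarith
      then show ?thesis using chi s0 powr_less_mono2[of chi "s0 / 2" "IR.D ((R ^^ i) p') (y i)"]
        by (meson half_gt_zero less_imp_le not_le)
    qed
    have ff: "\<bar>ln_deriv R x - ln_deriv S x\<bar> \<le> tau / b" for x
    proof -
      have "\<bar>ln_deriv R x - ln_deriv S x\<bar> \<le> \<bar>deriv R x - deriv S x\<bar> / b"
        using b Rb Sb by (intro ln_abs_diff_le)
      also have "\<dots> \<le> tau / b" using R b by (intro divide_right_mono) (auto simp: near_map_def)
      finally show ?thesis .
    qed
    define aS where "aS = (\<Sum>i<n. ln_deriv S ((S ^^ i) p)) / real n"
    have aR: "\<bar>IR.S n p' / real n - aS\<bar> \<le> Q * kap + tau / b"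
    proof -
      have "\<bar>IR.S n p' - (\<Sum>i<n. ln_deriv S ((S ^^ i) p))\<bar>
          \<le> (\<Sum>i<n. \<bar>ln_deriv R ((R ^^ i) p') - ln_deriv S ((S ^^ i) p)\<bar>)"
        unfolding IR.S_def sum_subtractf[symmetric] by (rule sum_abs)
      also have "\<dots> \<le> (\<Sum>i<n. K * IR.D ((R ^^ i) p') (y i) powr chi + tau / b)"
      proof (rule sum_mono)
        fix i
        have "ln_deriv S (y i) = ln_deriv S ((S ^^ i) p)"
          unfolding y_def x_def by (rule IS.f_shift_int)
        moreover have "\<bar>ln_deriv R ((R ^^ i) p') - ln_deriv R (y i)\<bar> \<le> K * IR.D ((R ^^ i) p') (y i) powr chi"
          unfolding IR.D_def by (rule IR.f_holder)
        ultimately show "\<bar>ln_deriv R ((R ^^ i) p') - ln_deriv S ((S ^^ i) p)\<bar>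
            \<le> K * IR.D ((R ^^ i) p') (y i) powr chi + tau / b"
          using ff[of "y i"] by linarith
      qed
      also have "\<dots> = K * (\<Sum>i<n. IR.D ((R ^^ i) p') (y i) powr chi) + real n * (tau / b)"
        by (simp add: sum.distrib sum_distrib_left)
      also have "\<dots> \<le> K * (real n * kap / IR.lamc) + real n * (tau / b)"
        using cl' IR.K_nonneg by (intro add_right_mono mult_left_mono) auto
      also have "\<dots> = real n * (Q * kap + tau / b)"
        by (simp add: Q_def IR.Q_def algebra_simps)
      finally have "\<bar>IR.S n p' - (\<Sum>i<n. ln_deriv S ((S ^^ i) p))\<bar> \<le> real n * (Q * kap + tau / b)" .
      then have "\<bar>IR.S n p' - (\<Sum>i<n. ln_deriv S ((S ^^ i) p))\<bar> / real n \<le> Q * kap + tau / b"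
        using n by (simp add: pos_divide_le_eq mult.commute)
      then show ?thesis using n by (simp add: aS_def diff_divide_distrib[symmetric])
    qed
    have vv: "\<bar>v (R x) - v (S x)\<bar> \<le> Kv * kap" for x
    proof -
      have "v (S x) = v (S x + of_int (j x))" using periodic_int[of v, OF v_shift] by simp
      then have "\<bar>v (R x) - v (S x)\<bar> \<le> Kv * IR.D (R x) (S x + of_int (j x)) powr chi"
        unfolding IR.D_def using v_holder by simp
      also have "\<dots> \<le> Kv * kap" using Dj Kv by (intro mult_left_mono)
      finally show ?thesis .
    qed
    have G: "A * t powr chi - eta \<le> ln_deriv R x - IR.S n p' / real n + v x - v (R x)"
      if "0 \<le> t" "t \<le> s" "IS.far p t x" for x t
    proof -
      have "A * t powr chi - th / real n \<le> ln_deriv S x - aS + v x - v (S x)"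
        unfolding aS_def using that by (rule key)
      moreover have "2 * (tau / b) + (Kv * kap + Q * kap) \<le> th / real n"
      proof -
        have "(Kv + Q) * kap = Kv * kap + Q * kap" "2 * (tau / b) = 2 * tau / b" by (simp_all add: distrib_right)
        moreover have "th / (2 * real n) + th / (2 * real n) = th / real n" using n by (simp add: field_simps)
        ultimately show ?thesis using tau(3) kap(2) by linarith
      qed
      moreover have "eta = th / real n + th / real n" by (simp add: eta_def)
      ultimately show ?thesis using ff[of x] aR vv[of x] by linarith
    qed
    \<comment> \<open>The orbit points have moved by at most \<open>s0 / 2\<close>, hence by at most
      \<open>t / 2\<close>.\<close>
    have far: "IS.far p (t / 2) x" if t: "s0 \<le> t" and farR: "IR.far p' t x" for t x
      unfolding IS.far_def
    proof
      fix q assume "q \<in> IS.orb p"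
      from IS.orb_mod[OF per this] obtain i and l :: int where i: "i < n" and q: "q = (S ^^ i) p + of_int l" by blast
      have "(R ^^ i) p' + of_int (l - k i) \<in> IR.orb p'" unfolding IR.orb_def by blast
      then have 1: "t \<le> IR.D x ((R ^^ i) p' + of_int (l - k i))" using farR by (simp add: IR.far_def)
      have "IR.D ((R ^^ i) p' + of_int (l - k i)) (y i + of_int (l - k i)) \<le> s0 / 2"
        unfolding IR.D_shift using i by (rule Dp)
      moreover have "y i + of_int (l - k i) = q" by (simp add: y_def x_def q)
      ultimately have "IR.D ((R ^^ i) p' + of_int (l - k i)) q \<le> s0 / 2" by simp
      then show "t / 2 \<le> IS.D x q"
        using 1 IR.D_triangle[of x "(R ^^ i) p' + of_int (l - k i)" q] IR.D_sym[of q "(R ^^ i) p' + of_int (l - k i)"] t by linarith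
    qed
    have "locked R W (ln_deriv R) dR c M lam Lam chi K p' n v Kv s s0 eta"
    proof (intro locked.intro locked_axioms.intro)
      show "lift_system R W (ln_deriv R) dR c M lam Lam chi K" by (rule IR)
      show "IR.per n p'" by (rule per')
      show "0 < s0" "s0 \<le> s" "0 < eta" by fact+
      show "\<bar>v x - v y\<bar> \<le> Kv * IR.D x y powr chi" for x y unfolding IR.D_def by (rule v_holder)
      show "v (x + 1) = v x" for x by (rule v_shift)
      fix q q' assume q: "q \<in> IR.orb p'" and q': "q' \<in> IR.orb p'" and ne: "q \<noteq> q'"
      obtain i and l :: int where i: "i < n" "q = (R ^^ i) p' + of_int l" using IR.orb_mod[OF per' q] by blast
      obtain i' and l' :: int where i': "i' < n" "q' = (R ^^ i') p' + of_int l'" using IR.orb_mod[OF per' q'] by blast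
      show "(Lam + 1) * s \<le> IR.D q q'"
      proof (cases "i = i'")
        case True
        then have "l \<noteq> l'" using ne i i' by auto
        then have "1 \<le> \<bar>real_of_int (l - l')\<bar>" by simp
        then have "1 \<le> \<bar>real_of_int (l - l')\<bar> * \<bar>c\<bar>" using IR.c_ge_1 by (metis mult_mono mult_1 abs_ge_zero zero_le_one)
        moreover have "IR.D q q' = \<bar>real_of_int (l - l')\<bar> * \<bar>c\<bar>"
          unfolding IR.D_def i(2) i'(2) True IR.W_shift_int by (simp add: abs_mult[symmetric] algebra_simps)
        ultimately show ?thesis using s by (simp add: algebra_simps)
      next
        \<comment> \<open>Both points moved by at most \<open>s0 / 2\<close>, so the separation
          drops by at most \<open>s0\<close>, which is no more than \<open>s\<close>.\<close>
        case False
        have 1: "IR.D q (y i + of_int l) \<le> s0 / 2" unfolding i(2) IR.D_shift using i(1) by (rule Dp)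
        have 2: "IR.D q' (y i' + of_int l') \<le> s0 / 2" unfolding i'(2) IR.D_shift using i'(1) by (rule Dp)
        have "IR.D (y i + of_int l) (y i' + of_int l') = IR.D (x i) (x i' + of_int (k i' + l' - k i - l))"
          using IR.D_shift[of "x i" "k i + l" "x i' + of_int (k i' + l' - k i - l)"] by (simp add: y_def algebra_simps)
        also have "\<dots> \<ge> (Lam + 2) * s" unfolding IR.D_def x_def using sep[OF i(1) i'(1) False] .
        finally have 3: "(Lam + 2) * s \<le> IR.D (y i + of_int l) (y i' + of_int l')" .
        have "IR.D (y i + of_int l) (y i' + of_int l') \<le> IR.D (y i + of_int l) q + (IR.D q q' + IR.D q' (y i' + of_int l'))"
          by (rule order_trans[OF IR.D_triangle add_left_mono[OF IR.D_triangle]])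
        then show ?thesis using 1 2 3 s0_s IR.D_sym[of q "y i + of_int l"] by (simp add: algebra_simps)
      qed
    next
      fix x
      have "IS.far p 0 x" by (simp add: IS.far_def)
      then show "- eta \<le> ln_deriv R x - IR.S n p' / real n + v x - v (R x)"
        using G[of 0 x] s chi by simp
    next
      fix x assume "IR.far p' s0 x"
      then have "IS.far p (s0 / 2) x" using far by simp
      then have "A * (s0 / 2) powr chi - eta \<le> ln_deriv R x - IR.S n p' / real n + v x - v (R x)"
        using G[of "s0 / 2" x] s0 s0_s by simp
      moreover have "A * (s0 powr chi / 2) \<le> A * (s0 / 2) powr chi"
        using A s0 chi by (intro mult_left_mono half_powr_ge) auto
      moreover have "A * (s0 powr chi / 2) = 2 * eta" using A by (simp add: s0(2))
      ultimately show "eta \<le> ln_deriv R x - IR.S n p' / real n + v x - v (R x)" by linarith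
    next
      fix x assume "IR.far p' s x"
      then have "IS.far p (s / 2) x" using far s0_s by simp
      then have "A * (s / 2) powr chi - eta \<le> ln_deriv R x - IR.S n p' / real n + v x - v (R x)"
        using G[of "s / 2" x] s by simp
      moreover have "A * (s powr chi / 2) \<le> A * (s / 2) powr chi"
        using A s chi by (intro mult_left_mono half_powr_ge) auto
      ultimately show "real (n + 1) * eta + (IR.Q + 2 * Kv) * s0 powr chi
          \<le> ln_deriv R x - IR.S n p' / real n + v x - v (R x)"
        using shell unfolding Q_def by linarith
    qed
    then show ?thesis by (rule locked_uniquely_minimized)
  qed
  then show ?thesis using tau(1) by blast
qed

text \<open>Order of the choices: \<open>eps\<close> from the allowed size, then \<open>A\<close>,
  \<open>del\<close>, \<open>Cs\<close> and \<open>smax\<close> from \<open>eps\<close> and the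
  uniform constants, and only then the orbit with its scale \<open>s\<close>.\<close>

lemma perturbation:
  assumes chi: "0 < chi" "chi \<le> 1" and T: "T \<in> E1chi chi" and e: "0 < e"
  shows "\<exists>S\<in>E1chi chi. near_map chi e S T \<and> (\<exists>e'>0. \<forall>R. near_map chi e' R S \<longrightarrow> uniquely_minimized R)"
proof -
  have T1: "C1_circle_lift T" by (rule E1chi_lift[OF T])
  obtain W c M lam Lam K e0 b L H where e0: "0 < e0" and b: "0 < b" and H: "0 \<le> H"
    and unif: "\<And>S. near_map chi e0 S T \<Longrightarrow>
    (\<exists>d. lift_system S W (ln_deriv S) d c M lam Lam chi K) \<and> (\<forall>x. b \<le> \<bar>deriv S x\<bar>) \<and>
    (\<forall>x. \<bar>deriv S x\<bar> \<le> L) \<and> (\<forall>x y. \<bar>deriv S x - deriv S y\<bar> \<le> H * \<bar>x - y\<bar> powr chi)"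
    using uniform_lift_system[OF chi T] by blast
  have TT: "near_map chi e0 T T" using T1 e0 by (simp add: near_map_def cdist_def)
  obtain dT where IT: "lift_system T W (ln_deriv T) dT c M lam Lam chi K"
    and TL: "\<And>x. \<bar>deriv T x\<bar> \<le> L" and TH: "\<And>x y. \<bar>deriv T x - deriv T y\<bar> \<le> H * \<bar>x - y\<bar> powr chi"
    and Tb: "\<And>x. b \<le> \<bar>deriv T x\<bar>"
    using unif[OF TT] by blast
  interpret IT: lift_system T W "ln_deriv T" dT c M lam Lam chi K by (rule IT)
  define L1 where "L1 = max 1 L"
  have L1: "1 \<le> L1" "\<And>x. \<bar>deriv T x\<bar> \<le> L1" using TL by (auto simp: L1_def le_max_iff_disj)
  have T_lip: "\<bar>T x - T y\<bar> \<le> L1 * \<bar>x - y\<bar>" for x y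
    using field_differentiable_bound[of UNIV T "deriv T" L1 x y] C1_liftD(1)[OF T1] L1(2) by simp
  \<comment> \<open>Bounds the distance from \<open>S\<close> to \<open>T\<close> divided by
    \<open>eps\<close>: 1 for the values, \<open>4 * L1\<close> for the derivatives, the last two
    terms for the Hoelder part by the product rule.\<close>
  define C0 where "C0 = 1 + 4 * L1 + 4 * L1 powr chi * L1 + 4 * H"
  have C0: "0 < C0" "1 \<le> C0" "4 * L1 \<le> C0" "4 * L1 powr chi * L1 + 4 * H \<le> C0"
  proof -
    have "0 \<le> 4 * L1 powr chi * L1" using L1(1) by simp
    then show "0 < C0" "1 \<le> C0" "4 * L1 \<le> C0" "4 * L1 powr chi * L1 + 4 * H \<le> C0"
      unfolding C0_def using L1(1) H by linarith+
  qed
  \<comment> \<open>\<open>1 / 8\<close> keeps \<open>1 - eps * bd\<close> between 1/2 and 2;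
    \<open>e0 / 2\<close> leaves room for maps near \<open>S\<close> inside the uniform
    neighbourhood of \<open>T\<close>.\<close>
  define eps where "eps = min (1 / 8) (min e (e0 / 2) / C0)"
  have eps: "0 < eps" "eps \<le> 1 / 8" "eps * C0 \<le> e" "eps * C0 \<le> e0 / 2"
  proof -
    show "0 < eps" unfolding eps_def using e e0 C0 by simp
    show "eps \<le> 1 / 8" unfolding eps_def by (rule min.cobounded1)
    have "eps \<le> min e (e0 / 2) / C0" unfolding eps_def by (rule min.cobounded2)
    then have "eps * C0 \<le> min e (e0 / 2)" using C0 by (simp add: pos_le_divide_eq)
    then show "eps * C0 \<le> e" "eps * C0 \<le> e0 / 2" by simp_all
  qed
  define Q where "Q = lift_system.Q lam chi K"
  have Q: "0 \<le> Q" unfolding Q_def by (rule IT.Q_nonneg)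
  have M: "1 \<le> M" by (rule IT.M_ge_1)
  define Kv where "Kv = Q + 8"
  define C2 where "C2 = (Q * M powr chi + 8) * L1 powr chi"
  have C2: "0 < C2" unfolding C2_def using Q L1 M by (intro mult_pos_pos add_nonneg_pos) auto
  \<comment> \<open>The bump gains \<open>eps / 2\<close>, of which half pays for the displacement
    from \<open>T x\<close> to \<open>S x\<close>; \<open>M powr chi\<close> converts
    \<open>D\<close> to the Euclidean distance.\<close>
  define A where "A = eps / 4 / M powr chi"
  have A: "0 < A" using eps M by (simp add: A_def)
  \<comment> \<open>The factor in the hypothesis on \<open>th\<close> of
    \<open>robust_locking\<close>; with \<open>th = del * s powr chi\<close> that hypothesis holds
    with equality.\<close>
  define dn where "dn = 6 + 8 * (Q + 2 * Kv) / A"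
  have dn: "0 < dn" unfolding dn_def using Q A by (intro add_pos_nonneg) (auto simp: Kv_def)
  define del where "del = A / 2 / dn"
  have del: "0 < del" "del * dn = A / 2" using A dn by (simp_all add: del_def)
  \<comment> \<open>\<open>Lam + 2\<close> is the separation for \<open>robust_locking\<close>;
    \<open>4 * M\<close> gives the Euclidean spacing \<open>4 * s\<close> of the bump.\<close>
  define Cs where "Cs = Lam + 2 + 4 * M"
  have Cs: "0 < Cs" "Lam + 2 \<le> Cs" "4 * M \<le> Cs" using IT.Lam_ge IT.lam M by (auto simp: Cs_def)
  \<comment> \<open>The last bound is equivalent to \<open>C2 * s powr (chi * chi)\<close> being at
    most \<open>eps / 4\<close>, the condition that absorbs the displacement.\<close>
  define smax where "smax = min (min 1 (1 / Cs)) ((eps / (4 * C2)) powr (1 / (chi * chi)))"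
  have smax: "0 < smax" using Cs eps C2 by (simp add: smax_def)
  obtain n p s where per: "IT.per n p" and s: "0 < s" "s \<le> smax" and E: "IT.E n p \<le> del * s powr chi"
    and sep: "\<And>i j m. i < j \<Longrightarrow> j < n \<Longrightarrow> Cs * s \<le> IT.D ((T ^^ i) p) ((T ^^ j) p + of_int m)"
    using IT.good_orbit[OF del(1) Cs(1) smax] by blast
  have n: "1 \<le> n" using per by (simp add: IT.per_def)
  have s1: "s \<le> 1" "Cs * s \<le> 1" "C2 * (s powr chi) powr chi \<le> eps / 4"
  proof -
    show "s \<le> 1" using s by (simp add: smax_def)
    have "s \<le> 1 / Cs" using s by (simp add: smax_def)
    then show "Cs * s \<le> 1" using Cs by (simp add: field_simps)
    have "s \<le> (eps / (4 * C2)) powr (1 / (chi * chi))" using s by (simp add: smax_def)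
    then have "s powr (chi * chi) \<le> ((eps / (4 * C2)) powr (1 / (chi * chi))) powr (chi * chi)"
      using s chi by (intro powr_mono2) auto
    then have "s powr (chi * chi) \<le> eps / (4 * C2)" using chi eps C2 by (simp add: powr_powr)
    then show "C2 * (s powr chi) powr chi \<le> eps / 4" using C2 by (simp add: powr_powr field_simps)
  qed
  have sep': "Cs * s \<le> IT.D ((T ^^ i) p) ((T ^^ j) p + of_int m)" if "i < n" "j < n" "i \<noteq> j" for i j m
  proof (cases "i < j")
    case False
    then have "Cs * s \<le> IT.D ((T ^^ j) p) ((T ^^ i) p + of_int (- m))" using that by (intro sep) auto
    also have "\<dots> = IT.D ((T ^^ i) p) ((T ^^ j) p + of_int m)"
      using IT.D_shift[of "(T ^^ j) p" m "(T ^^ i) p + of_int (- m)"] by (simp add: IT.D_sym)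
    finally show ?thesis .
  qed (use that sep in blast)
  have orb_sep: "Cs * s \<le> IT.D q q'" if qq: "q \<in> IT.orb p" "q' \<in> IT.orb p" "q \<noteq> q'" for q q'
  proof -
    obtain i and l :: int where i: "i < n" "q = (T ^^ i) p + of_int l" using IT.orb_mod[OF per qq(1)] by blast
    obtain i' and l' :: int where i': "i' < n" "q' = (T ^^ i') p + of_int l'" using IT.orb_mod[OF per qq(2)] by blast
    show ?thesis
    proof (cases "i = i'")
      case True
      then have "l \<noteq> l'" using qq(3) i i' by auto
      then have "1 \<le> \<bar>q - q'\<bar>" using True i i' by simp
      then show ?thesis using IT.D_lower[of q q'] s1 by linarith
    next
      case False
      have "IT.D q q' = IT.D ((T ^^ i) p) ((T ^^ i') p + of_int (l' - l))"
        using IT.D_shift[of "(T ^^ i) p" l "(T ^^ i') p + of_int (l' - l)"] i i' by simp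
      then show ?thesis using sep'[OF i(1) i'(1) False, of "l' - l"] by simp
    qed
  qed
  interpret B: bump "IT.orb p" s chi
  proof
    show "0 < chi" "chi \<le> 1" "0 < s" by fact+
    show "IT.orb p \<noteq> {}" unfolding IT.orb_def by blast
    show "x + of_int k \<in> IT.orb p" if "x \<in> IT.orb p" for x k using that by (rule IT.orb_shift)
    show "4 * s \<le> \<bar>x - y\<bar>" if "x \<in> IT.orb p" "y \<in> IT.orb p" "x \<noteq> y" for x y
    proof -
      have "M * (4 * s) \<le> Cs * s" using Cs s by (simp add: mult.commute[of M] mult_right_mono flip: mult.assoc)
      also have "\<dots> \<le> M * \<bar>x - y\<bar>" using orb_sep[OF that] IT.D_upper by (rule order_trans)
      finally show ?thesis using M by simp
    qed
  qed
  have X1: "B.X \<le> 1" unfolding B.X_def using s s1 chi powr_mono2[of chi s 1] by simp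
  define bu where "bu = B.bump_fun"
  define bd where "bd = B.bump_deriv"
  have bd4: "\<bar>bd x\<bar> \<le> 4" for x using B.bump_deriv_bound[of x] X1 by (simp add: bd_def)
  define S where "S x = T x - eps * bu (T x)" for x
  define S' where "S' x = deriv T x * (1 - eps * bd (T x))" for x
  have S_der: "(S has_real_derivative S' x) (at x)" for x
  proof -
    have "((\<lambda>x. bu (T x)) has_real_derivative bd (T x) * deriv T x) (at x)"
      unfolding bu_def bd_def by (rule DERIV_chain2[OF B.bump_has_deriv C1_liftD(1)[OF T1]])
    from DERIV_diff[OF C1_liftD(1)[OF T1] DERIV_cmult[OF this, of eps]]
    show ?thesis unfolding S_def[abs_def] S'_def by (simp add: algebra_simps)
  qed
  have dS: "deriv S x = S' x" for x using S_der by (rule DERIV_imp_deriv)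
  have bd_cont: "continuous_on UNIV bd"
    unfolding bd_def
  proof (rule IT.holder_continuous)
    fix x y
    have "\<bar>x - y\<bar> powr chi \<le> IT.D x y powr chi" using chi IT.D_lower by (intro powr_mono2) auto
    then show "\<bar>B.bump_deriv x - B.bump_deriv y\<bar> \<le> 4 * IT.D x y powr chi" using B.bump_deriv_holder[of x y] by linarith
  qed
  have S1: "C1_circle_lift S"
    unfolding C1_circle_lift_def
  proof (intro conjI allI)
    show "S differentiable (at x)" for x using S_der by (auto simp: real_differentiable_def)
    have "continuous_on UNIV S'"
      unfolding S'_def[abs_def] by (intro continuous_intros C1_liftD(2)[OF T1] continuous_on_compose2[OF bd_cont C1_liftD(3)[OF T1]]) auto
    then show "continuous_on UNIV (deriv S)" using dS by (simp add: ext[of "deriv S" S'])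
    show "S (x + 1) - S x \<in> \<int>" for x
      using B.bump_shift(1)[of "T x" dT] by (simp add: S_def bu_def IT.F_shift)
  qed
  have near: "near_map chi (eps * C0) S T"
    unfolding near_map_def
  proof (intro conjI allI)
    show "C1_circle_lift S" by (rule S1)
    fix x y
    have "\<bar>bu (T x)\<bar> \<le> 1"
    proof -
      have "\<bar>bu (T x)\<bar> \<le> B.X * B.m (T x)" unfolding bu_def by (rule B.bump_bound)
      also have "\<dots> \<le> 1 * 1" using X1 B.X_pos B.m_nonneg B.m_le[of "T x"] s1 by (intro mult_mono) auto
      finally show ?thesis by simp
    qed
    then have "\<bar>S x - T x\<bar> \<le> eps * C0" using eps C0 by (simp add: S_def abs_mult mult_mono)
    then show "cdist (S x) (T x) \<le> eps * C0" using cdist_le_abs by (rule order_trans[rotated])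
    have diff: "deriv S x - deriv T x = - (eps * (deriv T x * bd (T x)))" for x
      by (simp add: dS S'_def algebra_simps)
    have "\<bar>deriv T x * bd (T x)\<bar> \<le> L1 * 4" unfolding abs_mult using L1 bd4 by (intro mult_mono) auto
    then have "\<bar>deriv T x * bd (T x)\<bar> \<le> C0" using C0 by linarith
    then show "\<bar>deriv S x - deriv T x\<bar> \<le> eps * C0" unfolding diff using eps by (simp add: abs_mult mult_left_mono)
    have "deriv T x * bd (T x) - deriv T y * bd (T y) = deriv T x * (bd (T x) - bd (T y)) + bd (T y) * (deriv T x - deriv T y)"
      by (simp add: algebra_simps)
    then have "\<bar>deriv T x * bd (T x) - deriv T y * bd (T y)\<bar>
        \<le> \<bar>deriv T x\<bar> * \<bar>bd (T x) - bd (T y)\<bar> + \<bar>bd (T y)\<bar> * \<bar>deriv T x - deriv T y\<bar>"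
      by (simp add: abs_mult[symmetric])
    also have "\<dots> \<le> L1 * (4 * (L1 powr chi * \<bar>x - y\<bar> powr chi)) + 4 * (H * \<bar>x - y\<bar> powr chi)"
    proof (intro add_mono mult_mono)
      have "\<bar>bd (T x) - bd (T y)\<bar> \<le> 4 * \<bar>T x - T y\<bar> powr chi" unfolding bd_def by (rule B.bump_deriv_holder)
      also have "\<dots> \<le> 4 * (L1 * \<bar>x - y\<bar>) powr chi" using chi T_lip by (intro mult_left_mono powr_mono2) auto
      finally show "\<bar>bd (T x) - bd (T y)\<bar> \<le> 4 * (L1 powr chi * \<bar>x - y\<bar> powr chi)" by (simp add: powr_mult)
    qed (use L1 bd4 TH in auto)
    also have "\<dots> = (4 * L1 powr chi * L1 + 4 * H) * \<bar>x - y\<bar> powr chi" by (simp add: algebra_simps)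
    also have "\<dots> \<le> C0 * \<bar>x - y\<bar> powr chi" using C0 by (intro mult_right_mono) auto
    finally have "eps * \<bar>deriv T x * bd (T x) - deriv T y * bd (T y)\<bar> \<le> eps * (C0 * \<bar>x - y\<bar> powr chi)"
      using eps by (intro mult_left_mono) auto
    moreover have "(deriv S x - deriv T x) - (deriv S y - deriv T y) = - (eps * (deriv T x * bd (T x) - deriv T y * bd (T y)))"
      unfolding diff by (simp add: algebra_simps)
    ultimately show "\<bar>(deriv S x - deriv T x) - (deriv S y - deriv T y)\<bar> \<le> eps * C0 * \<bar>x - y\<bar> powr chi"
      using eps by (simp add: abs_mult)
  qed
  have near_e0: "near_map chi e0 S T" using near eps e0 by (auto intro: near_map_mono)
  obtain dS' where IS: "lift_system S W (ln_deriv S) dS' c M lam Lam chi K"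
    and Sb: "\<And>x. b \<le> \<bar>deriv S x\<bar>" and SH: "\<And>x y. \<bar>deriv S x - deriv S y\<bar> \<le> H * \<bar>x - y\<bar> powr chi"
    using unif[OF near_e0] by blast
  interpret IS: lift_system S W "ln_deriv S" dS' c M lam Lam chi K by (rule IS)
  have "S \<in> E1chi chi"
  proof -
    have "holder_deriv chi S"
      unfolding holder_deriv_def
      using periodic_holder_cdist[of "deriv S", OF C1_liftD(5)[OF S1] SH] by blast
    then show ?thesis using S1 IS.lift_system_expanding[OF S1] by (simp add: E1chi_def)
  qed
  moreover have "near_map chi e S T" using near eps(3) by (rule near_map_mono)
  moreover have "\<exists>e'>0. \<forall>R. near_map chi e' R S \<longrightarrow> uniquely_minimized R"
  proof -
    define l where "l x = ln (1 - eps * bd x)" for x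
    \<comment> \<open>\<open>g \<circ> T\<close> is conjugate to \<open>T \<circ> g\<close>: adding \<open>l = ln g'\<close> to \<open>u\<close> moves the gain from the point \<open>T x\<close> to \<open>x\<close>.\<close>
    define v where "v x = IT.u x + l x" for x
    have epsbd: "\<bar>eps * bd x\<bar> \<le> 1 / 2" for x
    proof -
      have "\<bar>eps * bd x\<bar> \<le> 1 / 8 * 4" unfolding abs_mult using eps bd4 by (intro mult_mono) auto
      then show ?thesis by simp
    qed
    have l_arg: "1 / 2 \<le> 1 - eps * bd x" "1 - eps * bd x \<le> 2" for x using epsbd[of x] by linarith+
    have fS: "ln_deriv S x = ln_deriv T x + l (T x)" for x
      using Tb[of x] b l_arg[of "T x"] by (simp add: dS S'_def abs_mult l_def ln_mult)
    have l_holder: "\<bar>l x - l y\<bar> \<le> 8 * \<bar>x - y\<bar> powr chi" for x y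
    proof -
      have "\<bar>ln \<bar>1 - eps * bd x\<bar> - ln \<bar>1 - eps * bd y\<bar>\<bar> \<le> \<bar>(1 - eps * bd x) - (1 - eps * bd y)\<bar> / (1 / 2)"
        using l_arg[of x] l_arg[of y] by (intro ln_abs_diff_le) auto
      moreover have "\<bar>1 - eps * bd x\<bar> = 1 - eps * bd x" "\<bar>1 - eps * bd y\<bar> = 1 - eps * bd y"
        using l_arg(1)[of x] l_arg(1)[of y] by linarith+
      ultimately have "\<bar>l x - l y\<bar> \<le> 2 * \<bar>eps * (bd y - bd x)\<bar>" by (simp add: l_def algebra_simps)
      also have "\<dots> \<le> 2 * (1 * (4 * \<bar>y - x\<bar> powr chi))"
        unfolding abs_mult bd_def using eps B.bump_deriv_holder by (intro mult_left_mono mult_mono) auto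
      finally show ?thesis by (simp add: abs_minus_commute)
    qed
    have v_holder: "\<bar>v x - v y\<bar> \<le> Kv * \<bar>W x - W y\<bar> powr chi" for x y
    proof -
      have "\<bar>x - y\<bar> powr chi \<le> \<bar>W x - W y\<bar> powr chi" using chi IT.W_lower by (intro powr_mono2) auto
      moreover have "\<bar>IT.u x - IT.u y\<bar> \<le> Q * \<bar>W x - W y\<bar> powr chi"
        using IT.u_holder[of x y] by (simp add: IT.D_def Q_def)
      ultimately show ?thesis using l_holder[of x y] by (simp add: v_def Kv_def distrib_right)
    qed
    have v_shift: "v (x + 1) = v x" for x
      using IT.u_shift_int[of x 1] B.bump_deriv_shift[of x 1] by (simp add: v_def l_def bd_def)
    have orbT: "(T ^^ i) p \<in> IT.orb p" for i
    proof -
      have "(T ^^ i) p + of_int 0 \<in> IT.orb p" unfolding IT.orb_def by blast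
      then show ?thesis by simp
    qed
    \<comment> \<open>The bump vanishes on the orbit, so the orbit is kept pointwise and only its
      derivatives change.\<close>
    have iter: "(S ^^ i) p = (T ^^ i) p" for i
    proof (induction i)
      case (Suc i)
      have "bu (T ((T ^^ i) p)) = 0" unfolding bu_def using orbT[of "Suc i"] by (intro B.bump_Ob) simp
      then show ?case using Suc by (simp add: S_def)
    qed simp
    define l0 where "l0 = ln (1 - eps * B.X)"
    have l_orb: "l q = l0" if "q \<in> IT.orb p" for q using B.bump_Ob(2)[OF that] by (simp add: l_def l0_def bd_def)
    have perS: "IS.per n p" using per by (simp add: IS.per_def IT.per_def iter)
    have sumS: "(\<Sum>i<n. ln_deriv S ((S ^^ i) p)) / real n = IT.alph + IT.E n p / real n + l0"
    proof -
      have "(\<Sum>i<n. ln_deriv S ((S ^^ i) p)) = (\<Sum>i<n. ln_deriv T ((T ^^ i) p) + l0)"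
        using fS l_orb orbT[of "Suc _"] by (intro sum.cong refl) (simp add: iter)
      also have "\<dots> = IT.S n p + real n * l0" by (simp add: sum.distrib IT.S_def)
      finally show ?thesis using n by (simp add: IT.E_def add_divide_distrib diff_divide_distrib)
    qed
    \<comment> \<open>Half of the gain in the derivative survives the logarithm, since
      \<open>1 - eps * bd x\<close> is at most 2.\<close>
    have gain: "eps / 2 * B.m x powr chi \<le> l x - l0" for x
    proof -
      define y where "y = 1 - eps * bd x"
      define z where "z = 1 - eps * B.X"
      have y: "1 / 2 \<le> y" "y \<le> 2" unfolding y_def by (rule l_arg)+
      have z: "0 < z" unfolding z_def using mult_mono[of eps "1 / 8" B.X 1] eps X1 B.X_pos by linarith
      have yz: "eps * B.m x powr chi \<le> y - z"
        using mult_left_mono[OF B.bump_gain[of x], of eps] eps by (simp add: y_def z_def bd_def algebra_simps)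
      then have yz0: "0 \<le> y - z" using eps B.mc_bounds(1)[of x] by (meson mult_nonneg_nonneg less_imp_le order_trans)
      have "ln z - ln y \<le> (z - y) / y" using y z by (intro ln_diff_le) auto
      then have "(y - z) / y \<le> ln y - ln z" using y by (simp add: field_simps)
      moreover have "(y - z) / 2 \<le> (y - z) / y" using yz0 y by (intro divide_left_mono) auto
      ultimately have "(y - z) / 2 \<le> ln y - ln z" by (rule order_trans[rotated])
      moreover have "eps * B.m x powr chi / 2 \<le> (y - z) / 2" using yz by (rule divide_right_mono) simp
      ultimately have "eps * B.m x powr chi / 2 \<le> ln y - ln z" by (rule order_trans[rotated])
      then show ?thesis by (simp add: y_def z_def l_def l0_def)
    qed
    have mT: "B.m (T x) \<le> L1 * B.m x" for x
    proof -
      consider "B.m x = s" | q where "q \<in> IT.orb p" "B.m x = \<bar>x - q\<bar>" using B.m_attained by blast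
      then show ?thesis
      proof cases
        case 1
        have "1 * s \<le> L1 * s" using L1 s by (intro mult_right_mono) auto
        then show ?thesis using B.m_le[of "T x"] 1 by simp
      next
        case 2
        have "B.m (T x) \<le> \<bar>T x - T q\<bar>" using IT.orb_F[OF 2(1)] by (rule B.m_le_dist)
        then show ?thesis using T_lip[of x q] 2(2) by simp
      qed
    qed
    \<comment> \<open>The displacement is at most \<open>X * L1 * m x\<close>; raised to the power
      \<open>chi\<close>, it carries the small factor \<open>s powr (chi * chi)\<close>.\<close>
    have small: "(Q * M powr chi + 8) * \<bar>T x - S x\<bar> powr chi \<le> eps / 4 * B.m x powr chi" for x
    proof -
      have "\<bar>T x - S x\<bar> = eps * \<bar>bu (T x)\<bar>" using eps by (simp add: S_def abs_mult)
      also have "\<dots> \<le> 1 * (B.X * B.m (T x))"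
        unfolding bu_def using eps B.bump_bound by (intro mult_mono) auto
      also have "\<dots> \<le> B.X * (L1 * B.m x)" using mT[of x] B.X_pos by simp
      finally have "\<bar>T x - S x\<bar> powr chi \<le> (B.X * (L1 * B.m x)) powr chi"
        using chi by (intro powr_mono2) auto
      then have "(Q * M powr chi + 8) * \<bar>T x - S x\<bar> powr chi \<le> (Q * M powr chi + 8) * (B.X powr chi * (L1 powr chi * B.m x powr chi))"
        using Q by (intro mult_left_mono) (simp_all add: powr_mult)
      also have "\<dots> = (C2 * (s powr chi) powr chi) * B.m x powr chi" by (simp add: C2_def B.X_def)
      also have "\<dots> \<le> eps / 4 * B.m x powr chi" using s1(3) by (intro mult_right_mono) auto
      finally show ?thesis .
    qed
    have u_err: "\<bar>IT.u (T x) - IT.u (S x)\<bar> \<le> Q * M powr chi * \<bar>T x - S x\<bar> powr chi" for x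
    proof -
      have "IT.D (T x) (S x) powr chi \<le> (M * \<bar>T x - S x\<bar>) powr chi" using chi IT.D_upper by (intro powr_mono2) auto
      then have "Q * IT.D (T x) (S x) powr chi \<le> Q * (M powr chi * \<bar>T x - S x\<bar> powr chi)"
        using Q by (intro mult_left_mono) (simp_all add: powr_mult)
      then show ?thesis using IT.u_holder[of "T x" "S x"] by (simp add: Q_def)
    qed
    \<comment> \<open>Regrouped, the right side is the nonnegative \<open>fbar\<close>, the gain
      \<open>l x - l0\<close>, two differences between \<open>T x\<close> and \<open>S x\<close>
      covered by half of that gain, and \<open>- E / n\<close> from the mean over the orbit.\<close>
    have lower: "eps / 4 * B.m x powr chi - IT.E n p / real n
        \<le> ln_deriv S x - (\<Sum>i<n. ln_deriv S ((S ^^ i) p)) / real n + v x - v (S x)" for x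
    proof -
      have "ln_deriv S x - (\<Sum>i<n. ln_deriv S ((S ^^ i) p)) / real n + v x - v (S x)
          = IT.fbar x + (IT.u (T x) - IT.u (S x)) + (l (T x) - l (S x)) + (l x - l0) - IT.E n p / real n"
        unfolding sumS fS[of x] by (simp add: v_def IT.fbar_def)
      moreover have "- (eps / 4 * B.m x powr chi) \<le> (IT.u (T x) - IT.u (S x)) + (l (T x) - l (S x))"
        using u_err[of x] l_holder[of "T x" "S x"] small[of x] unfolding distrib_right by linarith
      moreover have "eps / 2 * B.m x powr chi = eps / 4 * B.m x powr chi + eps / 4 * B.m x powr chi" by simp
      ultimately show ?thesis using IT.fbar_nonneg[of x] gain[of x] by linarith
    qed
    have key: "A * t powr chi - (del * s powr chi) / real n
        \<le> ln_deriv S x - (\<Sum>i<n. ln_deriv S ((S ^^ i) p)) / real n + v x - v (S x)"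
      if t: "0 \<le> t" "t \<le> s" and far: "IS.far p t x" for x t
    proof -
      have "t / M \<le> B.m x"
      proof (rule B.m_far)
        show "t / M \<le> s" using t M mult_mono[of 1 M t t] by (simp add: pos_divide_le_eq) (smt (verit) mult_left_mono mult.commute mult_1)
        fix q assume "q \<in> IT.orb p"
        then have "q \<in> IS.orb p"
          using IT.orb_mod[OF per, of q] unfolding IS.orb_def iter by blast
        then have "t \<le> M * \<bar>x - q\<bar>" using far IS.D_upper[of x q] unfolding IS.far_def by (meson order_trans)
        then show "t / M \<le> \<bar>x - q\<bar>" using M by (simp add: pos_divide_le_eq mult.commute)
      qed
      then have "(t / M) powr chi \<le> B.m x powr chi" using chi t M by (intro powr_mono2) auto
      then have "eps / 4 * (t / M) powr chi \<le> eps / 4 * B.m x powr chi" using eps by (intro mult_left_mono) auto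
      moreover have "eps / 4 * (t / M) powr chi = A * t powr chi" by (simp add: A_def powr_divide)
      moreover have "IT.E n p / real n \<le> (del * s powr chi) / real n" using E by (intro divide_right_mono) auto
      ultimately show ?thesis using lower[of x] by linarith
    qed
    show ?thesis
    proof (rule robust_locking[where W = W and v = v and s = s and p = p and n = n and A = A
          and th = "del * s powr chi" and Kv = Kv and b = b and ?e0.0 = "e0 / 2"])
      show "lift_system S W (ln_deriv S) dS' c M lam Lam chi K" by (rule IS)
      show "0 < e0 / 2" "0 < b" "0 < s" "0 < A" using e0 b s A by auto
      show "(\<exists>d. lift_system R W (ln_deriv R) d c M lam Lam chi K) \<and> (\<forall>x. b \<le> \<bar>deriv R x\<bar>)"
        if "near_map chi (e0 / 2) R S" for R
      proof -
        have "near_map chi (eps * C0 + e0 / 2) R T" using near that by (rule near_map_trans)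
        then have "near_map chi e0 R T" using eps(4) by (auto intro: near_map_mono)
        then show ?thesis using unif by blast
      qed
      show "b \<le> \<bar>deriv S x\<bar>" for x by (rule Sb)
      show "IS.per n p" by (rule perS)
      have Ls: "(Lam + 2) * s \<le> Cs * s" using Cs s by (intro mult_right_mono) auto
      then show "(Lam + 2) * s \<le> 1" using s1 by linarith
      show "(Lam + 2) * s \<le> \<bar>W ((S ^^ i) p) - W ((S ^^ j) p + of_int m)\<bar>" if "i < n" "j < n" "i \<noteq> j" for i j m
        using sep'[OF that, of m] Ls by (simp add: IT.D_def iter)
      show "\<bar>v x - v y\<bar> \<le> Kv * \<bar>W x - W y\<bar> powr chi" for x y by (rule v_holder)
      show "v (x + 1) = v x" for x by (rule v_shift)
      show "0 < del * s powr chi" using del s by simp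
      show "del * s powr chi * (6 + 8 * (IS.Q + 2 * Kv) / A) \<le> A / 2 * s powr chi"
      proof -
        have "del * s powr chi * dn = A / 2 * s powr chi" unfolding del(2)[symmetric] by simp
        then show ?thesis by (simp only: dn_def Q_def)
      qed
      show "A * t powr chi - del * s powr chi / real n
        \<le> ln_deriv S x - (\<Sum>i<n. ln_deriv S ((S ^^ i) p)) / real n + v x - v (S x)"
        if "0 \<le> t" "t \<le> s" "IS.far p t x" for x t
        using that by (rule key)
    qed
  qed
  ultimately show ?thesis by blast
qed

theorem theoremC:
  fixes chi :: real
  assumes "0 < chi" and "chi \<le> 1"
  shows "\<exists>U. open_in_E chi U \<and> dense_in_E chi U \<and>
    (\<forall>T\<in>U. (\<exists>!\<mu>. lyap_minimizing T \<mu>) \<and>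
             (\<forall>\<mu>. lyap_minimizing T \<mu> \<longrightarrow> supported_on_periodic_orbit T \<mu>))"
proof -
  \<comment> \<open>The interior of the set of uniquely minimized maps. Openness goes through
    \<open>near_map\<close>, which adds up along a chain: two radii \<open>e / 8\<close> give
    \<open>e / 4\<close>, and the factor 3 of \<open>dC1chi_of_near_map\<close> stays below
    \<open>e\<close>.\<close>
  define U where "U = {S \<in> E1chi chi. \<exists>e>0. \<forall>R\<in>E1chi chi. dC1chi chi R S < e \<longrightarrow> uniquely_minimized R}"
  have close: "dC1chi chi R T < e" if "near_map chi (e / 4) R T" "T \<in> E1chi chi" "0 < e" for R T e
    using dC1chi_of_near_map[OF that(1) E1chi_lift[OF that(2)]] that(3) by linarith
  have "open_in_E chi U"
    unfolding open_in_E_def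
  proof (intro conjI ballI)
    show "U \<subseteq> E1chi chi" by (auto simp: U_def)
    fix T assume "T \<in> U"
    then obtain e where T: "T \<in> E1chi chi" and e: "0 < e"
      and good: "\<And>R. R \<in> E1chi chi \<Longrightarrow> dC1chi chi R T < e \<Longrightarrow> uniquely_minimized R"
      by (auto simp: U_def)
    have "S \<in> U" if S: "S \<in> E1chi chi" "dC1chi chi S T < e / 8" for S
    proof -
      have "uniquely_minimized R" if R: "R \<in> E1chi chi" "dC1chi chi R S < e / 8" for R
      proof -
        have "near_map chi (e / 8 + e / 8) R T"
          using near_map_of_dC1chi[OF S(1) T assms(1) S(2)] near_map_of_dC1chi[OF R(1) S(1) assms(1) R(2)]
          by (rule near_map_trans)
        then have "dC1chi chi R T < e" using close[OF _ T e] by simp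
        then show ?thesis using good R(1) by blast
      qed
      then show ?thesis using S(1) e by (auto simp: U_def intro!: exI[of _ "e / 8"])
    qed
    then show "\<exists>e>0. \<forall>S\<in>E1chi chi. dC1chi chi S T < e \<longrightarrow> S \<in> U"
      using e by (intro exI[of _ "e / 8"]) auto
  qed
  moreover have "dense_in_E chi U"
    unfolding dense_in_E_def
  proof (intro ballI allI impI)
    fix T e assume T: "T \<in> E1chi chi" and e: "0 < (e::real)"
    obtain S e' where S: "S \<in> E1chi chi" "near_map chi (e / 4) S T" "0 < e'"
      "\<And>R. near_map chi e' R S \<Longrightarrow> uniquely_minimized R"
      using perturbation[OF assms T, of "e / 4"] e by auto
    have "S \<in> U"
      using S near_map_of_dC1chi[OF _ S(1) assms(1), of _ e'] by (auto simp: U_def intro!: exI[of _ e'])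
    then show "\<exists>S\<in>U. dC1chi chi S T < e" using close[OF S(2) T e] by blast
  qed
  moreover have "uniquely_minimized T" if "T \<in> U" for T
  proof -
    obtain e where T: "T \<in> E1chi chi" and e: "0 < e"
      and good: "\<And>R. R \<in> E1chi chi \<Longrightarrow> dC1chi chi R T < e \<Longrightarrow> uniquely_minimized R"
      using \<open>T \<in> U\<close> by (auto simp: U_def)
    have "near_map chi (e / 4) T T" using E1chi_lift[OF T] e by (simp add: near_map_def cdist_def)
    then show ?thesis using good[OF T close[OF _ T e]] by blast
  qed
  ultimately show ?thesis unfolding uniquely_minimized_def by blast
qed

end
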